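(* The system $\mathsf{P}_0$ proves $\mathsf{MCT}_{\mathsf{ns}}\leftrightarrow\Pi^0_1\text{-}\mathsf{TRANS}$, and from this proof one can extract closed terms $s,u$ such that $\mathsf{E\text{-}PRA}^{\omega*}$ proves $$(\forall\mu^2)\big[\mathsf{MU}(\mu)\to\mathsf{MCT}_{\mathsf{ef}}(s(\mu))\big]\wedge(\forall t)\big[\mathsf{MCT}_{\mathsf{ef}}(t)\to\mathsf{MU}(u(t))\big].$$ Here: $\mathsf{MCT}_{\mathsf{ns}}$: $(\forall^{\mathrm{st}}c_{(\cdot)}^{0\to1})\big[(\forall n^0)(c_n\le c_{n+1}\le 1)\to(\forall N,M\in\Omega)(c_M\approx c_N)\big]$; $\mathsf{MCT}_{\mathsf{ef}}(t)$: $(\forall c_{(\cdot)}^{0\to1},k^0)\big[(\forall n^0)(c_n\le c_{n+1}\le1)\to(\forall N,M\ge t(c_{(\cdot)})(k))(|c_M-c_N|\le\frac1k)\big]$; $\mathsf{MU}(\mu)$: $(\forall f^1)\big((\exists n)f(n)=0\to f(\mu(f))=0\big)$; $\Pi^0_1\text{-}\mathsf{TRANS}$: $(\forall^{\mathrm{st}}f^1)\big[(\forall^{\mathrm{st}}n^0)f(n)\ne0\to(\forall m)f(m)\ne0\big]$.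
   Context: $\mathsf{E\text{-}PRA}^{\omega*}$: Kohlenbach's extensional primitive recursive arithmetic in all finite types with finite sequence types. Add predicate $\mathrm{st}$ for each type; $(\forall^{\mathrm{st}}x)A:\equiv(\forall x)(\mathrm{st}(x)\to A)$, $(\exists^{\mathrm{st}}x)A:\equiv(\exists x)(\mathrm{st}(x)\wedge A)$; internal = no $\mathrm{st}$; $N\in\Omega$ means $\neg\mathrm{st}(N^0)$. $\mathsf{P}_0:=\mathsf{E\text{-}PRA}^{\omega*}+\mathcal{T}^*_{\mathrm{st}}+\mathsf{HAC}_{\mathrm{int}}+\mathsf{I}+\mathsf{QF\text{-}AC}^{1,0}$ with $\mathcal{T}^*_{\mathrm{st}}$: $\mathrm{st}(x)\wedge x=y\to\mathrm{st}(y)$, $\mathrm{st}(t)$ for closed terms $t$, $\mathrm{st}(f)\wedge\mathrm{st}(x)\to\mathrm{st}(f(x))$; $\mathsf{HAC}_{\mathrm{int}}$ (internal $\varphi$): $(\forall^{\mathrm{st}}x^\rho)(\exists^{\mathrm{st}}y^\tau)\varphi\to(\exists^{\mathrm{st}}F^{\rho\to\tau^*})(\forall^{\mathrm{st}}x)(\exists y\in F(x))\varphi(x,y)$; $\mathsf{I}$ (internal $\varphi$): $(\forall^{\mathrm{st}}x^{\sigma^*})(\exists y)(\forall z\in x)\varphi(z,y)\to(\exists y)(\forall^{\mathrm{st}}x)\varphi(x,y)$; $\mathsf{QF\text{-}AC}^{1,0}$: $(\forall x^1)(\exists y^0)\varphi\to(\exists F^{1\to0})(\forall x)\varphi(x,F(x))$,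 $\varphi$ quantifier-free internal. Reals are fast-converging Cauchy sequences of rationals $(q_n)$; $x\approx y$ iff $(\forall^{\mathrm{st}}n)(|q_n-r_n|\le2^{-n})$; $c_{(\cdot)}^{0\to1}$ is a sequence of reals.
   Formalization: Π⁰₁-TRANS → MCT_ns is proved over P₀ plus "every number below a standard number is standard", since P₀ as listed (no external induction) does not prove it; the converse is over P₀. Reals are taken with |q_n − q_{n+i}| < 2^{-(n+2)} so that the given ≈ is representation-independent. *)

theory Defs
  imports Main
begin

section \<open>Finite types with finite sequence types; terms\<close>

text \<open>\<open>Nt\<close> is the type 0 and \<open>SeqT \<sigma>\<close> is the type of finite sequences of objects of type \<open>\<sigma>\<close>.\<close>

datatype ty = Nt | Fun ty ty (infixr "\<Rrightarrow>" 65) | SeqT ty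

text \<open>
  The combinators are \<open>\<Pi> :: \<rho> \<Rrightarrow> \<tau> \<Rrightarrow> \<rho>\<close> and
  \<open>\<Sigma> :: (\<delta> \<Rrightarrow> \<rho> \<Rrightarrow> \<tau>) \<Rrightarrow> (\<delta> \<Rrightarrow> \<rho>) \<Rrightarrow> \<delta> \<Rrightarrow> \<tau>\<close>; the only recursor is primitive recursion
  with values of type 0.  A finite sequence is given by its length and its values:
  besides the empty sequence and \<open>Cons\<close> there are the length \<open>Len\<close>, the projection
  \<open>Proj s i = s\<^sub>i\<close> and \<open>Seg n f = \<langle>f 0, \<dots>, f (n - 1)\<rangle>\<close>.  This is the usual coding of a sequence as a pair
  of a length and a function.  A list recursor is not a separate constant: the one with values of
  type 0 is obtained from \<open>Rec\<close>, \<open>Len\<close> and \<open>Proj\<close>, and the one with values of arbitrary type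
  is not available in primitive recursive arithmetic.
\<close>

datatype cst =
    ZeroC | SuccC | PiC ty ty | SigmaC ty ty ty | RecC
  | NilC ty | ConsC ty | LenC ty | ProjC ty | SegC ty

fun cty :: "cst \<Rightarrow> ty" where
  "cty ZeroC = Nt"
| "cty SuccC = Nt \<Rrightarrow> Nt"
| "cty (PiC \<rho> \<tau>) = \<rho> \<Rrightarrow> \<tau> \<Rrightarrow> \<rho>"
| "cty (SigmaC \<delta> \<rho> \<tau>) = (\<delta> \<Rrightarrow> \<rho> \<Rrightarrow> \<tau>) \<Rrightarrow> (\<delta> \<Rrightarrow> \<rho>) \<Rrightarrow> \<delta> \<Rrightarrow> \<tau>"
| "cty RecC = Nt \<Rrightarrow> Nt \<Rrightarrow> (Nt \<Rrightarrow> Nt \<Rrightarrow> Nt) \<Rrightarrow> Nt"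
| "cty (NilC \<sigma>) = SeqT \<sigma>"
| "cty (ConsC \<sigma>) = \<sigma> \<Rrightarrow> SeqT \<sigma> \<Rrightarrow> SeqT \<sigma>"
| "cty (LenC \<sigma>) = SeqT \<sigma> \<Rrightarrow> Nt"
| "cty (ProjC \<sigma>) = SeqT \<sigma> \<Rrightarrow> Nt \<Rrightarrow> \<sigma>"
| "cty (SegC \<sigma>) = Nt \<Rrightarrow> (Nt \<Rrightarrow> \<sigma>) \<Rrightarrow> SeqT \<sigma>"

text \<open>Variables are de Bruijn indices into a context, the list of the types of the variables.\<close>

datatype tm = Var nat | Cst cst | App tm tm (infixl "\<cdot>" 100)

fun typ_of :: "ty list \<Rightarrow> tm \<Rightarrow> ty option" where
  "typ_of \<Gamma> (Var n) = (if n < length \<Gamma> then Some (\<Gamma> ! n) else None)"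
| "typ_of \<Gamma> (Cst c) = Some (cty c)"
| "typ_of \<Gamma> (App t u) =
     (case typ_of \<Gamma> t of
        Some (\<sigma> \<Rrightarrow> \<tau>) \<Rightarrow> if typ_of \<Gamma> u = Some \<sigma> then Some \<tau> else None
      | _ \<Rightarrow> None)"

definition closed_tm :: "tm \<Rightarrow> ty \<Rightarrow> bool" where
  "closed_tm t \<sigma> \<longleftrightarrow> typ_of [] t = Some \<sigma>"

fun sub_tm :: "(nat \<Rightarrow> tm) \<Rightarrow> tm \<Rightarrow> tm" where
  "sub_tm \<theta> (Var n) = \<theta> n"
| "sub_tm \<theta> (Cst c) = Cst c"
| "sub_tm \<theta> (App t u) = App (sub_tm \<theta> t) (sub_tm \<theta> u)"

definition lift :: "tm \<Rightarrow> tm" where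
  "lift = sub_tm (\<lambda>n. Var (Suc n))"

text \<open>
  Bracket abstraction: \<open>lam1 \<sigma> \<Gamma> t\<close> is the combinatory term for \<open>\<lambda>x\<^sup>\<sigma>. t\<close>, where \<open>x\<close> is variable 0 of
  \<open>t\<close> and \<open>\<Gamma>\<close> types the remaining variables; subterms without \<open>x\<close> are handled by \<open>\<Pi>\<close> alone.  \<open>lam [\<sigma>\<^sub>n, \<dots>, \<sigma>\<^sub>1] t\<close> is the closed term
  \<open>\<lambda>x\<^sub>1 \<dots> x\<^sub>n. t\<close>; as the list is the context of \<open>t\<close>, the last argument comes first.
\<close>

fun occurs0 :: "tm \<Rightarrow> bool" where
  "occurs0 (Var n) \<longleftrightarrow> n = 0"
| "occurs0 (Cst c) \<longleftrightarrow> False"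
| "occurs0 (App t u) \<longleftrightarrow> occurs0 t \<or> occurs0 u"

definition const_fun :: "ty \<Rightarrow> ty list \<Rightarrow> tm \<Rightarrow> tm" where
  "const_fun \<sigma> \<Gamma> t =
     Cst (PiC (the (typ_of (\<sigma> # \<Gamma>) t)) \<sigma>) \<cdot> sub_tm (\<lambda>n. Var (n - 1)) t"

fun lam1 :: "ty \<Rightarrow> ty list \<Rightarrow> tm \<Rightarrow> tm" where
  "lam1 \<sigma> \<Gamma> (Var n) =
     (if n = 0
      then Cst (SigmaC \<sigma> (\<sigma> \<Rrightarrow> \<sigma>) \<sigma>) \<cdot> Cst (PiC \<sigma> (\<sigma> \<Rrightarrow> \<sigma>)) \<cdot> Cst (PiC \<sigma> \<sigma>)
      else const_fun \<sigma> \<Gamma> (Var n))"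
| "lam1 \<sigma> \<Gamma> (Cst c) = const_fun \<sigma> \<Gamma> (Cst c)"
| "lam1 \<sigma> \<Gamma> (App t u) =
     (if occurs0 (App t u)
      then Cst (SigmaC \<sigma> (the (typ_of (\<sigma> # \<Gamma>) u)) (the (typ_of (\<sigma> # \<Gamma>) (App t u))))
             \<cdot> lam1 \<sigma> \<Gamma> t \<cdot> lam1 \<sigma> \<Gamma> u
      else const_fun \<sigma> \<Gamma> (App t u))"

fun lam :: "ty list \<Rightarrow> tm \<Rightarrow> tm" where
  "lam [] t = t"
| "lam (\<sigma> # \<Gamma>) t = lam \<Gamma> (lam1 \<sigma> \<Gamma> t)"

fun zero_tm :: "ty \<Rightarrow> tm" where
  "zero_tm Nt = Cst ZeroC"
| "zero_tm (\<sigma> \<Rrightarrow> \<tau>) = Cst (PiC \<tau> \<sigma>) \<cdot> zero_tm \<tau>"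
| "zero_tm (SeqT \<sigma>) = Cst (NilC \<sigma>)"


section \<open>Primitive recursive arithmetic as closed terms\<close>

abbreviation Z :: tm where "Z \<equiv> Cst ZeroC"
abbreviation Sc :: "tm \<Rightarrow> tm" where "Sc t \<equiv> Cst SuccC \<cdot> t"
abbreviation Rc :: "tm \<Rightarrow> tm \<Rightarrow> tm \<Rightarrow> tm" where "Rc n y z \<equiv> Cst RecC \<cdot> n \<cdot> y \<cdot> z"

text \<open>In \<open>Rc n y z\<close> the step term \<open>z\<close> takes the previous value first and the index second.\<close>

definition pred_c :: tm where
  "pred_c = lam [Nt] (Rc (Var 0) Z (lam [Nt, Nt] (Var 0)))"

definition add_c :: tm where
  "add_c = lam [Nt, Nt] (Rc (Var 0) (Var 1) (lam [Nt, Nt] (Sc (Var 1))))"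

definition monus_c :: tm where
  "monus_c = lam [Nt, Nt] (Rc (Var 0) (Var 1) (lam [Nt, Nt] (pred_c \<cdot> Var 1)))"

abbreviation plus_t :: "tm \<Rightarrow> tm \<Rightarrow> tm" (infixl "\<oplus>" 75) where "s \<oplus> t \<equiv> add_c \<cdot> s \<cdot> t"
abbreviation monus_t :: "tm \<Rightarrow> tm \<Rightarrow> tm" (infixl "\<ominus>" 75) where "s \<ominus> t \<equiv> monus_c \<cdot> s \<cdot> t"

definition mul_c :: tm where
  "mul_c = lam [Nt, Nt]
     (Rc (Var 0) Z (lam [Nt, Nt, Nt] (Var 1 \<oplus> Var 2) \<cdot> Var 1))"

abbreviation times_t :: "tm \<Rightarrow> tm \<Rightarrow> tm" (infixl "\<odot>" 80) where "s \<odot> t \<equiv> mul_c \<cdot> s \<cdot> t"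

definition pow2_c :: tm where
  "pow2_c = lam [Nt] (Rc (Var 0) (Sc Z) (lam [Nt, Nt] (Var 1 \<oplus> Var 1)))"

text \<open>
  Cantor pairing \<open>\<langle>m, n\<rangle> = T (m + n) + m\<close> with \<open>T k = k (k + 1) / 2\<close>.  \<open>root_c z\<close> is the largest \<open>w\<close>
  with \<open>T w \<le> z\<close>: in passing from \<open>b\<close> to \<open>b + 1\<close> it increases exactly when \<open>T (w + 1) \<le> b + 1\<close>.
\<close>

definition tri_c :: tm where
  "tri_c = lam [Nt] (Rc (Var 0) Z (lam [Nt, Nt] (Var 1 \<oplus> Sc (Var 0))))"

definition root_c :: tm where
  "root_c = lam [Nt] (Rc (Var 0) Z
     (lam [Nt, Nt] (Var 1 \<oplus> (Sc Z \<ominus> (tri_c \<cdot> Sc (Var 1) \<ominus> Sc (Var 0))))))"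

definition pair_c :: tm where
  "pair_c = lam [Nt, Nt] (tri_c \<cdot> (Var 1 \<oplus> Var 0) \<oplus> Var 1)"

definition fst_c :: tm where
  "fst_c = lam [Nt] (Var 0 \<ominus> tri_c \<cdot> (root_c \<cdot> Var 0))"

definition snd_c :: tm where
  "snd_c = lam [Nt] (root_c \<cdot> Var 0 \<ominus> fst_c \<cdot> Var 0)"


section \<open>Formulas\<close>

datatype fm =
    Equ tm tm         \<comment> \<open>equality of type 0\<close>
  | St ty tm
  | Fls
  | Imp fm fm
  | Con fm fm
  | Dis fm fm
  | Forall ty fm
  | Exists ty fm

abbreviation Neg :: "fm \<Rightarrow> fm" where "Neg \<phi> \<equiv> Imp \<phi> Fls"
abbreviation Iff :: "fm \<Rightarrow> fm \<Rightarrow> fm" where "Iff \<phi> \<psi> \<equiv> Con (Imp \<phi> \<psi>) (Imp \<psi> \<phi>)"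

fun well_typed :: "ty list \<Rightarrow> fm \<Rightarrow> bool" where
  "well_typed \<Gamma> (Equ s t) \<longleftrightarrow> typ_of \<Gamma> s = Some Nt \<and> typ_of \<Gamma> t = Some Nt"
| "well_typed \<Gamma> (St \<sigma> t) \<longleftrightarrow> typ_of \<Gamma> t = Some \<sigma>"
| "well_typed \<Gamma> Fls \<longleftrightarrow> True"
| "well_typed \<Gamma> (Imp \<phi> \<psi>) \<longleftrightarrow> well_typed \<Gamma> \<phi> \<and> well_typed \<Gamma> \<psi>"
| "well_typed \<Gamma> (Con \<phi> \<psi>) \<longleftrightarrow> well_typed \<Gamma> \<phi> \<and> well_typed \<Gamma> \<psi>"
| "well_typed \<Gamma> (Dis \<phi> \<psi>) \<longleftrightarrow> well_typed \<Gamma> \<phi> \<and> well_typed \<Gamma> \<psi>"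
| "well_typed \<Gamma> (Forall \<sigma> \<phi>) \<longleftrightarrow> well_typed (\<sigma> # \<Gamma>) \<phi>"
| "well_typed \<Gamma> (Exists \<sigma> \<phi>) \<longleftrightarrow> well_typed (\<sigma> # \<Gamma>) \<phi>"

fun internal :: "fm \<Rightarrow> bool" where
  "internal (Equ s t) \<longleftrightarrow> True"
| "internal (St \<sigma> t) \<longleftrightarrow> False"
| "internal Fls \<longleftrightarrow> True"
| "internal (Imp \<phi> \<psi>) \<longleftrightarrow> internal \<phi> \<and> internal \<psi>"
| "internal (Con \<phi> \<psi>) \<longleftrightarrow> internal \<phi> \<and> internal \<psi>"
| "internal (Dis \<phi> \<psi>) \<longleftrightarrow> internal \<phi> \<and> internal \<psi>"
| "internal (Forall \<sigma> \<phi>) \<longleftrightarrow> internal \<phi>"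
| "internal (Exists \<sigma> \<phi>) \<longleftrightarrow> internal \<phi>"

text \<open>Quantifier-free internal formulas; their atoms are equalities of type 0 only.\<close>

fun qf :: "fm \<Rightarrow> bool" where
  "qf (Equ s t) \<longleftrightarrow> True"
| "qf (St \<sigma> t) \<longleftrightarrow> False"
| "qf Fls \<longleftrightarrow> True"
| "qf (Imp \<phi> \<psi>) \<longleftrightarrow> qf \<phi> \<and> qf \<psi>"
| "qf (Con \<phi> \<psi>) \<longleftrightarrow> qf \<phi> \<and> qf \<psi>"
| "qf (Dis \<phi> \<psi>) \<longleftrightarrow> qf \<phi> \<and> qf \<psi>"
| "qf (Forall \<sigma> \<phi>) \<longleftrightarrow> False"
| "qf (Exists \<sigma> \<phi>) \<longleftrightarrow> False"

definition up :: "(nat \<Rightarrow> tm) \<Rightarrow> nat \<Rightarrow> tm" where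
  "up \<theta> n = (case n of 0 \<Rightarrow> Var 0 | Suc m \<Rightarrow> lift (\<theta> m))"

fun sub_fm :: "(nat \<Rightarrow> tm) \<Rightarrow> fm \<Rightarrow> fm" where
  "sub_fm \<theta> (Equ s t) = Equ (sub_tm \<theta> s) (sub_tm \<theta> t)"
| "sub_fm \<theta> (St \<sigma> t) = St \<sigma> (sub_tm \<theta> t)"
| "sub_fm \<theta> Fls = Fls"
| "sub_fm \<theta> (Imp \<phi> \<psi>) = Imp (sub_fm \<theta> \<phi>) (sub_fm \<theta> \<psi>)"
| "sub_fm \<theta> (Con \<phi> \<psi>) = Con (sub_fm \<theta> \<phi>) (sub_fm \<theta> \<psi>)"
| "sub_fm \<theta> (Dis \<phi> \<psi>) = Dis (sub_fm \<theta> \<phi>) (sub_fm \<theta> \<psi>)"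
| "sub_fm \<theta> (Forall \<sigma> \<phi>) = Forall \<sigma> (sub_fm (up \<theta>) \<phi>)"
| "sub_fm \<theta> (Exists \<sigma> \<phi>) = Exists \<sigma> (sub_fm (up \<theta>) \<phi>)"

definition lift_fm :: "fm \<Rightarrow> fm" where
  "lift_fm = sub_fm (\<lambda>n. Var (Suc n))"

text \<open>\<open>inst_fm t \<phi>\<close> replaces variable 0 of \<open>\<phi>\<close> by \<open>t\<close> and drops it from the context.\<close>

definition inst_fm :: "tm \<Rightarrow> fm \<Rightarrow> fm" where
  "inst_fm t = sub_fm (\<lambda>n. case n of 0 \<Rightarrow> t | Suc m \<Rightarrow> Var m)"

definition Forall_st :: "ty \<Rightarrow> fm \<Rightarrow> fm" where
  "Forall_st \<sigma> \<phi> = Forall \<sigma> (Imp (St \<sigma> (Var 0)) \<phi>)"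

definition Exists_st :: "ty \<Rightarrow> fm \<Rightarrow> fm" where
  "Exists_st \<sigma> \<phi> = Exists \<sigma> (Con (St \<sigma> (Var 0)) \<phi>)"

definition Le :: "tm \<Rightarrow> tm \<Rightarrow> fm" where
  "Le s t = Equ (s \<ominus> t) Z"

definition Lt :: "tm \<Rightarrow> tm \<Rightarrow> fm" where
  "Lt s t = Le (Sc s) t"

text \<open>Equality at higher types is defined from equality of type 0: extensionally at function types,
  and as equality of lengths and of components at sequence types.\<close>

fun EqT :: "ty \<Rightarrow> tm \<Rightarrow> tm \<Rightarrow> fm" where
  "EqT Nt s t = Equ s t"
| "EqT (\<sigma> \<Rrightarrow> \<tau>) s t = Forall \<sigma> (EqT \<tau> (lift s \<cdot> Var 0) (lift t \<cdot> Var 0))"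
| "EqT (SeqT \<sigma>) s t =
     Con (Equ (Cst (LenC \<sigma>) \<cdot> s) (Cst (LenC \<sigma>) \<cdot> t))
       (Forall Nt (Imp (Lt (Var 0) (Cst (LenC \<sigma>) \<cdot> lift s))
          (EqT \<sigma> (Cst (ProjC \<sigma>) \<cdot> lift s \<cdot> Var 0) (Cst (ProjC \<sigma>) \<cdot> lift t \<cdot> Var 0))))"

text \<open>\<open>a \<in> s\<close> for a finite sequence \<open>s\<close> of type \<open>SeqT \<sigma>\<close>.\<close>

definition Mem :: "ty \<Rightarrow> tm \<Rightarrow> tm \<Rightarrow> fm" where
  "Mem \<sigma> a s = Exists Nt (Con (Lt (Var 0) (Cst (LenC \<sigma>) \<cdot> lift s))
     (EqT \<sigma> (lift a) (Cst (ProjC \<sigma>) \<cdot> lift s \<cdot> Var 0)))"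


section \<open>Many-sorted classical logic\<close>

text \<open>
  Natural deduction for a language \<open>L\<close> (a set of formulas) and a theory \<open>T\<close>.
  \<open>prv L T \<Gamma> \<Delta> \<phi>\<close>: in context \<open>\<Gamma>\<close>, \<open>\<phi>\<close> is derivable from the hypotheses \<open>\<Delta>\<close>.  Every formula
  in a derivation is well-typed and belongs to \<open>L\<close>.  The axioms in \<open>T\<close> may contain free variables;
  an axiom may be used in every context in which it is well-typed.
\<close>

definition wff :: "fm set \<Rightarrow> ty list \<Rightarrow> fm \<Rightarrow> bool" where
  "wff L \<Gamma> \<phi> \<longleftrightarrow> well_typed \<Gamma> \<phi> \<and> \<phi> \<in> L"

inductive prv :: "fm set \<Rightarrow> fm set \<Rightarrow> ty list \<Rightarrow> fm list \<Rightarrow> fm \<Rightarrow> bool"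
  for L T :: "fm set" where
  Axiom: "\<phi> \<in> T \<Longrightarrow> wff L \<Gamma> \<phi> \<Longrightarrow> (\<forall>\<psi>\<in>set \<Delta>. wff L \<Gamma> \<psi>) \<Longrightarrow> prv L T \<Gamma> \<Delta> \<phi>"
| Assm: "\<phi> \<in> set \<Delta> \<Longrightarrow> (\<forall>\<psi>\<in>set \<Delta>. wff L \<Gamma> \<psi>) \<Longrightarrow> prv L T \<Gamma> \<Delta> \<phi>"
| ImpI: "prv L T \<Gamma> (\<phi> # \<Delta>) \<psi> \<Longrightarrow> wff L \<Gamma> (Imp \<phi> \<psi>) \<Longrightarrow> prv L T \<Gamma> \<Delta> (Imp \<phi> \<psi>)"
| ImpE: "prv L T \<Gamma> \<Delta> (Imp \<phi> \<psi>) \<Longrightarrow> prv L T \<Gamma> \<Delta> \<phi> \<Longrightarrow> prv L T \<Gamma> \<Delta> \<psi>"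
| Classical: "prv L T \<Gamma> (Neg \<phi> # \<Delta>) Fls \<Longrightarrow> wff L \<Gamma> \<phi> \<Longrightarrow> prv L T \<Gamma> \<Delta> \<phi>"
| ConI: "prv L T \<Gamma> \<Delta> \<phi> \<Longrightarrow> prv L T \<Gamma> \<Delta> \<psi> \<Longrightarrow> wff L \<Gamma> (Con \<phi> \<psi>) \<Longrightarrow> prv L T \<Gamma> \<Delta> (Con \<phi> \<psi>)"
| ConE1: "prv L T \<Gamma> \<Delta> (Con \<phi> \<psi>) \<Longrightarrow> prv L T \<Gamma> \<Delta> \<phi>"
| ConE2: "prv L T \<Gamma> \<Delta> (Con \<phi> \<psi>) \<Longrightarrow> prv L T \<Gamma> \<Delta> \<psi>"
| DisI1: "prv L T \<Gamma> \<Delta> \<phi> \<Longrightarrow> wff L \<Gamma> (Dis \<phi> \<psi>) \<Longrightarrow> prv L T \<Gamma> \<Delta> (Dis \<phi> \<psi>)"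
| DisI2: "prv L T \<Gamma> \<Delta> \<psi> \<Longrightarrow> wff L \<Gamma> (Dis \<phi> \<psi>) \<Longrightarrow> prv L T \<Gamma> \<Delta> (Dis \<phi> \<psi>)"
| DisE: "prv L T \<Gamma> \<Delta> (Dis \<phi> \<psi>) \<Longrightarrow> prv L T \<Gamma> (\<phi> # \<Delta>) \<chi> \<Longrightarrow> prv L T \<Gamma> (\<psi> # \<Delta>) \<chi> \<Longrightarrow>
    prv L T \<Gamma> \<Delta> \<chi>"
| ForallI: "prv L T (\<sigma> # \<Gamma>) (map lift_fm \<Delta>) \<phi> \<Longrightarrow> (\<forall>\<psi>\<in>set \<Delta>. wff L \<Gamma> \<psi>) \<Longrightarrow>
    wff L \<Gamma> (Forall \<sigma> \<phi>) \<Longrightarrow> prv L T \<Gamma> \<Delta> (Forall \<sigma> \<phi>)"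
| ForallE: "prv L T \<Gamma> \<Delta> (Forall \<sigma> \<phi>) \<Longrightarrow> typ_of \<Gamma> t = Some \<sigma> \<Longrightarrow> prv L T \<Gamma> \<Delta> (inst_fm t \<phi>)"
| ExistsI: "prv L T \<Gamma> \<Delta> (inst_fm t \<phi>) \<Longrightarrow> typ_of \<Gamma> t = Some \<sigma> \<Longrightarrow> wff L \<Gamma> (Exists \<sigma> \<phi>) \<Longrightarrow>
    prv L T \<Gamma> \<Delta> (Exists \<sigma> \<phi>)"
| ExistsE: "prv L T \<Gamma> \<Delta> (Exists \<sigma> \<phi>) \<Longrightarrow> prv L T (\<sigma> # \<Gamma>) (\<phi> # map lift_fm \<Delta>) (lift_fm \<psi>) \<Longrightarrow>
    wff L \<Gamma> \<psi> \<Longrightarrow> prv L T \<Gamma> \<Delta> \<psi>"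


section \<open>The axioms\<close>

text \<open>Terms in the axioms are arbitrary; being well-typed, as \<open>prv\<close> demands, forces the intended types.\<close>

inductive_set EPRA_ax :: "fm set" where
  eq_refl: "Equ t t \<in> EPRA_ax"
| eq_eucl: "Imp (Equ s t) (Imp (Equ s u) (Equ t u)) \<in> EPRA_ax"
| extensionality: "Imp (EqT \<rho> s t) (EqT \<tau> (f \<cdot> s) (f \<cdot> t)) \<in> EPRA_ax"
| succ_nonzero: "Neg (Equ (Sc t) Z) \<in> EPRA_ax"
| succ_inj: "Imp (Equ (Sc s) (Sc t)) (Equ s t) \<in> EPRA_ax"
| Pi_eq: "EqT \<rho> (Cst (PiC \<rho> \<tau>) \<cdot> s \<cdot> t) s \<in> EPRA_ax"
| Sigma_eq: "EqT \<tau> (Cst (SigmaC \<delta> \<rho> \<tau>) \<cdot> s \<cdot> t \<cdot> u) (s \<cdot> u \<cdot> (t \<cdot> u)) \<in> EPRA_ax"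
| Rec_zero: "Equ (Rc Z y z) y \<in> EPRA_ax"
| Rec_succ: "Equ (Rc (Sc n) y z) (z \<cdot> Rc n y z \<cdot> n) \<in> EPRA_ax"
| qf_induction: "qf \<phi> \<Longrightarrow>
    Imp (inst_fm Z \<phi>)
      (Imp (Forall Nt (Imp \<phi> (sub_fm (\<lambda>n. case n of 0 \<Rightarrow> Sc (Var 0) | Suc m \<Rightarrow> Var (Suc m)) \<phi>)))
        (Forall Nt \<phi>)) \<in> EPRA_ax"
| Len_Nil: "Equ (Cst (LenC \<sigma>) \<cdot> Cst (NilC \<sigma>)) Z \<in> EPRA_ax"
| Len_Cons: "Equ (Cst (LenC \<sigma>) \<cdot> (Cst (ConsC \<sigma>) \<cdot> a \<cdot> s)) (Sc (Cst (LenC \<sigma>) \<cdot> s)) \<in> EPRA_ax"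
| Proj_Cons_zero: "EqT \<sigma> (Cst (ProjC \<sigma>) \<cdot> (Cst (ConsC \<sigma>) \<cdot> a \<cdot> s) \<cdot> Z) a \<in> EPRA_ax"
| Proj_Cons_succ:
    "EqT \<sigma> (Cst (ProjC \<sigma>) \<cdot> (Cst (ConsC \<sigma>) \<cdot> a \<cdot> s) \<cdot> Sc i) (Cst (ProjC \<sigma>) \<cdot> s \<cdot> i) \<in> EPRA_ax"
| Len_Seg: "Equ (Cst (LenC \<sigma>) \<cdot> (Cst (SegC \<sigma>) \<cdot> n \<cdot> f)) n \<in> EPRA_ax"
| Proj_Seg:
    "Imp (Lt i n) (EqT \<sigma> (Cst (ProjC \<sigma>) \<cdot> (Cst (SegC \<sigma>) \<cdot> n \<cdot> f) \<cdot> i) (f \<cdot> i)) \<in> EPRA_ax"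
| Proj_outside:
    "Imp (Le (Cst (LenC \<sigma>) \<cdot> s) i) (EqT \<sigma> (Cst (ProjC \<sigma>) \<cdot> s \<cdot> i) (zero_tm \<sigma>)) \<in> EPRA_ax"

inductive_set T_st :: "fm set" where
  st_eq: "Imp (Con (St \<sigma> x) (EqT \<sigma> x y)) (St \<sigma> y) \<in> T_st"
| st_closed: "closed_tm t \<sigma> \<Longrightarrow> St \<sigma> t \<in> T_st"
| st_app: "Imp (Con (St (\<sigma> \<Rrightarrow> \<tau>) f) (St \<sigma> x)) (St \<tau> (f \<cdot> x)) \<in> T_st"

text \<open>
  In the next two schemata, \<open>weaken2 \<phi>\<close> inserts a fresh variable at position 2 of the context, behind
  the two displayed variables of \<open>\<phi>\<close>.
\<close>

definition weaken2 :: "fm \<Rightarrow> fm" where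
  "weaken2 = sub_fm (\<lambda>n. Var (if n < 2 then n else Suc n))"

text \<open>In \<open>HAC_int\<close>, \<open>y\<close> and \<open>x\<close> are variables 0 and 1 of \<open>\<phi>\<close>.\<close>

definition HAC_int :: "fm set" where
  "HAC_int = {Imp (Forall_st \<rho> (Exists_st \<tau> \<phi>))
      (Exists_st (\<rho> \<Rrightarrow> SeqT \<tau>) (Forall_st \<rho> (Exists \<tau>
         (Con (Mem \<tau> (Var 0) (Var 2 \<cdot> Var 1)) (weaken2 \<phi>))))) | \<rho> \<tau> \<phi>. internal \<phi>}"

text \<open>In \<open>Idealization\<close>, \<open>z\<close> and \<open>y\<close> are variables 0 and 1 of \<open>\<phi>\<close>.\<close>

definition Idealization :: "fm set" where
  "Idealization = {Imp
      (Forall_st (SeqT \<sigma>) (Exists \<tau> (Forall \<sigma> (Imp (Mem \<sigma> (Var 0) (Var 2)) (weaken2 \<phi>)))))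
      (Exists \<tau> (Forall_st \<sigma> \<phi>)) | \<sigma> \<tau> \<phi>. internal \<phi>}"

text \<open>In \<open>QF_AC\<close>, \<open>y\<close> and \<open>x\<close> are variables 0 and 1 of \<open>\<phi>\<close>; in the conclusion variable 0 is \<open>x\<close> and
  variable 1 is \<open>F\<close>.\<close>

definition QF_AC :: "fm set" where
  "QF_AC = {Imp (Forall (Nt \<Rrightarrow> Nt) (Exists Nt \<phi>))
      (Exists ((Nt \<Rrightarrow> Nt) \<Rrightarrow> Nt) (Forall (Nt \<Rrightarrow> Nt)
         (sub_fm (\<lambda>n. if n = 0 then Var 1 \<cdot> Var 0 else if n = 1 then Var 0 else Var n) \<phi>)))
      | \<phi>. qf \<phi>}"

definition P0_ax :: "fm set" where
  "P0_ax = EPRA_ax \<union> T_st \<union> HAC_int \<union> Idealization \<union> QF_AC"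

text \<open>
  Every number below a standard number is standard.  In the full nonstandard system this follows from
  external induction.  It does not follow from \<open>P0_ax\<close>, whose standardness axioms do not include
  external induction.  It is needed for the implication from \<open>Pi01_TRANS\<close> to \<open>MCT_ns\<close>: if a nonstandard
  \<open>N\<close> lies below a standard \<open>k\<close> and \<open>M\<close> exceeds all standard numbers, then \<open>c\<^sub>n = - 1 / (n + 1)\<close> is a
  standard sequence for which \<open>c\<^sub>N\<close> and \<open>c\<^sub>M\<close> are not infinitely close.
\<close>

definition st_downward :: fm where
  "st_downward = Forall_st Nt (Forall Nt (Imp (Le (Var 0) (Var 1)) (St Nt (Var 0))))"

text \<open>The language of arithmetic itself has no standardness predicate.\<close>

definition EPRA_proves :: "fm \<Rightarrow> bool" ("EPRA \<turnstile> _" [40] 40) where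
  "EPRA \<turnstile> \<phi> \<longleftrightarrow> prv (Collect internal) EPRA_ax [] [] \<phi>"

definition st_proves :: "fm set \<Rightarrow> fm \<Rightarrow> bool" (infix "\<turnstile>st" 40) where
  "T \<turnstile>st \<phi> \<longleftrightarrow> prv UNIV T [] [] \<phi>"


section \<open>Rationals and reals in the formal system\<close>

text \<open>Every number codes a rational: \<open>\<langle>\<langle>a, b\<rangle>, d\<rangle>\<close> codes \<open>(a - b) / (d + 1)\<close>.
  \<open>mkq a b d\<close> is a code of \<open>(a - b) / d\<close> for \<open>d > 0\<close>.\<close>

definition qpos :: "tm \<Rightarrow> tm" where "qpos q = fst_c \<cdot> (fst_c \<cdot> q)"
definition qneg :: "tm \<Rightarrow> tm" where "qneg q = snd_c \<cdot> (fst_c \<cdot> q)"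
definition qden :: "tm \<Rightarrow> tm" where "qden q = Sc (snd_c \<cdot> q)"

definition mkq :: "tm \<Rightarrow> tm \<Rightarrow> tm \<Rightarrow> tm" where
  "mkq a b d = pair_c \<cdot> (pair_c \<cdot> a \<cdot> b) \<cdot> (pred_c \<cdot> d)"

definition qadd_c :: tm where
  "qadd_c = lam [Nt, Nt] (let p = Var 1; q = Var 0 in
     mkq (qpos p \<odot> qden q \<oplus> qpos q \<odot> qden p) (qneg p \<odot> qden q \<oplus> qneg q \<odot> qden p)
       (qden p \<odot> qden q))"

definition qsub_c :: tm where
  "qsub_c = lam [Nt, Nt] (let p = Var 1; q = Var 0 in
     mkq (qpos p \<odot> qden q \<oplus> qneg q \<odot> qden p) (qneg p \<odot> qden q \<oplus> qpos q \<odot> qden p)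
       (qden p \<odot> qden q))"

definition qabs_c :: tm where
  "qabs_c = lam [Nt] (let q = Var 0 in
     mkq ((qpos q \<ominus> qneg q) \<oplus> (qneg q \<ominus> qpos q)) Z (qden q))"

abbreviation qadd :: "tm \<Rightarrow> tm \<Rightarrow> tm" where "qadd p q \<equiv> qadd_c \<cdot> p \<cdot> q"
abbreviation qsub :: "tm \<Rightarrow> tm \<Rightarrow> tm" where "qsub p q \<equiv> qsub_c \<cdot> p \<cdot> q"
abbreviation qabs :: "tm \<Rightarrow> tm" where "qabs q \<equiv> qabs_c \<cdot> q"

definition qle :: "tm \<Rightarrow> tm \<Rightarrow> fm" where
  "qle p q = Le (qpos p \<odot> qden q \<oplus> qneg q \<odot> qden p) (qpos q \<odot> qden p \<oplus> qneg p \<odot> qden q)"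

definition qlt :: "tm \<Rightarrow> tm \<Rightarrow> fm" where
  "qlt p q = Lt (qpos p \<odot> qden q \<oplus> qneg q \<odot> qden p) (qpos q \<odot> qden p \<oplus> qneg p \<odot> qden q)"

text \<open>\<open>1 / k\<close> for \<open>k > 0\<close>, and \<open>2\<^sup>-\<^sup>n\<close>.\<close>

definition qinv :: "tm \<Rightarrow> tm" where "qinv k = mkq (Sc Z) Z k"
definition q2 :: "tm \<Rightarrow> tm" where "q2 n = qinv (pow2_c \<cdot> n)"

text \<open>
  A real is a sequence of (codes of) rationals with \<open>|q\<^sub>n - q\<^sub>n\<^sub>+\<^sub>i| < 2\<^sup>-\<^sup>(\<^sup>n\<^sup>+\<^sup>2\<^sup>)\<close>.  The offset 2 matters:
  it makes the relation \<open>|q\<^sub>n - r\<^sub>n| \<le> 2\<^sup>-\<^sup>n\<close> for all (standard) \<open>n\<close> express that the two reals are equal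
  (infinitely close), independently of the chosen representations.  With \<open>2\<^sup>-\<^sup>n\<close> in its place two
  representations of the same real can violate that relation.
\<close>

definition is_real :: "tm \<Rightarrow> fm" where
  "is_real x = Forall Nt (Forall Nt
     (qlt (qabs (qsub (lift (lift x) \<cdot> Var 1) (lift (lift x) \<cdot> (Var 1 \<oplus> Var 0))))
          (q2 (Sc (Sc (Var 1))))))"

definition real_le :: "tm \<Rightarrow> tm \<Rightarrow> fm" where
  "real_le x y = Forall Nt (qle (lift x \<cdot> Var 0) (qadd (lift y \<cdot> Var 0) (q2 (Var 0))))"

definition real_approx :: "tm \<Rightarrow> tm \<Rightarrow> fm" where
  "real_approx x y =
     Forall_st Nt (qle (qabs (qsub (lift x \<cdot> Var 0) (lift y \<cdot> Var 0))) (q2 (Var 0)))"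

definition real_of_rat :: "tm \<Rightarrow> tm" where
  "real_of_rat q = Cst (PiC Nt Nt) \<cdot> q"

text \<open>\<open>|x - y|\<close> is \<open>\<lambda>n. |x (n + 1) - y (n + 1)|\<close>; the shift restores the rate of convergence.\<close>

definition absdiff_c :: tm where
  "absdiff_c = lam [Nt, Nt \<Rrightarrow> Nt, Nt \<Rrightarrow> Nt]
     (qabs (qsub (Var 2 \<cdot> Sc (Var 0)) (Var 1 \<cdot> Sc (Var 0))))"

definition real_absdiff :: "tm \<Rightarrow> tm \<Rightarrow> tm" where
  "real_absdiff x y = absdiff_c \<cdot> x \<cdot> y"


section \<open>The principles\<close>

abbreviation ty1 :: ty where "ty1 \<equiv> Nt \<Rrightarrow> Nt"
abbreviation ty2 :: ty where "ty2 \<equiv> ty1 \<Rrightarrow> Nt"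
abbreviation ty_seq :: ty where "ty_seq \<equiv> Nt \<Rrightarrow> ty1"
abbreviation ty_rate :: ty where "ty_rate \<equiv> ty_seq \<Rrightarrow> ty1"

text \<open>\<open>c\<close> is a sequence of reals with \<open>c n \<le> c (n + 1) \<le> 1\<close> for all \<open>n\<close>.\<close>

definition mono_bounded :: "tm \<Rightarrow> fm" where
  "mono_bounded c = Con (Forall Nt (is_real (lift c \<cdot> Var 0)))
     (Forall Nt (Con (real_le (lift c \<cdot> Var 0) (lift c \<cdot> Sc (Var 0)))
                     (real_le (lift c \<cdot> Sc (Var 0)) (real_of_rat (qinv (Sc Z))))))"

text \<open>The bound variables are \<open>c = Var 2\<close>, \<open>N = Var 1\<close>, \<open>M = Var 0\<close>.\<close>

definition MCT_ns :: fm where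
  "MCT_ns = Forall_st ty_seq (Imp (mono_bounded (Var 0))
     (Forall Nt (Forall Nt
        (Imp (Con (Neg (St Nt (Var 1))) (Neg (St Nt (Var 0))))
             (real_approx (Var 2 \<cdot> Var 0) (Var 2 \<cdot> Var 1))))))"

text \<open>The bound variables are \<open>c = Var 3\<close>, \<open>k = Var 2\<close>, \<open>N = Var 1\<close>, \<open>M = Var 0\<close>.  As \<open>1 / k\<close> occurs,
  \<open>k\<close> ranges over the positive numbers.\<close>

definition MCT_ef :: "tm \<Rightarrow> fm" where
  "MCT_ef t = Forall ty_seq (Forall Nt (Imp (Neg (Equ (Var 0) Z)) (Imp (mono_bounded (Var 1))
     (Forall Nt (Forall Nt
        (let rate = lift (lift (lift (lift t))) \<cdot> Var 3 \<cdot> Var 2 in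
         Imp (Con (Le rate (Var 1)) (Le rate (Var 0)))
             (real_le (real_absdiff (Var 3 \<cdot> Var 0) (Var 3 \<cdot> Var 1))
                      (real_of_rat (qinv (Var 2))))))))))"

definition MU :: "tm \<Rightarrow> fm" where
  "MU \<mu> = Forall ty1 (Imp (Exists Nt (Equ (Var 1 \<cdot> Var 0) Z))
                          (Equ (Var 0 \<cdot> (lift \<mu> \<cdot> Var 0)) Z))"

definition Pi01_TRANS :: fm where
  "Pi01_TRANS = Forall_st ty1 (Imp (Forall_st Nt (Neg (Equ (Var 1 \<cdot> Var 0) Z)))
                                   (Forall Nt (Neg (Equ (Var 1 \<cdot> Var 0) Z))))"

end

theory Submission
  imports Defs "HOL-Library.Countable" "HOL-Computational_Algebra.Fraction_Field"
begin

text \<open>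
  By completeness of many-sorted logic it suffices to argue in an arbitrary model, where arithmetic takes
  place in the ordered field of fractions of the numbers of the model and the only induction principle is
  the one for quantifier-free formulas.

  Given \<open>f\<close>, the sequence of reals that jumps from 0 to 1 at the least zero of \<open>f\<close> is nondecreasing, and a
  modulus of convergence tells how far one has to search for a zero.  In the nonstandard setting, a
  nonstandard least zero \<open>b\<close> of a standard \<open>f\<close> would separate the infinite indices \<open>b - 1\<close> and \<open>b\<close>.

  Conversely, let \<open>c\<close> be nondecreasing and bounded by 1 and divide the interval above \<open>c\<^sub>0\<close> into steps of
  length \<open>2\<^sup>-\<^sup>m\<close>.  A search functional \<open>\<mu>\<close> decides whether a given grid point is reached by some \<open>c\<^sub>n\<close>, so
  primitive recursion finds the last such point \<open>v\<close> and \<open>\<mu>\<close> gives an \<open>n\<close> with \<open>v \<le> c\<^sub>n\<close>; from then on the sequence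
  stays between \<open>v\<close> and \<open>v + 2\<^sup>-\<^sup>m\<close>.  In the nonstandard setting, transfer and \<open>HAC_int\<close> yield a standard
  \<open>\<mu>\<close> that is correct on standard functions, and then \<open>n\<close> is standard.
\<close>

section \<open>Substitution\<close>

text \<open>The nonstandard equivalence and its effective version rest on the same closed terms.
  Closed terms are standard and preserve standardness, so \<open>jump_c\<close> and
  \<open>index_c\<close> can be evaluated at standard arguments in the one case and at arbitrary
  arguments in the other. The extraction of \<open>s\<close> and \<open>u\<close> is realised in
  this way: they are written down, and the lemmas about their parts are stated so that both readings
  can use them.

  Two restrictions shape the arguments. The order of reals is a universal statement about
  approximations and cannot serve as an induction formula; hence all estimates concern rational
  approximations at a fixed precision, and the errors have to add up. Whether a grid point is
  reached is an existential statement; applying \<open>\<mu>\<close> turns it into an equation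
  between numbers, and only then are the recursion in \<open>level_c\<close> and the induction about
  it available.

  Infinite indices must exceed the standard index that the construction yields. This is the one
  place where \<open>st_downward\<close> enters.\<close>

lemma sub_tm_comp: "sub_tm \<theta> (sub_tm \<rho> t) = sub_tm (\<lambda>n. sub_tm \<theta> (\<rho> n)) t"
  by (induction t) auto

lemma sub_tm_Var [simp]: "sub_tm Var t = t"
  by (induction t) auto

lemma lift_simps [simp]:
  "lift (Var n) = Var (Suc n)" "lift (Cst c) = Cst c" "lift (s \<cdot> t) = lift s \<cdot> lift t"
  by (auto simp: lift_def)

lemma up_simps [simp]: "up \<theta> 0 = Var 0" "up \<theta> (Suc n) = lift (\<theta> n)"
  by (auto simp: up_def)

lemma sub_up_lift [simp]: "sub_tm (up \<theta>) (lift t) = lift (sub_tm \<theta> t)"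
  by (auto simp: lift_def sub_tm_comp up_def)

lemma up_comp: "(\<lambda>n. sub_tm (up \<theta>) (up \<rho> n)) = up (\<lambda>n. sub_tm \<theta> (\<rho> n))"
proof
  fix n show "sub_tm (up \<theta>) (up \<rho> n) = up (\<lambda>n. sub_tm \<theta> (\<rho> n)) n"
    by (cases n) auto
qed

lemma up_Var [simp]: "up Var = Var"
proof
  fix n show "up Var n = Var n" by (cases n) auto
qed

lemma sub_fm_comp: "sub_fm \<theta> (sub_fm \<rho> \<phi>) = sub_fm (\<lambda>n. sub_tm \<theta> (\<rho> n)) \<phi>"
  by (induction \<phi> arbitrary: \<theta> \<rho>) (auto simp: sub_tm_comp up_comp)

lemma sub_fm_Var [simp]: "sub_fm Var \<phi> = \<phi>"
  by (induction \<phi>) auto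

lemma sub_fm_cong_fun: "(\<And>n. \<theta> n = \<rho> n) \<Longrightarrow> sub_fm \<theta> \<phi> = sub_fm \<rho> \<phi>"
  by (metis ext)

lemma sub_up_lift_fm: "sub_fm (up \<theta>) (lift_fm \<phi>) = lift_fm (sub_fm \<theta> \<phi>)"
  unfolding lift_fm_def sub_fm_comp by (rule sub_fm_cong_fun) (simp add: lift_def)

lemma sub_case_nat_lift [simp]:
  "sub_tm (\<lambda>n. case n of 0 \<Rightarrow> t | Suc m \<Rightarrow> \<theta> m) (lift u) = sub_tm \<theta> u"
  by (simp add: lift_def sub_tm_comp)

lemma sub_inst_fm: "sub_fm \<theta> (inst_fm t \<phi>) = inst_fm (sub_tm \<theta> t) (sub_fm (up \<theta>) \<phi>)"
  unfolding inst_fm_def sub_fm_comp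
  by (rule sub_fm_cong_fun) (auto split: nat.split)

lemma inst_sub_up:
  "inst_fm t (sub_fm (up \<theta>) \<phi>) = sub_fm (\<lambda>n. case n of 0 \<Rightarrow> t | Suc m \<Rightarrow> \<theta> m) \<phi>"
  unfolding inst_fm_def sub_fm_comp
  by (rule sub_fm_cong_fun) (auto split: nat.split)

section \<open>Typing under substitution\<close>

lemma typ_of_App: "typ_of \<Gamma> (s \<cdot> t) = Some \<tau> \<longleftrightarrow>
    (\<exists>\<sigma>. typ_of \<Gamma> s = Some (\<sigma> \<Rrightarrow> \<tau>) \<and> typ_of \<Gamma> t = Some \<sigma>)"
  by (auto split: option.split ty.split)

text \<open>A typed term contains only variables of its context, so a substitution matters only
  there; in particular closed terms are fixed by every substitution.\<close>

lemma sub_tm_typed_cong: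
  "typ_of \<Gamma> t = Some \<sigma> \<Longrightarrow> (\<And>n. n < length \<Gamma> \<Longrightarrow> \<theta> n = \<rho> n) \<Longrightarrow> sub_tm \<theta> t = sub_tm \<rho> t"
proof (induction t arbitrary: \<sigma>)
  case (App s t)
  then show ?case by (auto simp: typ_of_App simp del: typ_of.simps(3))
qed (auto split: if_splits)

lemma sub_fm_typed_cong:
  "well_typed \<Gamma> \<phi> \<Longrightarrow> (\<And>n. n < length \<Gamma> \<Longrightarrow> \<theta> n = \<rho> n) \<Longrightarrow> sub_fm \<theta> \<phi> = sub_fm \<rho> \<phi>"
proof (induction \<phi> arbitrary: \<Gamma> \<theta> \<rho>)
  case (Forall \<sigma> \<phi>)
  have *: "up \<theta> n = up \<rho> n" if "n < length (\<sigma> # \<Gamma>)" for n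
    using that Forall.prems(2) by (cases n) auto
  have "sub_fm (up \<theta>) \<phi> = sub_fm (up \<rho>) \<phi>"
    by (rule Forall.IH [of "\<sigma> # \<Gamma>"]) (use Forall.prems(1) * in \<open>simp_all only: well_typed.simps\<close>)
  then show ?case by simp
next
  case (Exists \<sigma> \<phi>)
  have *: "up \<theta> n = up \<rho> n" if "n < length (\<sigma> # \<Gamma>)" for n
    using that Exists.prems(2) by (cases n) auto
  have "sub_fm (up \<theta>) \<phi> = sub_fm (up \<rho>) \<phi>"
    by (rule Exists.IH [of "\<sigma> # \<Gamma>"]) (use Exists.prems(1) * in \<open>simp_all only: well_typed.simps\<close>)
  then show ?case by simp
qed (simp; blast intro: sub_tm_typed_cong)+

lemma sub_closed_tm: "typ_of [] t = Some \<sigma> \<Longrightarrow> sub_tm \<theta> t = t"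
  using sub_tm_typed_cong [of "[]" t \<sigma> \<theta> Var] by simp

lemma typ_of_sub:
  "typ_of \<Gamma> t = Some \<sigma> \<Longrightarrow> (\<And>n. n < length \<Gamma> \<Longrightarrow> typ_of \<Gamma>' (\<theta> n) = Some (\<Gamma> ! n)) \<Longrightarrow>
    typ_of \<Gamma>' (sub_tm \<theta> t) = Some \<sigma>"
proof (induction t arbitrary: \<sigma>)
  case (App s t)
  then show ?case
    unfolding sub_tm.simps typ_of_App by blast
qed (auto split: if_splits)

lemma typ_of_lift: "typ_of (\<sigma> # \<Gamma>) (lift t) = Some \<tau>" if "typ_of \<Gamma> t = Some \<tau>"
  unfolding lift_def by (rule typ_of_sub [OF that]) simp

lemma up_typed:
  assumes "\<And>n. n < length \<Gamma> \<Longrightarrow> typ_of \<Gamma>' (\<theta> n) = Some (\<Gamma> ! n)" and "n < length (\<sigma> # \<Gamma>)"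
  shows "typ_of (\<sigma> # \<Gamma>') (up \<theta> n) = Some ((\<sigma> # \<Gamma>) ! n)"
  using assms by (cases n) (auto intro: typ_of_lift)

lemma well_typed_sub:
  "well_typed \<Gamma> \<phi> \<Longrightarrow> (\<And>n. n < length \<Gamma> \<Longrightarrow> typ_of \<Gamma>' (\<theta> n) = Some (\<Gamma> ! n)) \<Longrightarrow>
    well_typed \<Gamma>' (sub_fm \<theta> \<phi>)"
proof (induction \<phi> arbitrary: \<Gamma> \<Gamma>' \<theta>)
  case (Forall \<sigma> \<phi>)
  show ?case using Forall.IH [of "\<sigma> # \<Gamma>" "\<sigma> # \<Gamma>'" "up \<theta>"] Forall.prems up_typed by simp
next
  case (Exists \<sigma> \<phi>)
  show ?case using Exists.IH [of "\<sigma> # \<Gamma>" "\<sigma> # \<Gamma>'" "up \<theta>"] Exists.prems up_typed by simp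
qed (auto intro: typ_of_sub)

lemma well_typed_lift: "well_typed (\<sigma> # \<Gamma>) (lift_fm \<phi>)" if "well_typed \<Gamma> \<phi>"
  unfolding lift_fm_def by (rule well_typed_sub [OF that]) simp

lemma well_typed_inst: "well_typed \<Gamma> (inst_fm t \<phi>)"
  if "well_typed (\<sigma> # \<Gamma>) \<phi>" "typ_of \<Gamma> t = Some \<sigma>"
  unfolding inst_fm_def using that(2)
  by (intro well_typed_sub [OF that(1)]) (auto simp: less_Suc_eq_0_disj)

lemma typ_of_append: "typ_of (\<Gamma> @ \<Gamma>') t = Some \<sigma>" if "typ_of \<Gamma> t = Some \<sigma>"
  using typ_of_sub [OF that, of "\<Gamma> @ \<Gamma>'" Var] by (simp add: nth_append)

lemma well_typed_append: "well_typed (\<Gamma> @ \<Gamma>') \<phi>" if "well_typed \<Gamma> \<phi>"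
  using well_typed_sub [OF that, of "\<Gamma> @ \<Gamma>'" Var] by (simp add: nth_append)

lemma internal_sub [simp]: "internal (sub_fm \<theta> \<phi>) = internal \<phi>"
  by (induction \<phi> arbitrary: \<theta>) auto

lemma qf_sub [simp]: "qf (sub_fm \<theta> \<phi>) = qf \<phi>"
  by (induction \<phi> arbitrary: \<theta>) auto

lemma typ_of_monus [simp]: "typ_of \<Gamma> monus_c = Some (Nt \<Rrightarrow> Nt \<Rrightarrow> Nt)"
  by (simp add: monus_c_def pred_c_def const_fun_def numeral_2_eq_2)

text \<open>\<open>Le\<close>, and with it the bounds in \<open>EqT\<close> at sequence types and in
  \<open>Mem\<close>, contains the closed term \<open>monus_c\<close>; substitution commutes with
  these formulas because this term is fixed.\<close>

lemma sub_monus [simp]: "sub_tm \<theta> monus_c = monus_c" "lift monus_c = monus_c"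
  using sub_closed_tm typ_of_monus unfolding lift_def by blast+

lemma sub_Le [simp]: "sub_fm \<theta> (Le s t) = Le (sub_tm \<theta> s) (sub_tm \<theta> t)"
  and sub_Lt [simp]: "sub_fm \<theta> (Lt s t) = Lt (sub_tm \<theta> s) (sub_tm \<theta> t)"
  by (simp_all add: Le_def Lt_def)

lemma sub_EqT [simp]: "sub_fm \<theta> (EqT \<sigma> s t) = EqT \<sigma> (sub_tm \<theta> s) (sub_tm \<theta> t)"
  by (induction \<sigma> arbitrary: \<theta> s t) auto

lemma sub_Mem [simp]: "sub_fm \<theta> (Mem \<sigma> s t) = Mem \<sigma> (sub_tm \<theta> s) (sub_tm \<theta> t)"
  by (simp add: Mem_def)

lemma typ_of_zero_tm [simp]: "typ_of \<Gamma> (zero_tm \<sigma>) = Some \<sigma>"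
  by (induction \<sigma>) auto

lemma sub_zero_tm [simp]: "sub_tm \<theta> (zero_tm \<sigma>) = zero_tm \<sigma>"
  using sub_closed_tm typ_of_zero_tm by blast

text \<open>\<open>up (up \<theta>)\<close> fixes the two displayed variables and acts on the
  parameters from position 2 on; \<open>weaken2\<close> moves just these parameters by one, which
  the third \<open>up\<close> matches. So a substituted instance of \<open>HAC_int\<close> or
  \<open>Idealization\<close> is again an instance.\<close>

lemma weaken2_sub: "weaken2 (sub_fm (up (up \<theta>)) \<phi>) = sub_fm (up (up (up \<theta>))) (weaken2 \<phi>)"
  unfolding weaken2_def sub_fm_comp
proof (rule sub_fm_cong_fun)
  fix n
  show "sub_tm (\<lambda>n. Var (if n < 2 then n else Suc n)) (up (up \<theta>) n) =
      sub_tm (up (up (up \<theta>))) (Var (if n < 2 then n else Suc n))"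
  proof (cases "n < 2")
    case True
    then show ?thesis by (auto simp: less_2_cases_iff)
  next
    case False
    then obtain m where "n = Suc (Suc m)" by (metis add_2_eq_Suc le_Suc_ex not_less)
    then show ?thesis by (simp add: lift_def sub_tm_comp)
  qed
qed

text \<open>Axioms may have free variables. This closure makes derivability stable under
  substitution and axioms true for all parameters of the term model.\<close>

definition sub_closed :: "fm set \<Rightarrow> bool" where
  "sub_closed T \<longleftrightarrow> (\<forall>\<phi>\<in>T. \<forall>\<theta>. sub_fm \<theta> \<phi> \<in> T)"

lemma sub_closed_Un: "sub_closed S \<Longrightarrow> sub_closed T \<Longrightarrow> sub_closed (S \<union> T)"
  by (auto simp: sub_closed_def)

lemma sub_closed_EPRA_ax: "sub_closed EPRA_ax"
  unfolding sub_closed_def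
proof (intro ballI allI)
  fix \<phi> \<theta> assume "\<phi> \<in> EPRA_ax"
  then show "sub_fm \<theta> \<phi> \<in> EPRA_ax"
  proof cases
    case (qf_induction \<psi>)
    let ?\<psi> = "sub_fm (up \<theta>) \<psi>"
    \<comment> \<open>The successor substitution changes variable 0 only; \<open>up \<theta>\<close>
      fixes that variable, and the lifted terms in it do not contain it. So the two commute.\<close>
    have "sub_fm (up \<theta>) (sub_fm (\<lambda>n. case n of 0 \<Rightarrow> Sc (Var 0) | Suc m \<Rightarrow> Var (Suc m)) \<psi>) =
        sub_fm (\<lambda>n. case n of 0 \<Rightarrow> Sc (Var 0) | Suc m \<Rightarrow> Var (Suc m)) ?\<psi>"
      unfolding sub_fm_comp
      by (rule sub_fm_cong_fun) (auto simp: lift_def sub_tm_comp split: nat.split)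
    then show ?thesis
      using EPRA_ax.qf_induction [of ?\<psi>] qf_induction by (simp add: sub_inst_fm)
  qed (auto intro: EPRA_ax.intros)
qed

lemma sub_closed_T_st: "sub_closed T_st"
  unfolding sub_closed_def
proof (intro ballI allI)
  fix \<phi> \<theta> assume "\<phi> \<in> T_st"
  then show "sub_fm \<theta> \<phi> \<in> T_st"
    by cases (auto intro: T_st.intros simp: closed_tm_def sub_closed_tm)
qed

lemma sub_closed_HAC_int: "sub_closed HAC_int"
  unfolding sub_closed_def
proof (intro ballI allI)
  fix \<phi> \<theta> assume "\<phi> \<in> HAC_int"
  then obtain \<rho> \<tau> \<psi> where "\<phi> = Imp (Forall_st \<rho> (Exists_st \<tau> \<psi>))
      (Exists_st (\<rho> \<Rrightarrow> SeqT \<tau>) (Forall_st \<rho> (Exists \<tau>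
         (Con (Mem \<tau> (Var 0) (Var 2 \<cdot> Var 1)) (weaken2 \<psi>)))))" "internal \<psi>"
    unfolding HAC_int_def by blast
  then show "sub_fm \<theta> \<phi> \<in> HAC_int"
    unfolding HAC_int_def
    by (auto intro!: exI [of _ "sub_fm (up (up \<theta>)) \<psi>"]
        simp: weaken2_sub Forall_st_def Exists_st_def numeral_2_eq_2)
qed

lemma sub_closed_Idealization: "sub_closed Idealization"
  unfolding sub_closed_def
proof (intro ballI allI)
  fix \<phi> \<theta> assume "\<phi> \<in> Idealization"
  then obtain \<sigma> \<tau> \<psi> where "\<phi> = Imp
      (Forall_st (SeqT \<sigma>) (Exists \<tau> (Forall \<sigma> (Imp (Mem \<sigma> (Var 0) (Var 2)) (weaken2 \<psi>)))))
      (Exists \<tau> (Forall_st \<sigma> \<psi>))" "internal \<psi>"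
    unfolding Idealization_def by blast
  then show "sub_fm \<theta> \<phi> \<in> Idealization"
    unfolding Idealization_def
    by (auto intro!: exI [of _ "sub_fm (up (up \<theta>)) \<psi>"]
        simp: weaken2_sub Forall_st_def Exists_st_def numeral_2_eq_2)
qed

lemma sub_closed_QF_AC: "sub_closed QF_AC"
  unfolding sub_closed_def
proof (intro ballI allI)
  fix \<phi> \<theta> assume "\<phi> \<in> QF_AC"
  then obtain \<psi> where *: "\<phi> = Imp (Forall (Nt \<Rrightarrow> Nt) (Exists Nt \<psi>))
      (Exists ((Nt \<Rrightarrow> Nt) \<Rrightarrow> Nt) (Forall (Nt \<Rrightarrow> Nt)
         (sub_fm (\<lambda>n. if n = 0 then Var 1 \<cdot> Var 0 else if n = 1 then Var 0 else Var n) \<psi>)))"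
    "qf \<psi>"
    unfolding QF_AC_def by blast
  have "sub_fm (up (up \<theta>))
      (sub_fm (\<lambda>n. if n = 0 then Var 1 \<cdot> Var 0 else if n = 1 then Var 0 else Var n) \<psi>) =
    sub_fm (\<lambda>n. if n = 0 then Var 1 \<cdot> Var 0 else if n = 1 then Var 0 else Var n)
      (sub_fm (up (up \<theta>)) \<psi>)" (is "?l = ?r")
    unfolding sub_fm_comp
  proof (rule sub_fm_cong_fun, goal_cases)
    case (1 n)
    consider "n = 0" | "n = 1" | m where "n = Suc (Suc m)"
      by (metis One_nat_def not0_implies_Suc)
    then show ?case by cases (auto simp: lift_def sub_tm_comp)
  qed
  with * show "sub_fm \<theta> \<phi> \<in> QF_AC"
    unfolding QF_AC_def by (auto intro!: exI [of _ "sub_fm (up (up \<theta>)) \<psi>"])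
qed

lemma sub_closed_P0_ax: "sub_closed P0_ax"
  unfolding P0_ax_def
  by (intro sub_closed_Un sub_closed_EPRA_ax sub_closed_T_st sub_closed_HAC_int
      sub_closed_Idealization sub_closed_QF_AC)

lemma sub_closed_st_downward: "sub_closed {st_downward}"
  by (simp add: sub_closed_def st_downward_def Forall_st_def numeral_eq_Suc)

section \<open>Structural properties of derivations\<close>

text \<open>Covers the two languages in use, all formulas and the internal formulas. The condition
  on substitution goes both ways, so that membership in \<open>L\<close> can also be read off from
  an instance.\<close>

locale language =
  fixes L :: "fm set"
  assumes Fls_L [simp]: "Fls \<in> L"
    and Imp_L [simp]: "Imp \<phi> \<psi> \<in> L \<longleftrightarrow> \<phi> \<in> L \<and> \<psi> \<in> L"
    and Con_L [simp]: "Con \<phi> \<psi> \<in> L \<longleftrightarrow> \<phi> \<in> L \<and> \<psi> \<in> L"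
    and Dis_L [simp]: "Dis \<phi> \<psi> \<in> L \<longleftrightarrow> \<phi> \<in> L \<and> \<psi> \<in> L"
    and Forall_L [simp]: "Forall \<sigma> \<phi> \<in> L \<longleftrightarrow> \<phi> \<in> L"
    and Exists_L [simp]: "Exists \<sigma> \<phi> \<in> L \<longleftrightarrow> \<phi> \<in> L"
    and sub_L [simp]: "sub_fm \<theta> \<phi> \<in> L \<longleftrightarrow> \<phi> \<in> L"
    and internal_L: "internal \<phi> \<Longrightarrow> \<phi> \<in> L"
begin

lemma lift_L [simp]: "lift_fm \<phi> \<in> L \<longleftrightarrow> \<phi> \<in> L"
  by (simp add: lift_fm_def)

lemma inst_L [simp]: "inst_fm t \<phi> \<in> L \<longleftrightarrow> \<phi> \<in> L"
  by (simp add: inst_fm_def)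

lemma wff_simps [simp]:
  "wff L \<Gamma> Fls"
  "wff L \<Gamma> (Imp \<phi> \<psi>) \<longleftrightarrow> wff L \<Gamma> \<phi> \<and> wff L \<Gamma> \<psi>"
  "wff L \<Gamma> (Con \<phi> \<psi>) \<longleftrightarrow> wff L \<Gamma> \<phi> \<and> wff L \<Gamma> \<psi>"
  "wff L \<Gamma> (Dis \<phi> \<psi>) \<longleftrightarrow> wff L \<Gamma> \<phi> \<and> wff L \<Gamma> \<psi>"
  "wff L \<Gamma> (Forall \<sigma> \<phi>) \<longleftrightarrow> wff L (\<sigma> # \<Gamma>) \<phi>"
  "wff L \<Gamma> (Exists \<sigma> \<phi>) \<longleftrightarrow> wff L (\<sigma> # \<Gamma>) \<phi>"
  by (auto simp: wff_def)

lemma wff_inst: "wff L (\<sigma> # \<Gamma>) \<phi> \<Longrightarrow> typ_of \<Gamma> t = Some \<sigma> \<Longrightarrow> wff L \<Gamma> (inst_fm t \<phi>)"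
  by (auto simp: wff_def intro: well_typed_inst)

lemma wff_lift: "wff L \<Gamma> \<phi> \<Longrightarrow> wff L (\<sigma> # \<Gamma>) (lift_fm \<phi>)"
  by (auto simp: wff_def intro: well_typed_lift)

lemma wff_append: "wff L \<Gamma> \<phi> \<Longrightarrow> wff L (\<Gamma> @ \<Gamma>') \<phi>"
  by (auto simp: wff_def intro: well_typed_append)

lemma wff_sub:
  "wff L \<Gamma> \<phi> \<Longrightarrow> (\<And>n. n < length \<Gamma> \<Longrightarrow> typ_of \<Gamma>' (\<theta> n) = Some (\<Gamma> ! n)) \<Longrightarrow>
    wff L \<Gamma>' (sub_fm \<theta> \<phi>)"
  by (auto simp: wff_def intro: well_typed_sub)

lemma prv_wff: "prv L T \<Gamma> \<Delta> \<phi> \<Longrightarrow> wff L \<Gamma> \<phi> \<and> (\<forall>\<psi>\<in>set \<Delta>. wff L \<Gamma> \<psi>)"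
  by (induction rule: prv.induct) (auto intro: wff_inst)

lemma prv_weaken:
  "prv L T \<Gamma> \<Delta> \<phi> \<Longrightarrow> set \<Delta> \<subseteq> set \<Delta>' \<Longrightarrow> \<forall>\<psi>\<in>set \<Delta>'. wff L \<Gamma> \<psi> \<Longrightarrow> prv L T \<Gamma> \<Delta>' \<phi>"
proof (induction arbitrary: \<Delta>' rule: prv.induct)
  case (Assm \<phi> \<Delta> \<Gamma>)
  then show ?case by (meson prv.Assm subsetD)
next
  case (ImpI \<Gamma> \<phi> \<Delta> \<psi>)
  have "prv L T \<Gamma> (\<phi> # \<Delta>') \<psi>" using ImpI by (intro ImpI.IH) auto
  then show ?case using ImpI by (intro prv.ImpI) auto
next
  case (Classical \<Gamma> \<phi> \<Delta>)
  have "prv L T \<Gamma> (Neg \<phi> # \<Delta>') Fls" using Classical by (intro Classical.IH) auto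
  then show ?case using Classical by (simp add: prv.Classical)
next
  case (DisE \<Gamma> \<Delta> \<phi> \<psi> \<chi>)
  have *: "wff L \<Gamma> \<phi>" "wff L \<Gamma> \<psi>" using prv_wff DisE.hyps(1) by fastforce+
  have "prv L T \<Gamma> (\<phi> # \<Delta>') \<chi>" using DisE.prems * by (intro DisE.IH(2)) auto
  moreover have "prv L T \<Gamma> (\<psi> # \<Delta>') \<chi>" using DisE.prems * by (intro DisE.IH(3)) auto
  ultimately show ?case using DisE by (meson prv.DisE)
next
  case (ForallI \<sigma> \<Gamma> \<Delta> \<phi>)
  have "prv L T (\<sigma> # \<Gamma>) (map lift_fm \<Delta>') \<phi>"
    using ForallI.prems wff_lift by (intro ForallI.IH) auto
  then show ?case using ForallI by (intro prv.ForallI) auto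
next
  case (ExistsE \<Gamma> \<Delta> \<sigma> \<phi> \<psi>)
  have *: "wff L (\<sigma> # \<Gamma>) \<phi>" using prv_wff ExistsE.hyps(1) by fastforce+
  have "prv L T (\<sigma> # \<Gamma>) (\<phi> # map lift_fm \<Delta>') (lift_fm \<psi>)"
    using ExistsE.prems wff_lift * by (intro ExistsE.IH) auto
  then show ?case using ExistsE by (meson prv.ExistsE)
qed (meson prv.intros)+

text \<open>Needed to rename eigenvariables. The quantifier rules survive because
  \<open>up \<theta>\<close> commutes with lifting; only the variables of \<open>\<Gamma>\<close>
  need well-typed images.\<close>

lemma prv_sub:
  assumes T: "sub_closed T"
  shows "prv L T \<Gamma> \<Delta> \<phi> \<Longrightarrow> (\<And>n. n < length \<Gamma> \<Longrightarrow> typ_of \<Gamma>' (\<theta> n) = Some (\<Gamma> ! n)) \<Longrightarrow>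
    prv L T \<Gamma>' (map (sub_fm \<theta>) \<Delta>) (sub_fm \<theta> \<phi>)"
proof (induction arbitrary: \<Gamma>' \<theta> rule: prv.induct)
  case (Axiom \<phi> \<Gamma> \<Delta>)
  then show ?case using T wff_sub
    by (intro prv.Axiom) (auto simp: sub_closed_def)
next
  case (Assm \<phi> \<Delta> \<Gamma>)
  then show ?case using wff_sub by (intro prv.Assm) auto
next
  case (ImpI \<Gamma> \<phi> \<Delta> \<psi>)
  then show ?case using wff_sub [OF ImpI.hyps(2), of \<Gamma>' \<theta>] by (auto intro!: prv.ImpI)
next
  case (Classical \<Gamma> \<phi> \<Delta>)
  then show ?case using wff_sub [OF Classical.hyps(2), of \<Gamma>' \<theta>] by (simp add: prv.Classical)
next
  case (ConI \<Gamma> \<Delta> \<phi> \<psi>)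
  then show ?case using wff_sub [OF ConI.hyps(3), of \<Gamma>' \<theta>] by (auto intro!: prv.ConI)
next
  case (DisI1 \<Gamma> \<Delta> \<phi> \<psi>)
  then show ?case using wff_sub [OF DisI1.hyps(2), of \<Gamma>' \<theta>] by (auto intro!: prv.DisI1)
next
  case (DisI2 \<Gamma> \<Delta> \<phi> \<psi>)
  then show ?case using wff_sub [OF DisI2.hyps(2), of \<Gamma>' \<theta>] by (auto intro!: prv.DisI2)
next
  case (DisE \<Gamma> \<Delta> \<phi> \<psi> \<chi>)
  show ?case by (rule prv.DisE) (use DisE in auto)
next
  case (ForallI \<sigma> \<Gamma> \<Delta> \<phi>)
  have "prv L T (\<sigma> # \<Gamma>') (map (sub_fm (up \<theta>)) (map lift_fm \<Delta>)) (sub_fm (up \<theta>) \<phi>)"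
    by (rule ForallI.IH) (use ForallI.prems up_typed in auto)
  moreover have "\<forall>\<psi>\<in>set \<Delta>. wff L \<Gamma>' (sub_fm \<theta> \<psi>)"
    using ForallI.hyps(2) ForallI.prems wff_sub by blast
  ultimately show ?case
    using ForallI.prems wff_sub [OF ForallI.hyps(3), of \<Gamma>' \<theta>]
    by (auto intro!: prv.ForallI simp: sub_up_lift_fm comp_def)
next
  case (ForallE \<Gamma> \<Delta> \<sigma> \<phi> t)
  have "typ_of \<Gamma>' (sub_tm \<theta> t) = Some \<sigma>" using ForallE by (auto intro: typ_of_sub)
  then show ?case using ForallE by (auto intro!: prv.ForallE simp: sub_inst_fm)
next
  case (ExistsI \<Gamma> \<Delta> t \<phi> \<sigma>)
  have "typ_of \<Gamma>' (sub_tm \<theta> t) = Some \<sigma>" using ExistsI by (auto intro: typ_of_sub)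
  then show ?case using ExistsI wff_sub [OF ExistsI.hyps(3), of \<Gamma>' \<theta>]
    by (auto intro!: prv.ExistsI [of _ _ _ _ "sub_tm \<theta> t"] simp: sub_inst_fm)
next
  case (ExistsE \<Gamma> \<Delta> \<sigma> \<phi> \<psi>)
  have "prv L T (\<sigma> # \<Gamma>') (map (sub_fm (up \<theta>)) (\<phi> # map lift_fm \<Delta>)) (sub_fm (up \<theta>) (lift_fm \<psi>))"
    by (rule ExistsE.IH) (use ExistsE.prems up_typed in auto)
  moreover have "prv L T \<Gamma>' (map (sub_fm \<theta>) \<Delta>) (Exists \<sigma> (sub_fm (up \<theta>) \<phi>))"
    using ExistsE.IH(1) ExistsE.prems by simp
  ultimately show ?case
    using wff_sub [OF ExistsE.hyps(3), of \<Gamma>' \<theta>] ExistsE.prems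
    by (simp add: sub_up_lift_fm comp_def prv.ExistsE [of _ _ _ _ \<sigma> "sub_fm (up \<theta>) \<phi>"])
qed (simp; metis prv.ImpE prv.ConE1 prv.ConE2)+

lemma prv_append:
  assumes "sub_closed T" "prv L T \<Gamma> \<Delta> \<phi>"
  shows "prv L T (\<Gamma> @ \<Gamma>') \<Delta> \<phi>"
proof -
  have "prv L T (\<Gamma> @ \<Gamma>') (map (sub_fm Var) \<Delta>) (sub_fm Var \<phi>)"
    by (rule prv_sub [OF assms]) (simp add: nth_append)
  then show ?thesis by (simp add: map_idI)
qed

text \<open>Eigenvariables are appended at the end of the context, so that the variables already in
  use keep their indices.\<close>

lemma prv_witness:
  assumes T: "sub_closed T"
    and d: "prv L T (\<Gamma> @ [\<sigma>]) (inst_fm (Var (length \<Gamma>)) \<phi> # \<Delta>) Fls"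
    and wf: "wff L (\<sigma> # \<Gamma>) \<phi>" "\<forall>\<psi>\<in>set \<Delta>. wff L \<Gamma> \<psi>"
    and ex: "prv L T \<Gamma> \<Delta> (Exists \<sigma> \<phi>)"
  shows "prv L T \<Gamma> \<Delta> Fls"
proof -
  \<comment> \<open>\<open>ExistsE\<close> wants the eigenvariable at position 0: this substitution
    moves it there from the end of the context and shifts the others.\<close>
  define \<theta> where "\<theta> i = (if i < length \<Gamma> then Var (Suc i) else Var 0)" for i
  have "prv L T (\<sigma> # \<Gamma>) (map (sub_fm \<theta>) (inst_fm (Var (length \<Gamma>)) \<phi> # \<Delta>)) (sub_fm \<theta> Fls)"
    by (rule prv_sub [OF T d]) (auto simp: \<theta>_def nth_append less_Suc_eq)
  moreover have "sub_fm \<theta> (inst_fm (Var (length \<Gamma>)) \<phi>) = \<phi>"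
  proof -
    have "sub_fm \<theta> (inst_fm (Var (length \<Gamma>)) \<phi>) = sub_fm Var \<phi>"
      unfolding inst_fm_def sub_fm_comp
      by (rule sub_fm_typed_cong [of "\<sigma> # \<Gamma>"])
        (use wf in \<open>auto simp: wff_def \<theta>_def less_Suc_eq_0_disj\<close>)
    then show ?thesis by simp
  qed
  moreover have "map (sub_fm \<theta>) \<Delta> = map lift_fm \<Delta>"
    unfolding lift_fm_def
    by (rule map_cong) (use wf in \<open>auto simp: wff_def \<theta>_def intro!: sub_fm_typed_cong\<close>)
  ultimately show ?thesis
    by (intro prv.ExistsE [OF ex]) (simp_all add: lift_fm_def)
qed

lemma prv_cut:
  assumes "prv L T \<Gamma> (\<phi> # \<Delta>) \<psi>" "prv L T \<Gamma> \<Delta> \<phi>"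
  shows "prv L T \<Gamma> \<Delta> \<psi>"
proof -
  have "wff L \<Gamma> (Imp \<phi> \<psi>)" using assms prv_wff by auto
  then show ?thesis using assms prv.ImpE prv.ImpI by blast
qed

text \<open>The Henkin construction supplies witnesses for existential formulas only; a refuted
  universal formula gets its counterexample through this classical step.\<close>

lemma prv_not_Forall:
  assumes "prv L T \<Gamma> \<Delta> (Neg (Forall \<sigma> \<phi>))"
  shows "prv L T \<Gamma> \<Delta> (Exists \<sigma> (Neg \<phi>))"
proof -
  have wf: "wff L (\<sigma> # \<Gamma>) \<phi>" "\<forall>\<psi>\<in>set \<Delta>. wff L \<Gamma> \<psi>" using prv_wff [OF assms] by auto
  let ?N = "Neg (Exists \<sigma> (Neg \<phi>))"
  let ?D = "map lift_fm (?N # \<Delta>)"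
  let ?E = "Neg \<phi> # ?D"
  have wfE: "\<forall>\<psi>\<in>set ?E. wff L (\<sigma> # \<Gamma>) \<psi>"
    using wf wff_lift wff_lift [of \<Gamma> ?N \<sigma>] by auto
  have i: "inst_fm (Var 0) (sub_fm (up (\<lambda>n. Var (Suc n))) \<phi>) = \<phi>"
  proof -
    have "sub_fm (\<lambda>n. case n of 0 \<Rightarrow> Var 0 | Suc m \<Rightarrow> Var (Suc m)) \<phi> = sub_fm Var \<phi>"
      by (rule sub_fm_cong_fun) (auto split: nat.split)
    then show ?thesis by (simp add: inst_sub_up)
  qed
  have n: "lift_fm ?N = Neg (Exists \<sigma> (Neg (sub_fm (up (\<lambda>n. Var (Suc n))) \<phi>)))"
    by (simp add: lift_fm_def)
  have "prv L T (\<sigma> # \<Gamma>) ?E (lift_fm ?N)" using wfE by (intro prv.Assm) auto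
  moreover have "prv L T (\<sigma> # \<Gamma>) ?E (Exists \<sigma> (Neg (sub_fm (up (\<lambda>n. Var (Suc n))) \<phi>)))"
  proof (rule prv.ExistsI [of _ _ _ _ "Var 0"])
    show "prv L T (\<sigma> # \<Gamma>) ?E (inst_fm (Var 0) (Neg (sub_fm (up (\<lambda>n. Var (Suc n))) \<phi>)))"
      using wfE i by (intro prv.Assm) (auto simp: inst_fm_def)
  qed (use wfE n in auto)
  ultimately have "prv L T (\<sigma> # \<Gamma>) ?E Fls" using prv.ImpE n by simp
  then have "prv L T (\<sigma> # \<Gamma>) ?D \<phi>" using wf by (simp add: prv.Classical)
  then have "prv L T \<Gamma> (?N # \<Delta>) (Forall \<sigma> \<phi>)" using wf by (auto intro!: prv.ForallI)
  moreover have "prv L T \<Gamma> (?N # \<Delta>) (Neg (Forall \<sigma> \<phi>))"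
    by (rule prv_weaken [OF assms]) (use wf in auto)
  ultimately have "prv L T \<Gamma> (?N # \<Delta>) Fls" by (meson prv.ImpE)
  then show ?thesis using wf by (simp add: prv.Classical)
qed

end

lemma language_UNIV: "language UNIV"
  by unfold_locales auto

lemma language_internal: "language (Collect internal)"
  by unfold_locales auto

section \<open>Structures\<close>

text \<open>All types share one carrier; \<open>dom\<close> cuts out the objects of a type, and
  \<open>app\<close> is a total function that matters only on matching types. So evaluation needs no
  dependent types.\<close>

record 'v struct =
  dom :: "ty \<Rightarrow> 'v set"
  app :: "'v \<Rightarrow> 'v \<Rightarrow> 'v"
  cst :: "cst \<Rightarrow> 'v"
  std :: "ty \<Rightarrow> 'v \<Rightarrow> bool"

fun ev :: "('v, 'x) struct_scheme \<Rightarrow> 'v list \<Rightarrow> tm \<Rightarrow> 'v" where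
  "ev M e (Var n) = e ! n"
| "ev M e (Cst c) = cst M c"
| "ev M e (s \<cdot> t) = app M (ev M e s) (ev M e t)"

fun sat :: "('v, 'x) struct_scheme \<Rightarrow> 'v list \<Rightarrow> fm \<Rightarrow> bool" where
  "sat M e (Equ s t) \<longleftrightarrow> ev M e s = ev M e t"
| "sat M e (St \<sigma> t) \<longleftrightarrow> std M \<sigma> (ev M e t)"
| "sat M e Fls \<longleftrightarrow> False"
| "sat M e (Imp \<phi> \<psi>) \<longleftrightarrow> (sat M e \<phi> \<longrightarrow> sat M e \<psi>)"
| "sat M e (Con \<phi> \<psi>) \<longleftrightarrow> sat M e \<phi> \<and> sat M e \<psi>"
| "sat M e (Dis \<phi> \<psi>) \<longleftrightarrow> sat M e \<phi> \<or> sat M e \<psi>"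
| "sat M e (Forall \<sigma> \<phi>) \<longleftrightarrow> (\<forall>x\<in>dom M \<sigma>. sat M (x # e) \<phi>)"
| "sat M e (Exists \<sigma> \<phi>) \<longleftrightarrow> (\<exists>x\<in>dom M \<sigma>. sat M (x # e) \<phi>)"

definition env :: "('v, 'x) struct_scheme \<Rightarrow> ty list \<Rightarrow> 'v list \<Rightarrow> bool" where
  "env M \<Gamma> e \<longleftrightarrow> list_all2 (\<lambda>\<sigma> x. x \<in> dom M \<sigma>) \<Gamma> e"

lemma env_simps [simp]:
  "env M [] e \<longleftrightarrow> e = []"
  "env M (\<sigma> # \<Gamma>) (x # e) \<longleftrightarrow> x \<in> dom M \<sigma> \<and> env M \<Gamma> e"
  by (auto simp: env_def)

text \<open>\<open>sat_EqT\<close> makes the models normal: the defined equality of every type is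
  identity, so extensionality turns into substitution of equals. Axioms are open and must hold for
  all values of their variables.\<close>

locale model =
  fixes M :: "'v struct" and L T :: "fm set"
  assumes app_dom: "f \<in> dom M (\<sigma> \<Rrightarrow> \<tau>) \<Longrightarrow> x \<in> dom M \<sigma> \<Longrightarrow> app M f x \<in> dom M \<tau>"
    and cst_dom: "cst M c \<in> dom M (cty c)"
    and sat_EqT: "env M \<Gamma> e \<Longrightarrow> typ_of \<Gamma> s = Some \<sigma> \<Longrightarrow> typ_of \<Gamma> t = Some \<sigma> \<Longrightarrow>
      sat M e (EqT \<sigma> s t) \<longleftrightarrow> ev M e s = ev M e t"
    and axiom: "\<phi> \<in> T \<Longrightarrow> wff L \<Gamma> \<phi> \<Longrightarrow> env M \<Gamma> e \<Longrightarrow> sat M e \<phi>"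

section \<open>Completeness\<close>

instance ty :: countable by countable_datatype
instance cst :: countable by countable_datatype
instance tm :: countable by countable_datatype
instance fm :: countable by countable_datatype

lemma well_typed_Lt [simp]:
  "well_typed \<Gamma> (Lt s t) \<longleftrightarrow> typ_of \<Gamma> s = Some Nt \<and> typ_of \<Gamma> t = Some Nt"
  by (auto simp: Lt_def Le_def typ_of_monus split: option.splits ty.splits if_splits)

lemma well_typed_EqT:
  "typ_of \<Gamma> s = Some \<sigma> \<Longrightarrow> typ_of \<Gamma> t = Some \<sigma> \<Longrightarrow> well_typed \<Gamma> (EqT \<sigma> s t)"
  by (induction \<sigma> arbitrary: s t \<Gamma>) (auto simp: typ_of_lift)

lemma internal_EqT [simp]: "internal (EqT \<sigma> s t)"
  by (induction \<sigma> arbitrary: s t) (auto simp: Lt_def Le_def)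

lemma inst_EqT_lift:
  "inst_fm u (EqT \<tau> (lift s \<cdot> Var 0) (lift t \<cdot> Var 0)) = EqT \<tau> (s \<cdot> u) (t \<cdot> u)"
  by (simp add: inst_fm_def)

section \<open>Henkin's theory with witnesses\<close>

locale henkin = language L for L +
  fixes T :: "fm set" and \<chi> :: fm
  assumes T: "sub_closed T" and EPRA_T: "EPRA_ax \<subseteq> T"
    and St_T: "L \<subseteq> Collect internal \<or> T_st \<subseteq> T"
    and wff_\<chi>: "wff L [] \<chi>" and unprovable: "\<not> prv L T [] [] \<chi>"
begin

text \<open>Witnesses are variables appended to the context, so no new constants enter the language
  and old variables keep their indices. The existential formula is kept as well, since it has to
  hold in the limit.\<close>

fun add_witness :: "ty list \<Rightarrow> fm list \<Rightarrow> fm \<Rightarrow> ty list \<times> fm list" where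
  "add_witness \<Gamma> \<Delta> (Exists \<sigma> \<phi>) =
     (\<Gamma> @ [\<sigma>], inst_fm (Var (length \<Gamma>)) \<phi> # Exists \<sigma> \<phi> # \<Delta>)"
| "add_witness \<Gamma> \<Delta> \<psi> = (\<Gamma>, \<psi> # \<Delta>)"

definition extend :: "ty list \<times> fm list \<Rightarrow> fm \<Rightarrow> ty list \<times> fm list" where
  "extend p \<psi> =
    (if wff L (fst p) \<psi> \<and> \<not> prv L T (fst p) (\<psi> # snd p) Fls
     then add_witness (fst p) (snd p) \<psi> else p)"

text \<open>Every formula is treated at infinitely many stages.\<close>

primrec stage :: "nat \<Rightarrow> ty list \<times> fm list" where
  "stage 0 = ([], [Neg \<chi>])"
| "stage (Suc n) = extend (stage n) (from_nat (fst (prod_decode n)))"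

declare stage.simps(2) [simp del]

abbreviation C :: "nat \<Rightarrow> ty list" where "C n \<equiv> fst (stage n)"
abbreviation H :: "nat \<Rightarrow> fm list" where "H n \<equiv> snd (stage n)"
abbreviation P :: "nat \<Rightarrow> fm \<Rightarrow> bool" where "P n \<equiv> prv L T (C n) (H n)"

definition ok :: "ty list \<times> fm list \<Rightarrow> bool" where
  "ok p \<longleftrightarrow> (\<forall>\<psi>\<in>set (snd p). wff L (fst p) \<psi>) \<and> \<not> prv L T (fst p) (snd p) Fls"

lemma ok_extend: "ok p \<Longrightarrow> ok (extend p \<psi>)"
proof (cases "wff L (fst p) \<psi> \<and> \<not> prv L T (fst p) (\<psi> # snd p) Fls \<and> (\<exists>\<sigma> \<phi>. \<psi> = Exists \<sigma> \<phi>)")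
  case True
  assume p: "ok p"
  obtain \<Gamma> \<Delta> where [simp]: "p = (\<Gamma>, \<Delta>)" by fastforce
  from True obtain \<sigma> \<phi> where [simp]: "\<psi> = Exists \<sigma> \<phi>" by auto
  have wf: "wff L (\<sigma> # \<Gamma>) \<phi>" and *: "\<forall>\<theta>\<in>set (\<psi> # \<Delta>). wff L \<Gamma> \<theta>"
    using True p by (auto simp: ok_def)
  have "prv L T \<Gamma> (\<psi> # \<Delta>) \<psi>" using * by (intro prv.Assm) auto
  then have "\<not> prv L T (\<Gamma> @ [\<sigma>]) (inst_fm (Var (length \<Gamma>)) \<phi> # \<psi> # \<Delta>) Fls"
    using prv_witness [OF T _ wf *] True by auto
  moreover have "wff L (\<Gamma> @ [\<sigma>]) (inst_fm (Var (length \<Gamma>)) \<phi>)"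
    using wff_append [OF wf, of "[\<sigma>]"] by (intro wff_inst [of \<sigma>]) (auto simp: nth_append)
  moreover have "\<forall>\<theta>\<in>set (\<psi> # \<Delta>). wff L (\<Gamma> @ [\<sigma>]) \<theta>"
    using * wff_append by blast
  ultimately show ?thesis using True by (auto simp: extend_def ok_def)
next
  case False
  assume p: "ok p"
  have "add_witness \<Gamma> \<Delta> \<psi> = (\<Gamma>, \<psi> # \<Delta>)" if "\<nexists>\<sigma> \<phi>. \<psi> = Exists \<sigma> \<phi>" for \<Gamma> \<Delta>
    using that by (cases \<psi>) auto
  then show ?thesis using False p by (auto simp: extend_def ok_def)
qed

lemma ok_stage: "ok (stage n)"
proof (induction n)
  case 0
  have "prv L T [] [] \<chi>" if "prv L T [] [Neg \<chi>] Fls"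
    using that wff_\<chi> by (rule prv.Classical)
  then show ?case using wff_\<chi> unprovable by (auto simp: ok_def)
qed (simp add: ok_extend stage.simps)

lemma wff_H: "\<psi> \<in> set (H n) \<Longrightarrow> wff L (C n) \<psi>" and consistent: "\<not> P n Fls"
  using ok_stage by (auto simp: ok_def)

lemma extend_mono:
  "(\<exists>\<Gamma>'. fst (extend p \<psi>) = fst p @ \<Gamma>') \<and> set (snd p) \<subseteq> set (snd (extend p \<psi>))"
  by (cases \<psi>) (auto simp: extend_def)

lemma stage_mono: "n \<le> m \<Longrightarrow> (\<exists>\<Gamma>'. C m = C n @ \<Gamma>') \<and> set (H n) \<subseteq> set (H m)"
proof (induction m rule: nat_induct_at_least)
  case (Suc m)
  then show ?case using extend_mono [of "stage m"] by (simp add: stage.simps) (metis append.assoc subset_trans)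
qed auto

lemma P_mono: "P n \<phi> \<Longrightarrow> n \<le> m \<Longrightarrow> P m \<phi>"
proof -
  assume "P n \<phi>" "n \<le> m"
  then obtain \<Gamma>' where "C m = C n @ \<Gamma>'" "set (H n) \<subseteq> set (H m)" using stage_mono by blast
  then show ?thesis
    using prv_append [OF T \<open>P n \<phi>\<close>, of \<Gamma>'] wff_H by (metis prv_weaken)
qed

lemma P_weaken: "P n \<phi> \<Longrightarrow> wff L (C n) \<psi> \<Longrightarrow> prv L T (C n) (\<psi> # H n) \<phi>"
  by (rule prv_weaken) (use wff_H in auto)

lemma P_head: "wff L (C n) \<psi> \<Longrightarrow> prv L T (C n) (\<psi> # H n) \<psi>"
  by (rule prv.Assm) (use wff_H in auto)

lemma P_Assm: "\<psi> \<in> set (H n) \<Longrightarrow> P n \<psi>"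
  by (rule prv.Assm) (use wff_H in auto)

lemma typ_of_mono: "typ_of (C n) t = Some \<sigma> \<Longrightarrow> n \<le> m \<Longrightarrow> typ_of (C m) t = Some \<sigma>"
  using stage_mono typ_of_append by metis

lemma wff_mono: "wff L (C n) \<phi> \<Longrightarrow> n \<le> m \<Longrightarrow> wff L (C m) \<phi>"
  using stage_mono wff_append by metis

text \<open>Typing, well-formedness and provability in the limit of the stages. Contexts grow at the
  end and hypotheses accumulate, so what holds at one stage holds at all later ones, and finitely
  many facts can be brought to a common stage.\<close>

definition TY :: "tm \<Rightarrow> ty \<Rightarrow> bool" where "TY t \<sigma> \<longleftrightarrow> (\<exists>n. typ_of (C n) t = Some \<sigma>)"
definition WF :: "fm \<Rightarrow> bool" where "WF \<phi> \<longleftrightarrow> (\<exists>n. wff L (C n) \<phi>)"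
definition Holds :: "fm \<Rightarrow> bool" where "Holds \<phi> \<longleftrightarrow> (\<exists>n. P n \<phi>)"

lemma Holds_Fls [simp]: "\<not> Holds Fls"
  using consistent by (auto simp: Holds_def)

lemma Holds_ImpD: "Holds (Imp \<phi> \<psi>) \<Longrightarrow> Holds \<phi> \<Longrightarrow> Holds \<psi>"
proof -
  assume "Holds (Imp \<phi> \<psi>)" "Holds \<phi>"
  then obtain n m where "P n (Imp \<phi> \<psi>)" "P m \<phi>" by (auto simp: Holds_def)
  then have "P (max n m) \<psi>" by (meson P_mono max.cobounded1 max.cobounded2 prv.ImpE)
  then show ?thesis by (auto simp: Holds_def)
qed

text \<open>A formula may become well-formed only after its variables have entered the context, so
  it has to be treated again beyond any given stage.\<close>

lemma stage_for:
  obtains m where "n \<le> m" "stage (Suc m) = extend (stage m) \<phi>"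
proof
  show "n \<le> prod_encode (to_nat \<phi>, n)" by (rule le_prod_encode_2)
qed (simp add: stage.simps)

lemma set_add_witness: "set (\<psi> # \<Delta>) \<subseteq> set (snd (add_witness \<Gamma> \<Delta> \<psi>))"
  by (cases \<psi>) auto

lemma Holds_or_Neg: "WF \<phi> \<Longrightarrow> Holds \<phi> \<or> Holds (Neg \<phi>)"
proof -
  assume "WF \<phi>"
  then obtain n where "wff L (C n) \<phi>" by (auto simp: WF_def)
  obtain m where m: "n \<le> m" "stage (Suc m) = extend (stage m) \<phi>" by (rule stage_for)
  have wf: "wff L (C m) \<phi>" using wff_mono m \<open>wff L (C n) \<phi>\<close> by blast
  show ?thesis
  proof (cases "prv L T (C m) (\<phi> # H m) Fls")
    case True
    then have "P m (Neg \<phi>)" using wf by (auto intro: prv.ImpI)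
    then show ?thesis by (auto simp: Holds_def)
  next
    case False
    then have "stage (Suc m) = add_witness (C m) (H m) \<phi>"
      using m wf by (auto simp: extend_def)
    then have "\<phi> \<in> set (H (Suc m))" using set_add_witness by fastforce
    then have "P (Suc m) \<phi>" by (rule P_Assm)
    then show ?thesis unfolding Holds_def by blast
  qed
qed

lemma Holds_Imp [simp]: "WF (Imp \<phi> \<psi>) \<Longrightarrow> Holds (Imp \<phi> \<psi>) \<longleftrightarrow> (Holds \<phi> \<longrightarrow> Holds \<psi>)"
proof
  assume "WF (Imp \<phi> \<psi>)" and *: "Holds \<phi> \<longrightarrow> Holds \<psi>"
  then obtain k where k: "wff L (C k) \<phi>" "wff L (C k) \<psi>" by (auto simp: WF_def)
  have wf: "wff L (C m) \<phi>" "wff L (C m) \<psi>" if "k \<le> m" for m using k wff_mono that by blast+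
  show "Holds (Imp \<phi> \<psi>)"
  proof (cases "Holds \<psi>")
    case True
    then obtain n where "P n \<psi>" by (auto simp: Holds_def)
    then have "P (max k n) \<psi>" using P_mono by simp
    then have "prv L T (C (max k n)) (\<phi> # H (max k n)) \<psi>"
      using wf P_weaken by simp
    then have "P (max k n) (Imp \<phi> \<psi>)" using wf by (auto intro: prv.ImpI)
    then show ?thesis unfolding Holds_def by blast
  next
    case False
    then have "Holds (Neg \<phi>)" using * Holds_or_Neg k WF_def by blast
    then obtain n where "P n (Neg \<phi>)" by (auto simp: Holds_def)
    then have n: "P (max k n) (Neg \<phi>)" using P_mono by simp
    let ?\<Gamma> = "C (max k n)" and ?\<Delta> = "Neg \<psi> # \<phi> # H (max k n)"
    have D: "\<forall>\<theta>\<in>set ?\<Delta>. wff L ?\<Gamma> \<theta>" using wf wff_H by auto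
    have "prv L T ?\<Gamma> ?\<Delta> (Neg \<phi>)" by (rule prv_weaken [OF n _ D]) auto
    moreover have "prv L T ?\<Gamma> ?\<Delta> \<phi>" using D by (intro prv.Assm) auto
    ultimately have "prv L T ?\<Gamma> ?\<Delta> Fls" by (rule prv.ImpE)
    then have "prv L T ?\<Gamma> (\<phi> # H (max k n)) \<psi>" using wf by (simp add: prv.Classical)
    then have "P (max k n) (Imp \<phi> \<psi>)" using wf by (auto intro: prv.ImpI)
    then show ?thesis unfolding Holds_def by blast
  qed
qed (use Holds_ImpD in blast)

lemma Holds_Con [simp]: "Holds (Con \<phi> \<psi>) \<longleftrightarrow> Holds \<phi> \<and> Holds \<psi>"
proof
  assume "Holds \<phi> \<and> Holds \<psi>"
  then obtain n m where "P n \<phi>" "P m \<psi>" by (auto simp: Holds_def)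
  then have "P (max n m) \<phi>" "P (max n m) \<psi>" using P_mono by auto
  then have "P (max n m) (Con \<phi> \<psi>)" using prv_wff by (auto intro!: prv.ConI)
  then show "Holds (Con \<phi> \<psi>)" unfolding Holds_def by blast
qed (auto simp: Holds_def intro: prv.ConE1 prv.ConE2)

lemma Holds_Dis [simp]: "WF (Dis \<phi> \<psi>) \<Longrightarrow> Holds (Dis \<phi> \<psi>) \<longleftrightarrow> Holds \<phi> \<or> Holds \<psi>"
proof
  assume "WF (Dis \<phi> \<psi>)"
  then obtain k where k: "wff L (C k) \<phi>" "wff L (C k) \<psi>" by (auto simp: WF_def)
  have wf: "wff L (C m) \<phi>" "wff L (C m) \<psi>" if "k \<le> m" for m using k wff_mono that by blast+
  {
    assume "Holds \<phi> \<or> Holds \<psi>"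
    then obtain n where "P n \<phi> \<or> P n \<psi>" by (auto simp: Holds_def)
    then have "P (max k n) \<phi> \<or> P (max k n) \<psi>" using P_mono by auto
    then have "P (max k n) (Dis \<phi> \<psi>)" using wf by (auto intro: prv.DisI1 prv.DisI2)
    then show "Holds (Dis \<phi> \<psi>)" unfolding Holds_def by blast
  next
    assume d: "Holds (Dis \<phi> \<psi>)"
    show "Holds \<phi> \<or> Holds \<psi>"
    proof (rule ccontr)
      assume "\<not> (Holds \<phi> \<or> Holds \<psi>)"
      then have "Holds (Neg \<phi>)" "Holds (Neg \<psi>)" using Holds_or_Neg k WF_def by blast+
      then obtain n m l where "P n (Neg \<phi>)" "P m (Neg \<psi>)" "P l (Dis \<phi> \<psi>)"
        using d by (auto simp: Holds_def)
      define j where "j = max k (max n (max m l))"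
      have j: "P j (Neg \<phi>)" "P j (Neg \<psi>)" "P j (Dis \<phi> \<psi>)" "k \<le> j"
        using \<open>P n (Neg \<phi>)\<close> \<open>P m (Neg \<psi>)\<close> \<open>P l (Dis \<phi> \<psi>)\<close> P_mono
        by (auto simp: j_def le_max_iff_disj)
      have "prv L T (C j) (\<theta> # H j) Fls" if "P j (Neg \<theta>)" "wff L (C j) \<theta>" for \<theta>
      proof -
        have "prv L T (C j) (\<theta> # H j) (Neg \<theta>)"
          using that by (rule P_weaken)
        moreover have "prv L T (C j) (\<theta> # H j) \<theta>"
          using that by (simp add: P_head)
        ultimately show ?thesis by (rule prv.ImpE)
      qed
      then have "P j Fls" using j wf by (meson prv.DisE)
      then show False using consistent by blast
    qed
  }
qed

text \<open>A provable formula is consistent with the hypotheses, so a later stage that treats it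
  adds the instance with the fresh variable.\<close>

lemma Holds_ExistsD: "Holds (Exists \<sigma> \<phi>) \<Longrightarrow> \<exists>t. TY t \<sigma> \<and> Holds (inst_fm t \<phi>)"
proof -
  let ?E = "Exists \<sigma> \<phi>"
  assume "Holds ?E"
  then obtain n where "P n ?E" by (auto simp: Holds_def)
  obtain m where m: "n \<le> m" "stage (Suc m) = extend (stage m) ?E" by (rule stage_for)
  have E: "P m ?E" using \<open>P n ?E\<close> m P_mono by blast
  then have "\<not> prv L T (C m) (?E # H m) Fls" using prv_cut consistent by blast
  then have *: "stage (Suc m) = (C m @ [\<sigma>], inst_fm (Var (length (C m))) \<phi> # ?E # H m)"
    using m prv_wff [OF E] by (auto simp: extend_def)
  then have "P (Suc m) (inst_fm (Var (length (C m))) \<phi>)"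
    by (intro P_Assm) simp
  moreover have "typ_of (C (Suc m)) (Var (length (C m))) = Some \<sigma>"
    unfolding * by simp
  ultimately show ?thesis unfolding Holds_def TY_def by blast
qed

lemma Holds_Exists [simp]:
  "WF (Exists \<sigma> \<phi>) \<Longrightarrow> Holds (Exists \<sigma> \<phi>) \<longleftrightarrow> (\<exists>t. TY t \<sigma> \<and> Holds (inst_fm t \<phi>))"
proof
  assume "WF (Exists \<sigma> \<phi>)" and "\<exists>t. TY t \<sigma> \<and> Holds (inst_fm t \<phi>)"
  then obtain k n m t where "wff L (C k) (Exists \<sigma> \<phi>)" "P n (inst_fm t \<phi>)"
      "typ_of (C m) t = Some \<sigma>"
    by (auto simp: WF_def TY_def Holds_def)
  then have "wff L (C (max k (max n m))) (Exists \<sigma> \<phi>)" "P (max k (max n m)) (inst_fm t \<phi>)"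
      "typ_of (C (max k (max n m))) t = Some \<sigma>"
    using wff_mono P_mono typ_of_mono by (meson max.cobounded1 max.cobounded2 max.coboundedI2)+
  then have "P (max k (max n m)) (Exists \<sigma> \<phi>)" by (meson prv.ExistsI)
  then show "Holds (Exists \<sigma> \<phi>)" unfolding Holds_def by blast
qed (rule Holds_ExistsD)

lemma Holds_Forall [simp]:
  "WF (Forall \<sigma> \<phi>) \<Longrightarrow> Holds (Forall \<sigma> \<phi>) \<longleftrightarrow> (\<forall>t. TY t \<sigma> \<longrightarrow> Holds (inst_fm t \<phi>))"
proof
  assume "Holds (Forall \<sigma> \<phi>)"
  then obtain n where n: "P n (Forall \<sigma> \<phi>)" by (auto simp: Holds_def)
  show "\<forall>t. TY t \<sigma> \<longrightarrow> Holds (inst_fm t \<phi>)"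
  proof (intro allI impI)
    fix t assume "TY t \<sigma>"
    then obtain m where "typ_of (C m) t = Some \<sigma>" by (auto simp: TY_def)
    then have "P (max n m) (inst_fm t \<phi>)"
      using n by (meson P_mono typ_of_mono max.cobounded1 max.cobounded2 prv.ForallE)
    then show "Holds (inst_fm t \<phi>)" unfolding Holds_def by blast
  qed
next
  assume wf: "WF (Forall \<sigma> \<phi>)" and all: "\<forall>t. TY t \<sigma> \<longrightarrow> Holds (inst_fm t \<phi>)"
  show "Holds (Forall \<sigma> \<phi>)"
  proof (rule ccontr)
    assume "\<not> Holds (Forall \<sigma> \<phi>)"
    then have "Holds (Neg (Forall \<sigma> \<phi>))" using Holds_or_Neg wf by blast
    then have "Holds (Exists \<sigma> (Neg \<phi>))" unfolding Holds_def using prv_not_Forall by blast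
    then obtain t where t: "TY t \<sigma>" "Holds (inst_fm t (Neg \<phi>))" using Holds_ExistsD by blast
    then have "Holds (Neg (inst_fm t \<phi>))" by (simp add: inst_fm_def)
    then show False using t all Holds_ImpD Holds_Fls by blast
  qed
qed

lemma TY_unique: "TY t \<sigma> \<Longrightarrow> TY t \<tau> \<Longrightarrow> \<sigma> = \<tau>"
  unfolding TY_def using typ_of_mono by (metis nat_le_linear option.inject)

lemma TY_Cst: "TY (Cst c) (cty c)"
  by (auto simp: TY_def)

lemma TY_closed: "typ_of [] t = Some \<sigma> \<Longrightarrow> TY t \<sigma>"
  unfolding TY_def by (rule exI [of _ 0]) simp

lemma TY_App: "TY f (\<sigma> \<Rrightarrow> \<tau>) \<Longrightarrow> TY t \<sigma> \<Longrightarrow> TY (f \<cdot> t) \<tau>"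
proof -
  assume "TY f (\<sigma> \<Rrightarrow> \<tau>)" "TY t \<sigma>"
  then obtain n m where "typ_of (C n) f = Some (\<sigma> \<Rrightarrow> \<tau>)" "typ_of (C m) t = Some \<sigma>"
    by (auto simp: TY_def)
  then have "typ_of (C (max n m)) f = Some (\<sigma> \<Rrightarrow> \<tau>)" "typ_of (C (max n m)) t = Some \<sigma>"
    by (meson typ_of_mono max.cobounded1 max.cobounded2)+
  then have "typ_of (C (max n m)) (f \<cdot> t) = Some \<tau>" by simp
  then show ?thesis unfolding TY_def by blast
qed

lemma TY_list: "list_all2 (\<lambda>\<sigma> t. TY t \<sigma>) \<Gamma> ts \<Longrightarrow>
    \<exists>n. list_all2 (\<lambda>\<sigma> t. typ_of (C n) t = Some \<sigma>) \<Gamma> ts"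
proof (induction rule: list_all2_induct)
  case (Cons \<sigma> \<Gamma> t ts)
  then obtain n m where "typ_of (C m) t = Some \<sigma>" and
      *: "list_all2 (\<lambda>\<sigma> t. typ_of (C n) t = Some \<sigma>) \<Gamma> ts"
    by (auto simp: TY_def)
  have "typ_of (C (max n m)) t = Some \<sigma>"
    using \<open>typ_of (C m) t = Some \<sigma>\<close> by (rule typ_of_mono) simp
  moreover have "list_all2 (\<lambda>\<sigma> t. typ_of (C (max n m)) t = Some \<sigma>) \<Gamma> ts"
    by (rule list_all2_mono [OF *]) (rule typ_of_mono, auto)
  ultimately have "list_all2 (\<lambda>\<sigma> t. typ_of (C (max n m)) t = Some \<sigma>) (\<sigma> # \<Gamma>) (t # ts)"
    by simp
  then show ?case by blast
qed simp

lemma WF_sub: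
  assumes "wff L \<Gamma> \<phi>" "list_all2 (\<lambda>\<sigma> t. TY t \<sigma>) \<Gamma> ts"
  shows "WF (sub_fm ((!) ts) \<phi>)"
proof -
  obtain n where "list_all2 (\<lambda>\<sigma> t. typ_of (C n) t = Some \<sigma>) \<Gamma> ts"
    using TY_list assms by blast
  then have "wff L (C n) (sub_fm ((!) ts) \<phi>)"
    by (intro wff_sub [OF assms(1)]) (auto simp: list_all2_conv_all_nth)
  then show ?thesis by (auto simp: WF_def)
qed

lemma Holds_axiom: "\<phi> \<in> T \<Longrightarrow> WF \<phi> \<Longrightarrow> Holds \<phi>"
  unfolding Holds_def WF_def using wff_H by (blast intro: prv.Axiom)

lemma WF_EqT: "TY s \<sigma> \<Longrightarrow> TY t \<sigma> \<Longrightarrow> WF (EqT \<sigma> s t)"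
proof -
  assume "TY s \<sigma>" "TY t \<sigma>"
  then have "list_all2 (\<lambda>\<sigma> t. TY t \<sigma>) [\<sigma>, \<sigma>] [s, t]" by simp
  moreover have "wff L [\<sigma>, \<sigma>] (EqT \<sigma> (Var 0) (Var 1))"
    by (auto simp: wff_def internal_L intro: well_typed_EqT)
  ultimately show ?thesis
    using WF_sub [of "[\<sigma>, \<sigma>]" "EqT \<sigma> (Var 0) (Var 1)" "[s, t]"] by simp
qed

lemma WF_Imp: "WF \<phi> \<Longrightarrow> WF \<psi> \<Longrightarrow> WF (Imp \<phi> \<psi>)"
  unfolding WF_def using wff_mono by (metis nat_le_linear wff_simps(2))

lemma WF_Lt: "TY s Nt \<Longrightarrow> TY t Nt \<Longrightarrow> WF (Lt s t)"
proof -
  assume "TY s Nt" "TY t Nt"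
  then have "list_all2 (\<lambda>\<sigma> t. TY t \<sigma>) [Nt, Nt] [s, t]" by simp
  moreover have "wff L [Nt, Nt] (Lt (Var 0) (Var 1))"
    unfolding wff_def by (auto simp: Lt_def Le_def typ_of_monus intro: internal_L)
  ultimately show ?thesis
    using WF_sub [of "[Nt, Nt]" "Lt (Var 0) (Var 1)" "[s, t]"] by simp
qed

section \<open>Term model modulo provable equality\<close>

definition eqv :: "ty \<Rightarrow> tm \<Rightarrow> tm \<Rightarrow> bool" where "eqv \<sigma> s t \<longleftrightarrow> Holds (EqT \<sigma> s t)"

lemma eqv_Fun:
  assumes "TY f (\<sigma> \<Rrightarrow> \<tau>)" "TY g (\<sigma> \<Rrightarrow> \<tau>)"
  shows "eqv (\<sigma> \<Rrightarrow> \<tau>) f g \<longleftrightarrow> (\<forall>t. TY t \<sigma> \<longrightarrow> eqv \<tau> (f \<cdot> t) (g \<cdot> t))"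
  using WF_EqT [OF assms] by (simp add: eqv_def inst_EqT_lift)

lemma TY_Len: "TY s (SeqT \<sigma>) \<Longrightarrow> TY (Cst (LenC \<sigma>) \<cdot> s) Nt"
  using TY_App [of "Cst (LenC \<sigma>)"] TY_Cst [of "LenC \<sigma>"] by simp

lemma TY_Proj: "TY s (SeqT \<sigma>) \<Longrightarrow> TY i Nt \<Longrightarrow> TY (Cst (ProjC \<sigma>) \<cdot> s \<cdot> i) \<sigma>"
  using TY_App [OF TY_App [of "Cst (ProjC \<sigma>)"]] TY_Cst [of "ProjC \<sigma>"] by simp

lemma eqv_SeqT:
  assumes "TY s (SeqT \<sigma>)" "TY t (SeqT \<sigma>)"
  shows "eqv (SeqT \<sigma>) s t \<longleftrightarrow> eqv Nt (Cst (LenC \<sigma>) \<cdot> s) (Cst (LenC \<sigma>) \<cdot> t) \<and>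
    (\<forall>i. TY i Nt \<longrightarrow> Holds (Lt i (Cst (LenC \<sigma>) \<cdot> s)) \<longrightarrow>
      eqv \<sigma> (Cst (ProjC \<sigma>) \<cdot> s \<cdot> i) (Cst (ProjC \<sigma>) \<cdot> t \<cdot> i))"
proof -
  let ?\<phi> = "Imp (Lt (Var 0) (Cst (LenC \<sigma>) \<cdot> lift s))
          (EqT \<sigma> (Cst (ProjC \<sigma>) \<cdot> lift s \<cdot> Var 0) (Cst (ProjC \<sigma>) \<cdot> lift t \<cdot> Var 0))"
  have i: "inst_fm i ?\<phi> = Imp (Lt i (Cst (LenC \<sigma>) \<cdot> s))
      (EqT \<sigma> (Cst (ProjC \<sigma>) \<cdot> s \<cdot> i) (Cst (ProjC \<sigma>) \<cdot> t \<cdot> i))" for i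
    by (simp add: inst_fm_def)
  have *: "WF (Con (Equ (Cst (LenC \<sigma>) \<cdot> s) (Cst (LenC \<sigma>) \<cdot> t)) (Forall Nt ?\<phi>))"
    using WF_EqT [OF assms] by simp
  then have "WF (Forall Nt ?\<phi>)" by (auto simp: WF_def)
  moreover have "WF (inst_fm i ?\<phi>)" if "TY i Nt" for i
    unfolding i using that assms by (intro WF_Imp WF_Lt WF_EqT TY_Len TY_Proj)
  ultimately show ?thesis by (auto simp: eqv_def i)
qed

lemma eqv_cong_arg:
  assumes "TY f (\<sigma> \<Rrightarrow> \<tau>)" "TY s \<sigma>" "TY t \<sigma>" "eqv \<sigma> s t"
  shows "eqv \<tau> (f \<cdot> s) (f \<cdot> t)"
proof -
  have "WF (Imp (EqT \<sigma> s t) (EqT \<tau> (f \<cdot> s) (f \<cdot> t)))"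
    using assms by (intro WF_Imp WF_EqT TY_App)
  moreover have "Imp (EqT \<sigma> s t) (EqT \<tau> (f \<cdot> s) (f \<cdot> t)) \<in> T"
    using EPRA_T EPRA_ax.extensionality by blast
  ultimately have "Holds (Imp (EqT \<sigma> s t) (EqT \<tau> (f \<cdot> s) (f \<cdot> t)))" by (rule Holds_axiom [rotated])
  then show ?thesis using assms Holds_ImpD by (auto simp: eqv_def)
qed

lemma Equ_refl: "TY t Nt \<Longrightarrow> Holds (Equ t t)"
  using Holds_axiom EPRA_T EPRA_ax.eq_refl WF_EqT [of t Nt t] by auto

lemma Equ_eucl:
  assumes "TY s Nt" "TY t Nt" "TY u Nt" "Holds (Equ s t)" "Holds (Equ s u)"
  shows "Holds (Equ t u)"
proof -
  have "WF (Imp (EqT Nt s t) (Imp (EqT Nt s u) (EqT Nt t u)))"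
    using assms by (intro WF_Imp WF_EqT)
  then have "Holds (Imp (Equ s t) (Imp (Equ s u) (Equ t u)))"
    using EPRA_T EPRA_ax.eq_eucl by (intro Holds_axiom) (auto simp del: Holds_Imp)
  then show ?thesis using assms Holds_ImpD by blast
qed

text \<open>In \<open>EqT\<close> for sequences the index is bounded by the length of the first
  sequence, so the Euclidean law has to carry the bound over to an equal length. The reason is
  extensionality for the function \<open>monus_c \<cdot> Sc i\<close>.\<close>

lemma Lt_cong:
  assumes "TY i Nt" "TY s Nt" "TY t Nt" "eqv Nt s t" "Holds (Lt i s)"
  shows "Holds (Lt i t)"
proof -
  have m: "TY (monus_c \<cdot> Sc i) (Nt \<Rrightarrow> Nt)"
    using TY_App [OF TY_closed [OF typ_of_monus] TY_App [of "Cst SuccC"]] TY_Cst [of SuccC] assms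
    by simp
  have "eqv Nt (Sc i \<ominus> s) (Sc i \<ominus> t)" using assms m by (intro eqv_cong_arg)
  then show ?thesis
    unfolding Lt_def Le_def eqv_def EqT.simps
    by (rule Equ_eucl [rotated 3])
      (use assms m TY_App [OF m] TY_Cst [of ZeroC] in \<open>simp_all add: Lt_def Le_def\<close>)
qed

lemma eqv_refl: "TY t \<sigma> \<Longrightarrow> eqv \<sigma> t t"
proof (induction \<sigma> arbitrary: t)
  case Nt
  then show ?case by (simp add: eqv_def Equ_refl)
next
  case (Fun \<sigma> \<tau>)
  then show ?case by (auto simp: eqv_Fun intro: TY_App)
next
  case (SeqT \<sigma>)
  show ?case
    unfolding eqv_SeqT [OF SeqT.prems SeqT.prems]
    using SeqT TY_Proj Equ_refl [OF TY_Len [OF SeqT.prems]] by (simp add: eqv_def [of Nt])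
qed

lemma eqv_eucl: "TY s \<sigma> \<Longrightarrow> TY t \<sigma> \<Longrightarrow> TY u \<sigma> \<Longrightarrow> eqv \<sigma> s t \<Longrightarrow> eqv \<sigma> s u \<Longrightarrow> eqv \<sigma> t u"
proof (induction \<sigma> arbitrary: s t u)
  case Nt
  then show ?case using Equ_eucl [of s t u] by (simp add: eqv_def)
next
  case (Fun \<sigma> \<tau>)
  show ?case
    unfolding eqv_Fun [OF Fun.prems(2,3)]
  proof (intro allI impI)
    fix a assume a: "TY a \<sigma>"
    have "eqv \<tau> (s \<cdot> a) (t \<cdot> a)" "eqv \<tau> (s \<cdot> a) (u \<cdot> a)"
      using Fun.prems a eqv_Fun by blast+
    then show "eqv \<tau> (t \<cdot> a) (u \<cdot> a)"
      using Fun.prems a by (blast intro: Fun.IH TY_App)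
  qed
next
  case (SeqT \<sigma>)
  let ?l = "\<lambda>t. Cst (LenC \<sigma>) \<cdot> t"
  have st: "eqv Nt (?l s) (?l t)" and su: "eqv Nt (?l s) (?l u)"
    using SeqT.prems by (auto simp: eqv_SeqT)
  have l: "TY (?l s) Nt" "TY (?l t) Nt" "TY (?l u) Nt" using SeqT.prems TY_Len by blast+
  have eu: "eqv Nt b c" if "TY a Nt" "TY b Nt" "TY c Nt" "eqv Nt a b" "eqv Nt a c" for a b c
    using that Equ_eucl [of a b c] by (simp add: eqv_def)
  have tu: "eqv Nt (?l t) (?l u)" using eu [OF l st su] .
  have ts: "eqv Nt (?l t) (?l s)"
    using eu [OF l(1,2,1) st] Equ_refl [OF l(1)] by (simp add: eqv_def)
  have "eqv \<sigma> (Cst (ProjC \<sigma>) \<cdot> t \<cdot> i) (Cst (ProjC \<sigma>) \<cdot> u \<cdot> i)"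
    if "TY i Nt" "Holds (Lt i (?l t))" for i
  proof -
    have "Holds (Lt i (?l s))" using Lt_cong that ts l by blast
    then show ?thesis
      using SeqT.prems that by (intro SeqT.IH [where s = "Cst (ProjC \<sigma>) \<cdot> s \<cdot> i" and t = "Cst (ProjC \<sigma>) \<cdot> t \<cdot> i" and u = "Cst (ProjC \<sigma>) \<cdot> u \<cdot> i"])
        (auto simp: eqv_SeqT TY_Proj)
  qed
  then show ?case using tu SeqT.prems by (simp add: eqv_SeqT)
qed

lemma eqv_sym: "TY s \<sigma> \<Longrightarrow> TY t \<sigma> \<Longrightarrow> eqv \<sigma> s t \<Longrightarrow> eqv \<sigma> t s"
  using eqv_eucl eqv_refl by blast

lemma eqv_trans: "TY s \<sigma> \<Longrightarrow> TY t \<sigma> \<Longrightarrow> TY u \<sigma> \<Longrightarrow> eqv \<sigma> s t \<Longrightarrow> eqv \<sigma> t u \<Longrightarrow> eqv \<sigma> s u"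
  using eqv_eucl eqv_sym by blast

lemma eqv_App:
  assumes "TY f (\<sigma> \<Rrightarrow> \<tau>)" "TY g (\<sigma> \<Rrightarrow> \<tau>)" "TY s \<sigma>" "TY t \<sigma>"
    and "eqv (\<sigma> \<Rrightarrow> \<tau>) f g" "eqv \<sigma> s t"
  shows "eqv \<tau> (f \<cdot> s) (g \<cdot> t)"
proof (rule eqv_trans [of _ _ "f \<cdot> t"])
  show "eqv \<tau> (f \<cdot> s) (f \<cdot> t)" using assms by (intro eqv_cong_arg)
  show "eqv \<tau> (f \<cdot> t) (g \<cdot> t)" using assms by (simp add: eqv_Fun)
qed (use assms TY_App in auto)

text \<open>A class of equal terms is represented by the least code of a member, which gives
  countermodels the fixed carrier \<open>nat\<close>. The type need not be an argument, as a term
  has at most one.\<close>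

definition nf :: "tm \<Rightarrow> nat" where
  "nf t = (LEAST n. \<exists>\<sigma>. TY t \<sigma> \<and> TY (from_nat n) \<sigma> \<and> eqv \<sigma> t (from_nat n))"

lemma nf_spec:
  assumes "TY t \<sigma>" shows "TY (from_nat (nf t)) \<sigma> \<and> eqv \<sigma> t (from_nat (nf t))"
proof -
  have "\<exists>\<sigma>. TY t \<sigma> \<and> TY (from_nat (nf t)) \<sigma> \<and> eqv \<sigma> t (from_nat (nf t))"
    unfolding nf_def
    by (rule LeastI_ex) (use assms eqv_refl in \<open>auto intro!: exI [of _ "to_nat t"]\<close>)
  then show ?thesis using TY_unique assms by blast
qed

lemma nf_eq:
  assumes "TY s \<sigma>" "TY t \<sigma>" shows "nf s = nf t \<longleftrightarrow> eqv \<sigma> s t"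
proof
  assume "nf s = nf t"
  then show "eqv \<sigma> s t"
    using nf_spec assms eqv_sym eqv_trans by metis
next
  assume *: "eqv \<sigma> s t"
  have "(\<exists>\<sigma>. TY s \<sigma> \<and> TY u \<sigma> \<and> eqv \<sigma> s u) \<longleftrightarrow> (\<exists>\<sigma>. TY t \<sigma> \<and> TY u \<sigma> \<and> eqv \<sigma> t u)" for u
    using assms * TY_unique eqv_sym eqv_trans by metis
  then show "nf s = nf t" by (simp add: nf_def)
qed

definition K :: "nat struct" where
  "K = \<lparr> dom = (\<lambda>\<sigma>. nf ` {t. TY t \<sigma>}), app = (\<lambda>x y. nf (from_nat x \<cdot> from_nat y)),
         cst = (\<lambda>c. nf (Cst c)), std = (\<lambda>\<sigma> x. Holds (St \<sigma> (from_nat x))) \<rparr>"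

lemma dom_K: "dom K \<sigma> = nf ` {t. TY t \<sigma>}" by (simp add: K_def)

lemma nf_App:
  assumes "TY f (\<sigma> \<Rrightarrow> \<tau>)" "TY t \<sigma>" shows "app K (nf f) (nf t) = nf (f \<cdot> t)"
proof -
  have "nf (from_nat (nf f) \<cdot> from_nat (nf t)) = nf (f \<cdot> t)"
    using assms nf_spec TY_App eqv_App eqv_sym by (subst nf_eq [of _ \<tau>]) (meson)+
  then show ?thesis by (simp add: K_def)
qed

lemma ev_K:
  assumes "list_all2 (\<lambda>\<sigma> t. TY t \<sigma>) \<Gamma> ts"
  shows "typ_of \<Gamma> t = Some \<sigma> \<Longrightarrow>
    TY (sub_tm ((!) ts) t) \<sigma> \<and> ev K (map nf ts) t = nf (sub_tm ((!) ts) t)"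
proof (induction t arbitrary: \<sigma>)
  case (Var n)
  then show ?case using assms by (auto simp: list_all2_conv_all_nth split: if_splits)
next
  case (Cst c)
  then show ?case using TY_Cst by (auto simp: K_def)
next
  case (App f t)
  then obtain \<tau> where "typ_of \<Gamma> f = Some (\<tau> \<Rrightarrow> \<sigma>)" "typ_of \<Gamma> t = Some \<tau>"
    unfolding typ_of_App by blast
  then show ?case using App.IH nf_App TY_App by (metis ev.simps(3) sub_tm.simps(3))
qed

text \<open>Makes \<open>std\<close> of the term model independent of the representative. If
  \<open>St\<close> occurs in the language at all, \<open>St_T\<close> supplies the axiom that
  standardness respects equality.\<close>

lemma Holds_St_cong:
  assumes "St \<sigma> (Var 0) \<in> L" "TY s \<sigma>" "TY t \<sigma>" "eqv \<sigma> s t" "Holds (St \<sigma> s)"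
  shows "Holds (St \<sigma> t)"
proof -
  have "T_st \<subseteq> T" using assms(1) St_T by auto
  then have "Imp (Con (St \<sigma> s) (EqT \<sigma> s t)) (St \<sigma> t) \<in> T" using T_st.st_eq by blast
  moreover have "WF (Imp (Con (St \<sigma> s) (EqT \<sigma> s t)) (St \<sigma> t))"
  proof -
    let ?\<phi> = "Imp (Con (St \<sigma> (Var 0)) (EqT \<sigma> (Var 0) (Var 1))) (St \<sigma> (Var 1))"
    have "St \<sigma> (Var 1) \<in> L"
      using assms(1) sub_L [of "\<lambda>_. Var 1" "St \<sigma> (Var 0)"] by simp
    then have "wff L [\<sigma>, \<sigma>] ?\<phi>"
      using assms(1) well_typed_EqT [of "[\<sigma>, \<sigma>]"] by (auto simp: wff_def internal_L)
    from WF_sub [OF this, of "[s, t]"] show ?thesis using assms by simp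
  qed
  ultimately have "Holds (Imp (Con (St \<sigma> s) (EqT \<sigma> s t)) (St \<sigma> t))" by (rule Holds_axiom)
  then show ?thesis using assms Holds_ImpD by (auto simp: eqv_def)
qed

text \<open>Every element of the term model is the code \<open>nf t\<close> of a typed term, so
  quantifiers over a domain become quantifiers over terms, which the witness property matches with
  \<open>Holds\<close>.\<close>

lemma truth:
  "wff L \<Gamma> \<phi> \<Longrightarrow> list_all2 (\<lambda>\<sigma> t. TY t \<sigma>) \<Gamma> ts \<Longrightarrow>
    sat K (map nf ts) \<phi> \<longleftrightarrow> Holds (sub_fm ((!) ts) \<phi>)"
proof (induction \<phi> arbitrary: \<Gamma> ts)
  case (Equ s t)
  then have *: "typ_of \<Gamma> s = Some Nt" "typ_of \<Gamma> t = Some Nt" by (auto simp: wff_def)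
  show ?case using ev_K [OF Equ(2) *(1)] ev_K [OF Equ(2) *(2)] nf_eq [of _ Nt]
    by (auto simp: eqv_def)
next
  case (St \<sigma> t)
  then have *: "typ_of \<Gamma> t = Some \<sigma>" by (auto simp: wff_def)
  let ?u = "sub_tm ((!) ts) t"
  have u: "TY ?u \<sigma>" "ev K (map nf ts) t = nf ?u" using ev_K [OF St(2) *] by auto
  have "St \<sigma> (Var 0) \<in> L"
    using St(1) sub_L [of "\<lambda>_. t" "St \<sigma> (Var 0)"] by (simp add: wff_def)
  then have "Holds (St \<sigma> (from_nat (nf ?u))) \<longleftrightarrow> Holds (St \<sigma> ?u)"
    using nf_spec [OF u(1)] u(1) Holds_St_cong eqv_sym by blast
  then show ?case using u(2) by (simp add: K_def)
next
  case (Imp \<phi> \<psi>)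
  then show ?case using WF_sub [OF Imp.prems] Imp.IH [of \<Gamma> ts] by simp
next
  case (Con \<phi> \<psi>)
  then show ?case using Con.IH [of \<Gamma> ts] by simp
next
  case (Dis \<phi> \<psi>)
  then show ?case using WF_sub [OF Dis.prems] Dis.IH [of \<Gamma> ts] by simp
next
  case (Forall \<sigma> \<phi>)
  have "sat K (map nf ts) (Forall \<sigma> \<phi>) \<longleftrightarrow> (\<forall>t. TY t \<sigma> \<longrightarrow> sat K (map nf (t # ts)) \<phi>)"
    by (auto simp: dom_K)
  also have "\<dots> \<longleftrightarrow> (\<forall>t. TY t \<sigma> \<longrightarrow> Holds (sub_fm ((!) (t # ts)) \<phi>))"
    using Forall.IH [of "\<sigma> # \<Gamma>"] Forall.prems by (metis list_all2_Cons wff_simps(5))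
  also have "\<dots> \<longleftrightarrow> Holds (sub_fm ((!) ts) (Forall \<sigma> \<phi>))"
    using WF_sub [OF Forall.prems] by (simp add: inst_sub_up nth_Cons [abs_def])
  finally show ?case .
next
  case (Exists \<sigma> \<phi>)
  have "sat K (map nf ts) (Exists \<sigma> \<phi>) \<longleftrightarrow> (\<exists>t. TY t \<sigma> \<and> sat K (map nf (t # ts)) \<phi>)"
    by (auto simp: dom_K)
  also have "\<dots> \<longleftrightarrow> (\<exists>t. TY t \<sigma> \<and> Holds (sub_fm ((!) (t # ts)) \<phi>))"
    using Exists.IH [of "\<sigma> # \<Gamma>"] Exists.prems by (metis list_all2_Cons wff_simps(6))
  also have "\<dots> \<longleftrightarrow> Holds (sub_fm ((!) ts) (Exists \<sigma> \<phi>))"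
    using WF_sub [OF Exists.prems] by (simp add: inst_sub_up nth_Cons [abs_def])
  finally show ?case .
qed auto

lemma env_K: "env K \<Gamma> e \<Longrightarrow> \<exists>ts. e = map nf ts \<and> list_all2 (\<lambda>\<sigma> t. TY t \<sigma>) \<Gamma> ts"
proof (induction \<Gamma> arbitrary: e)
  case (Cons \<sigma> \<Gamma>)
  then obtain x e' where "e = x # e'" "x \<in> dom K \<sigma>" "env K \<Gamma> e'"
    by (auto simp: env_def list_all2_Cons1)
  moreover from this obtain t where "x = nf t" "TY t \<sigma>" by (auto simp: dom_K)
  moreover from calculation obtain ts where "e' = map nf ts" "list_all2 (\<lambda>\<sigma> t. TY t \<sigma>) \<Gamma> ts"
    using Cons.IH by blast
  ultimately have "e = map nf (t # ts)" "list_all2 (\<lambda>\<sigma> t. TY t \<sigma>) (\<sigma> # \<Gamma>) (t # ts)"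
    by simp_all
  then show ?case by blast
qed simp

lemma model_K: "model K L T"
proof
  show "app K f x \<in> dom K \<tau>" if "f \<in> dom K (\<sigma> \<Rrightarrow> \<tau>)" "x \<in> dom K \<sigma>" for f x \<sigma> \<tau>
    using that nf_App TY_App by (fastforce simp: dom_K)
  show "cst K c \<in> dom K (cty c)" for c
    using TY_Cst by (auto simp: K_def)
  show "sat K e (EqT \<sigma> s t) \<longleftrightarrow> ev K e s = ev K e t"
    if e: "env K \<Gamma> e" and s: "typ_of \<Gamma> s = Some \<sigma>" and t: "typ_of \<Gamma> t = Some \<sigma>" for \<Gamma> e s t \<sigma>
  proof -
    obtain ts where ts: "e = map nf ts" "list_all2 (\<lambda>\<sigma> t. TY t \<sigma>) \<Gamma> ts" using env_K e by blast
    have "wff L \<Gamma> (EqT \<sigma> s t)" using s t by (simp add: wff_def internal_L well_typed_EqT)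
    then show ?thesis
      using truth [OF _ ts(2)] ev_K [OF ts(2) s] ev_K [OF ts(2) t] ts nf_eq [of _ \<sigma>]
      by (simp add: eqv_def)
  qed
  show "sat K e \<phi>" if "\<phi> \<in> T" "wff L \<Gamma> \<phi>" and e: "env K \<Gamma> e" for \<phi> \<Gamma> e
  proof -
    obtain ts where ts: "e = map nf ts" "list_all2 (\<lambda>\<sigma> t. TY t \<sigma>) \<Gamma> ts"
      using env_K e by blast
    have "Holds (sub_fm ((!) ts) \<phi>)"
      using T that WF_sub ts by (intro Holds_axiom) (auto simp: sub_closed_def)
    then show ?thesis using truth that ts by blast
  qed
qed

lemma not_sat_K: "\<not> sat K [] \<chi>"
proof
  assume "sat K [] \<chi>"
  moreover have "sub_fm ((!) []) \<chi> = sub_fm Var \<chi>"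
    using wff_\<chi> by (intro sub_fm_typed_cong [of "[]"]) (auto simp: wff_def)
  ultimately have "Holds \<chi>" using truth [OF wff_\<chi>, of "[]"] by simp
  moreover have "P 0 (Neg \<chi>)" using wff_\<chi> by (intro prv.Assm) auto
  then have "Holds (Neg \<chi>)" unfolding Holds_def by blast
  ultimately show False using Holds_ImpD Holds_Fls by blast
qed

end

theorem completeness:
  assumes "language L" "sub_closed T" "EPRA_ax \<subseteq> T" "L \<subseteq> Collect internal \<or> T_st \<subseteq> T"
    and "wff L [] \<chi>" and "\<And>M :: nat struct. model M L T \<Longrightarrow> sat M [] \<chi>"
  shows "prv L T [] [] \<chi>"
proof (rule ccontr)
  assume "\<not> prv L T [] [] \<chi>"
  then interpret henkin L T \<chi>
    using assms by (simp add: henkin_def henkin_axioms_def)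
  show False using model_K not_sat_K assms(6) by blast
qed

section \<open>Models of arithmetic\<close>

lemma ev_lift [simp]: "ev M (x # e) (lift t) = ev M e t"
  by (induction t) auto

lemma ev_sub:
  "typ_of \<Gamma> t = Some \<sigma> \<Longrightarrow> (\<And>n. n < length \<Gamma> \<Longrightarrow> ev M e (\<theta> n) = e' ! n) \<Longrightarrow>
    ev M e (sub_tm \<theta> t) = ev M e' t"
proof (induction t arbitrary: \<sigma>)
  case (App s t)
  then show ?case unfolding typ_of_App sub_tm.simps ev.simps by metis
qed (auto split: if_splits)

lemma sat_sub:
  "well_typed \<Gamma> \<phi> \<Longrightarrow> (\<And>n. n < length \<Gamma> \<Longrightarrow> ev M e (\<theta> n) = e' ! n) \<Longrightarrow>
    sat M e (sub_fm \<theta> \<phi>) \<longleftrightarrow> sat M e' \<phi>"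
proof (induction \<phi> arbitrary: \<Gamma> e e' \<theta>)
  case (Equ s t)
  then show ?case using ev_sub [of \<Gamma> s Nt M e \<theta> e'] ev_sub [of \<Gamma> t Nt M e \<theta> e'] by simp
next
  case (St \<sigma> t)
  then show ?case using ev_sub [of \<Gamma> t \<sigma> M e \<theta> e'] by simp
next
  case (Imp \<phi> \<psi>)
  then show ?case using Imp.IH [of \<Gamma> e \<theta> e'] by simp
next
  case (Con \<phi> \<psi>)
  then show ?case using Con.IH [of \<Gamma> e \<theta> e'] by simp
next
  case (Dis \<phi> \<psi>)
  then show ?case using Dis.IH [of \<Gamma> e \<theta> e'] by simp
next
  case (Forall \<sigma> \<phi>)
  have "ev M (x # e) (up \<theta> n) = (x # e') ! n" if "n < length (\<sigma> # \<Gamma>)" for n x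
    using that Forall.prems(2) by (cases n) auto
  then have "sat M (x # e) (sub_fm (up \<theta>) \<phi>) \<longleftrightarrow> sat M (x # e') \<phi>" for x
    by (intro Forall.IH [of "\<sigma> # \<Gamma>"]) (use Forall.prems(1) in auto)
  then show ?case by simp
next
  case (Exists \<sigma> \<phi>)
  have "ev M (x # e) (up \<theta> n) = (x # e') ! n" if "n < length (\<sigma> # \<Gamma>)" for n x
    using that Exists.prems(2) by (cases n) auto
  then have "sat M (x # e) (sub_fm (up \<theta>) \<phi>) \<longleftrightarrow> sat M (x # e') \<phi>" for x
    by (intro Exists.IH [of "\<sigma> # \<Gamma>"]) (use Exists.prems(1) in auto)
  then show ?case by simp
qed simp

lemma ev_closed: "typ_of [] t = Some \<sigma> \<Longrightarrow> ev M e t = ev M [] t"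
  using ev_sub [of "[]" t \<sigma> M e Var "[]"] by simp

lemma internal_EPRA_ax: "\<phi> \<in> EPRA_ax \<Longrightarrow> internal \<phi>"
proof -
  have *: "internal \<psi>" if "qf \<psi>" for \<psi> using that by (induction \<psi>) auto
  show "internal \<phi>" if "\<phi> \<in> EPRA_ax"
    using that by cases (auto simp: * inst_fm_def Lt_def Le_def)
qed

section \<open>Bracket abstraction in models\<close>

lemma const_fun_typ:
  assumes "typ_of (\<sigma> # \<Gamma>) t = Some \<tau>" "\<not> occurs0 t"
  shows "typ_of \<Gamma> (sub_tm (\<lambda>n. Var (n - 1)) t) = Some \<tau>"
  using assms
proof (induction t arbitrary: \<tau>)
  case (App s t)
  then show ?case unfolding sub_tm.simps typ_of_App by auto
qed (auto simp: nth_Cons' split: if_splits)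

lemma const_fun_ev:
  assumes "\<not> occurs0 t"
  shows "ev M e (sub_tm (\<lambda>n. Var (n - 1)) t) = ev M (x # e) t"
  using assms by (induction t) auto

lemma lam1_typ':
  "typ_of (\<sigma> # \<Gamma>) t = Some \<tau> \<Longrightarrow> typ_of \<Gamma> (lam1 \<sigma> \<Gamma> t) = Some (\<sigma> \<Rrightarrow> \<tau>)"
proof (induction t arbitrary: \<tau>)
  case (App s t)
  obtain \<rho> where \<rho>: "typ_of (\<sigma> # \<Gamma>) s = Some (\<rho> \<Rrightarrow> \<tau>)" "typ_of (\<sigma> # \<Gamma>) t = Some \<rho>"
    using App.prems unfolding typ_of_App by blast
  show ?case
  proof (cases "occurs0 (s \<cdot> t)")
    case True
    then show ?thesis using App.IH \<rho> by simp
  next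
    case False
    then show ?thesis using const_fun_typ [OF App.prems False] App.prems \<rho>
      by (simp add: const_fun_def)
  qed
qed (auto simp: const_fun_def nth_Cons' split: if_splits)

lemma lam1_typ [simp]:
  "typ_of (\<sigma> # \<Gamma>) t \<noteq> None \<Longrightarrow>
    typ_of \<Gamma> (lam1 \<sigma> \<Gamma> t) = Some (\<sigma> \<Rrightarrow> the (typ_of (\<sigma> # \<Gamma>) t))"
  using lam1_typ' by fastforce

lemma lam1_typ_closed [simp]:
  "typ_of [\<sigma>] t \<noteq> None \<Longrightarrow>
    typ_of (\<gamma> # \<Gamma>) (lam1 \<sigma> [] t) = Some (\<sigma> \<Rrightarrow> the (typ_of [\<sigma>] t))"
  using typ_of_append [of "[]" "lam1 \<sigma> [] t" _ "\<gamma> # \<Gamma>"] by simp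

lemma lam1_ev_closed [simp]:
  "typ_of [\<sigma>] t \<noteq> None \<Longrightarrow> ev M (x # e) (lam1 \<sigma> [] t) = ev M [] (lam1 \<sigma> [] t)"
  by (rule ev_closed) simp

declare lam1.simps [simp del]

lemma typ_closed: "typ_of [] t = Some \<sigma> \<Longrightarrow> typ_of \<Gamma> t = Some \<sigma>"
  using typ_of_append by fastforce

lemma typ_pred_c [simp]: "typ_of \<Gamma> pred_c = Some (Nt \<Rrightarrow> Nt)"
  by (rule typ_closed) (simp add: pred_c_def)

lemma typ_add_c [simp]: "typ_of \<Gamma> add_c = Some (Nt \<Rrightarrow> Nt \<Rrightarrow> Nt)"
  by (rule typ_closed) (simp add: add_c_def)

lemma typ_mul_c [simp]: "typ_of \<Gamma> mul_c = Some (Nt \<Rrightarrow> Nt \<Rrightarrow> Nt)"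
  by (rule typ_closed) (simp add: mul_c_def numeral_2_eq_2)

lemmas [simp] =
  ev_closed [OF typ_pred_c, of _ "x # e" for x e]
  ev_closed [OF typ_add_c, of _ "x # e" for x e]
  ev_closed [OF typ_of_monus, of _ "x # e" for x e]
  ev_closed [OF typ_mul_c, of _ "x # e" for x e]

locale arithmetic = model M L T + language L for M :: "'v struct" and L T +
  assumes EPRA_T: "EPRA_ax \<subseteq> T"
begin

abbreviation ap :: "'v \<Rightarrow> 'v \<Rightarrow> 'v" (infixl "\<star>" 100) where "x \<star> y \<equiv> app M x y"
abbreviation D :: "ty \<Rightarrow> 'v set" where "D \<equiv> dom M"
abbreviation N :: "'v set" where "N \<equiv> dom M Nt"
abbreviation zer :: 'v where "zer \<equiv> cst M ZeroC"
abbreviation Su :: "'v \<Rightarrow> 'v" where "Su x \<equiv> cst M SuccC \<star> x"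
abbreviation Rec :: "'v \<Rightarrow> 'v \<Rightarrow> 'v \<Rightarrow> 'v" where "Rec n y z \<equiv> cst M RecC \<star> n \<star> y \<star> z"

lemma ax: "\<phi> \<in> EPRA_ax \<Longrightarrow> well_typed \<Gamma> \<phi> \<Longrightarrow> env M \<Gamma> e \<Longrightarrow> sat M e \<phi>"
  using EPRA_T internal_EPRA_ax internal_L axiom [of \<phi> \<Gamma>] by (auto simp: wff_def)

lemma ev_dom: "env M \<Gamma> e \<Longrightarrow> typ_of \<Gamma> t = Some \<sigma> \<Longrightarrow> ev M e t \<in> D \<sigma>"
proof (induction t arbitrary: \<sigma>)
  case (App s t)
  then show ?case unfolding typ_of_App ev.simps using app_dom by blast
qed (auto simp: env_def list_all2_conv_all_nth cst_dom split: if_splits)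

lemma Pi_app [simp]: "x \<in> D \<rho> \<Longrightarrow> y \<in> D \<tau> \<Longrightarrow> cst M (PiC \<rho> \<tau>) \<star> x \<star> y = x"
  using ax [OF EPRA_ax.Pi_eq [of \<rho> \<tau> "Var 0" "Var 1"], of "[\<rho>, \<tau>]" "[x, y]"]
    sat_EqT [of "[\<rho>, \<tau>]" "[x, y]" "Cst (PiC \<rho> \<tau>) \<cdot> Var 0 \<cdot> Var 1" \<rho> "Var 0"]
  by (simp add: well_typed_EqT)

lemma Sigma_app [simp]:
  "x \<in> D (\<delta> \<Rrightarrow> \<rho> \<Rrightarrow> \<tau>) \<Longrightarrow> y \<in> D (\<delta> \<Rrightarrow> \<rho>) \<Longrightarrow> z \<in> D \<delta> \<Longrightarrow>
    cst M (SigmaC \<delta> \<rho> \<tau>) \<star> x \<star> y \<star> z = x \<star> z \<star> (y \<star> z)"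
  using ax [OF EPRA_ax.Sigma_eq [of \<tau> \<delta> \<rho> "Var 0" "Var 1" "Var 2"],
        of "[\<delta> \<Rrightarrow> \<rho> \<Rrightarrow> \<tau>, \<delta> \<Rrightarrow> \<rho>, \<delta>]" "[x, y, z]"]
    sat_EqT [of "[\<delta> \<Rrightarrow> \<rho> \<Rrightarrow> \<tau>, \<delta> \<Rrightarrow> \<rho>, \<delta>]" "[x, y, z]"
      "Cst (SigmaC \<delta> \<rho> \<tau>) \<cdot> Var 0 \<cdot> Var 1 \<cdot> Var 2" \<tau> "Var 0 \<cdot> Var 2 \<cdot> (Var 1 \<cdot> Var 2)"]
  by (simp add: well_typed_EqT numeral_2_eq_2)

abbreviation "step_ty \<equiv> Nt \<Rrightarrow> Nt \<Rrightarrow> Nt"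

lemma zer_N [simp]: "zer \<in> N" using cst_dom [of ZeroC] by simp
lemma Su_N [simp]: "x \<in> N \<Longrightarrow> Su x \<in> N" using cst_dom [of SuccC] app_dom by auto
lemma Rec_N [simp]: "n \<in> N \<Longrightarrow> y \<in> N \<Longrightarrow> z \<in> D step_ty \<Longrightarrow> Rec n y z \<in> N"
  using cst_dom [of RecC] app_dom by (metis cty.simps(5))

lemma Rec_zer [simp]: "y \<in> N \<Longrightarrow> z \<in> D step_ty \<Longrightarrow> Rec zer y z = y"
  using ax [OF EPRA_ax.Rec_zero [of "Var 0" "Var 1"], of "[Nt, step_ty]" "[y, z]"] by simp

lemma Rec_Su [simp]:
  "n \<in> N \<Longrightarrow> y \<in> N \<Longrightarrow> z \<in> D step_ty \<Longrightarrow> Rec (Su n) y z = z \<star> Rec n y z \<star> n"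
  using ax [OF EPRA_ax.Rec_succ [of "Var 0" "Var 1" "Var 2"], of "[Nt, Nt, step_ty]" "[n, y, z]"]
  by (simp add: numeral_2_eq_2)

lemma Su_zer [simp]: "x \<in> N \<Longrightarrow> Su x \<noteq> zer" "x \<in> N \<Longrightarrow> zer \<noteq> Su x"
  using ax [OF EPRA_ax.succ_nonzero [of "Var 0"], of "[Nt]" "[x]"] by auto

text \<open>Beta conversion. Together with the typing rule it replaces the combinators: later closed
  terms are computed with it, at arguments from the right domains.\<close>

lemma lam1_app':
  "typ_of (\<sigma> # \<Gamma>) t = Some \<tau> \<Longrightarrow> env M \<Gamma> e \<Longrightarrow> x \<in> D \<sigma> \<Longrightarrow>
    ev M e (lam1 \<sigma> \<Gamma> t) \<star> x = ev M (x # e) t"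
proof (induction t arbitrary: \<tau>)
  case (Var n)
  show ?case
  proof (cases n)
    case 0
    then show ?thesis
      using Var app_dom [OF cst_dom [of "PiC \<sigma> \<sigma>", simplified]]
        cst_dom [of "PiC \<sigma> (\<sigma> \<Rrightarrow> \<sigma>)"] cst_dom [of "PiC \<sigma> \<sigma>"]
      by (simp add: lam1.simps)
  next
    case (Suc m)
    then show ?thesis
      using Var ev_dom [of \<Gamma> e "Var m" \<tau>] by (simp add: lam1.simps const_fun_def split: if_splits)
  qed
next
  case (Cst c)
  then show ?case using cst_dom [of c] by (simp add: lam1.simps const_fun_def)
next
  case (App s t)
  obtain \<rho> where \<rho>: "typ_of (\<sigma> # \<Gamma>) s = Some (\<rho> \<Rrightarrow> \<tau>)" "typ_of (\<sigma> # \<Gamma>) t = Some \<rho>"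
    using App.prems unfolding typ_of_App by blast
  show ?case
  proof (cases "occurs0 (s \<cdot> t)")
    case True
    moreover have "ev M e (lam1 \<sigma> \<Gamma> s) \<in> D (\<sigma> \<Rrightarrow> \<rho> \<Rrightarrow> \<tau>)" "ev M e (lam1 \<sigma> \<Gamma> t) \<in> D (\<sigma> \<Rrightarrow> \<rho>)"
      using ev_dom [OF App.prems(2)] lam1_typ' \<rho> by blast+
    ultimately show ?thesis using App.IH \<rho> App.prems by (simp add: lam1.simps)
  next
    case False
    have *: "typ_of \<Gamma> (sub_tm (\<lambda>n. Var (n - 1)) (s \<cdot> t)) = Some \<tau>"
      using const_fun_typ [OF App.prems(1) False] .
    have "ev M e (sub_tm (\<lambda>n. Var (n - 1)) (s \<cdot> t)) = ev M (x # e) (s \<cdot> t)"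
      using const_fun_ev [OF False] .
    then show ?thesis
      using False ev_dom [OF App.prems(2) *] App.prems \<rho> by (simp add: lam1.simps const_fun_def)
  qed
qed

lemma lam1_app [simp]:
  "typ_of (\<sigma> # \<Gamma>) t \<noteq> None \<Longrightarrow> env M \<Gamma> e \<Longrightarrow> x \<in> D \<sigma> \<Longrightarrow>
    ev M e (lam1 \<sigma> \<Gamma> t) \<star> x = ev M (x # e) t"
  using lam1_app' by fastforce

lemma lam1_dom [simp]:
  "typ_of (\<sigma> # \<Gamma>) t = Some \<tau> \<Longrightarrow> env M \<Gamma> e \<Longrightarrow> ev M e (lam1 \<sigma> \<Gamma> t) \<in> D (\<sigma> \<Rrightarrow> \<tau>)"
  using ev_dom lam1_typ' by blast

text \<open>Induction reaches only predicates that a quantifier-free formula defines. Each use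
  therefore exhibits such a \<open>\<phi>\<close> with its parameters \<open>e\<close>, while
  \<open>P\<close> states the property in terms of the operations of the model.\<close>

lemma N_induct:
  assumes "qf \<phi>" "well_typed (Nt # \<Gamma>) \<phi>" "env M \<Gamma> e"
    and P: "\<And>n. n \<in> N \<Longrightarrow> P n \<longleftrightarrow> sat M (n # e) \<phi>"
    and "P zer" "\<And>n. n \<in> N \<Longrightarrow> P n \<Longrightarrow> P (Su n)" and n: "n \<in> N"
  shows "P n"
proof -
  let ?s = "\<lambda>n. case n of 0 \<Rightarrow> Sc (Var 0) | Suc m \<Rightarrow> Var (Suc m)"
  have "well_typed \<Gamma> (inst_fm Z \<phi>)" by (rule well_typed_inst [OF assms(2)]) simp
  moreover have "well_typed (Nt # \<Gamma>) (sub_fm ?s \<phi>)"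
    by (rule well_typed_sub [OF assms(2)]) (auto split: nat.split)
  ultimately have "sat M e (Imp (inst_fm Z \<phi>) (Imp (Forall Nt (Imp \<phi> (sub_fm ?s \<phi>))) (Forall Nt \<phi>)))"
    using assms(1-3) by (intro ax [OF EPRA_ax.qf_induction]) auto
  moreover have "sat M e (inst_fm Z \<phi>) \<longleftrightarrow> sat M (zer # e) \<phi>"
    unfolding inst_fm_def by (rule sat_sub [OF assms(2)]) (auto split: nat.split)
  moreover have "sat M (n # e) (sub_fm ?s \<phi>) \<longleftrightarrow> sat M (Su n # e) \<phi>" for n
    by (rule sat_sub [OF assms(2)]) (auto split: nat.split)
  ultimately show ?thesis using assms by simp
qed

section \<open>Arithmetic of the numbers of a model\<close>

definition pr :: "'v \<Rightarrow> 'v" where "pr x = ev M [] pred_c \<star> x"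
definition pl :: "'v \<Rightarrow> 'v \<Rightarrow> 'v" where "pl x y = ev M [] add_c \<star> x \<star> y"
definition mn :: "'v \<Rightarrow> 'v \<Rightarrow> 'v" where "mn x y = ev M [] monus_c \<star> x \<star> y"
definition ml :: "'v \<Rightarrow> 'v \<Rightarrow> 'v" where "ml x y = ev M [] mul_c \<star> x \<star> y"

lemma folds [simp]:
  "ev M [] pred_c \<star> x = pr x" "ev M [] add_c \<star> x \<star> y = pl x y"
  "ev M [] monus_c \<star> x \<star> y = mn x y" "ev M [] mul_c \<star> x \<star> y = ml x y"
  by (simp_all add: pr_def pl_def mn_def ml_def)

lemma pr_N [simp]: "x \<in> N \<Longrightarrow> pr x \<in> N"
  using ev_dom [of "[Nt]" "[x]" "pred_c \<cdot> Var 0" Nt] by simp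
lemma pl_N [simp]: "x \<in> N \<Longrightarrow> y \<in> N \<Longrightarrow> pl x y \<in> N"
  using ev_dom [of "[Nt, Nt]" "[x, y]" "Var 0 \<oplus> Var 1" Nt] by simp
lemma mn_N [simp]: "x \<in> N \<Longrightarrow> y \<in> N \<Longrightarrow> mn x y \<in> N"
  using ev_dom [of "[Nt, Nt]" "[x, y]" "Var 0 \<ominus> Var 1" Nt] by simp
lemma ml_N [simp]: "x \<in> N \<Longrightarrow> y \<in> N \<Longrightarrow> ml x y \<in> N"
  using ev_dom [of "[Nt, Nt]" "[x, y]" "Var 0 \<odot> Var 1" Nt] by simp

lemma pr_rec [simp]: "pr zer = zer" "x \<in> N \<Longrightarrow> pr (Su x) = x"
  by (simp_all add: pr_def pred_c_def)

lemma pl_zer [simp]: "x \<in> N \<Longrightarrow> pl x zer = x"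
  and pl_Su [simp]: "x \<in> N \<Longrightarrow> y \<in> N \<Longrightarrow> pl x (Su y) = Su (pl x y)"
  by (simp_all add: pl_def add_c_def)

lemma mn_zer [simp]: "x \<in> N \<Longrightarrow> mn x zer = x"
  and mn_Su: "x \<in> N \<Longrightarrow> y \<in> N \<Longrightarrow> mn x (Su y) = pr (mn x y)"
  by (simp_all add: mn_def monus_c_def)

lemma ml_zer [simp]: "x \<in> N \<Longrightarrow> ml x zer = zer"
  and ml_Su [simp]: "x \<in> N \<Longrightarrow> y \<in> N \<Longrightarrow> ml x (Su y) = pl (ml x y) x"
  by (simp_all add: ml_def mul_c_def numeral_2_eq_2)

lemma pl_zer_left [simp]: "x \<in> N \<Longrightarrow> pl zer x = x"
  by (rule N_induct [where P = "\<lambda>x. pl zer x = x" and \<phi> = "Equ (Z \<oplus> Var 0) (Var 0)" and e = "[]" and \<Gamma> = "[]"])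
    simp_all

lemma pl_Su_left [simp]: "x \<in> N \<Longrightarrow> y \<in> N \<Longrightarrow> pl (Su x) y = Su (pl x y)"
  by (rule N_induct [where P = "\<lambda>y. pl (Su x) y = Su (pl x y)"
        and \<phi> = "Equ (Sc (Var 1) \<oplus> Var 0) (Sc (Var 1 \<oplus> Var 0))" and e = "[x]" and \<Gamma> = "[Nt]"])
    simp_all

lemma pl_comm: "x \<in> N \<Longrightarrow> y \<in> N \<Longrightarrow> pl x y = pl y x"
  by (rule N_induct [where P = "\<lambda>y. pl x y = pl y x"
        and \<phi> = "Equ (Var 1 \<oplus> Var 0) (Var 0 \<oplus> Var 1)" and e = "[x]" and \<Gamma> = "[Nt]"])
    simp_all

lemma pl_assoc: "x \<in> N \<Longrightarrow> y \<in> N \<Longrightarrow> z \<in> N \<Longrightarrow> pl (pl x y) z = pl x (pl y z)"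
  by (rule N_induct [where P = "\<lambda>z. pl (pl x y) z = pl x (pl y z)"
        and \<phi> = "Equ (Var 1 \<oplus> Var 2 \<oplus> Var 0) (Var 1 \<oplus> (Var 2 \<oplus> Var 0))"
        and e = "[x, y]" and \<Gamma> = "[Nt, Nt]"])
    simp_all

lemma pl_left_comm: "x \<in> N \<Longrightarrow> y \<in> N \<Longrightarrow> z \<in> N \<Longrightarrow> pl x (pl y z) = pl y (pl x z)"
  by (metis pl_assoc pl_comm)

lemmas pl_ac = pl_assoc pl_comm pl_left_comm

lemma ml_zer_left [simp]: "x \<in> N \<Longrightarrow> ml zer x = zer"
  by (rule N_induct [where P = "\<lambda>x. ml zer x = zer" and \<phi> = "Equ (Z \<odot> Var 0) Z" and e = "[]" and \<Gamma> = "[]"])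
    simp_all

lemma ml_Su_left: "x \<in> N \<Longrightarrow> y \<in> N \<Longrightarrow> ml (Su x) y = pl (ml x y) y"
  by (rule N_induct [where P = "\<lambda>y. ml (Su x) y = pl (ml x y) y"
        and \<phi> = "Equ (Sc (Var 1) \<odot> Var 0) (Var 1 \<odot> Var 0 \<oplus> Var 0)" and e = "[x]" and \<Gamma> = "[Nt]"])
    (simp_all add: pl_ac)

lemma ml_comm: "x \<in> N \<Longrightarrow> y \<in> N \<Longrightarrow> ml x y = ml y x"
  by (rule N_induct [where P = "\<lambda>y. ml x y = ml y x"
        and \<phi> = "Equ (Var 1 \<odot> Var 0) (Var 0 \<odot> Var 1)" and e = "[x]" and \<Gamma> = "[Nt]"])
    (simp_all add: ml_Su_left)

lemma ml_pl: "x \<in> N \<Longrightarrow> y \<in> N \<Longrightarrow> z \<in> N \<Longrightarrow> ml x (pl y z) = pl (ml x y) (ml x z)"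
  by (rule N_induct [where P = "\<lambda>z. ml x (pl y z) = pl (ml x y) (ml x z)"
        and \<phi> = "Equ (Var 1 \<odot> (Var 2 \<oplus> Var 0)) (Var 1 \<odot> Var 2 \<oplus> Var 1 \<odot> Var 0)"
        and e = "[x, y]" and \<Gamma> = "[Nt, Nt]"])
    (simp_all add: pl_assoc)

lemma ml_assoc: "x \<in> N \<Longrightarrow> y \<in> N \<Longrightarrow> z \<in> N \<Longrightarrow> ml (ml x y) z = ml x (ml y z)"
  by (rule N_induct [where P = "\<lambda>z. ml (ml x y) z = ml x (ml y z)"
        and \<phi> = "Equ (Var 1 \<odot> Var 2 \<odot> Var 0) (Var 1 \<odot> (Var 2 \<odot> Var 0))"
        and e = "[x, y]" and \<Gamma> = "[Nt, Nt]"])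
    (simp_all add: ml_pl)

lemma N_cases: "x \<in> N \<Longrightarrow> x = zer \<or> x = Su (pr x)"
  by (rule N_induct [where P = "\<lambda>x. x = zer \<or> x = Su (pr x)"
        and \<phi> = "Dis (Equ (Var 0) Z) (Equ (Var 0) (Sc (pred_c \<cdot> Var 0)))" and e = "[]" and \<Gamma> = "[]"])
    simp_all

lemma mn_Su_Su [simp]: "x \<in> N \<Longrightarrow> y \<in> N \<Longrightarrow> mn (Su x) (Su y) = mn x y"
  by (rule N_induct [where P = "\<lambda>y. mn (Su x) (Su y) = mn x y"
        and \<phi> = "Equ (Sc (Var 1) \<ominus> Sc (Var 0)) (Var 1 \<ominus> Var 0)" and e = "[x]" and \<Gamma> = "[Nt]"])
    (simp_all add: mn_Su [of "Su x"], simp_all add: mn_Su)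

lemma mn_pl [simp]: "x \<in> N \<Longrightarrow> y \<in> N \<Longrightarrow> mn (pl y x) x = y"
  by (rule N_induct [where P = "\<lambda>x. mn (pl y x) x = y"
        and \<phi> = "Equ ((Var 1 \<oplus> Var 0) \<ominus> Var 0) (Var 1)" and e = "[y]" and \<Gamma> = "[Nt]"])
    simp_all

lemma mn_zer_left [simp]: "x \<in> N \<Longrightarrow> mn zer x = zer"
  by (rule N_induct [where P = "\<lambda>x. mn zer x = zer" and \<phi> = "Equ (Z \<ominus> Var 0) Z" and e = "[]" and \<Gamma> = "[]"])
    (simp_all add: mn_Su)

lemma mn_pl_zer [simp]: "x \<in> N \<Longrightarrow> y \<in> N \<Longrightarrow> mn x (pl y x) = zer"
  by (rule N_induct [where P = "\<lambda>x. mn x (pl y x) = zer"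
        and \<phi> = "Equ (Var 0 \<ominus> (Var 1 \<oplus> Var 0)) Z" and e = "[y]" and \<Gamma> = "[Nt]"])
    simp_all

lemma pl_cancel: "x \<in> N \<Longrightarrow> y \<in> N \<Longrightarrow> z \<in> N \<Longrightarrow> pl x z = pl y z \<longleftrightarrow> x = y"
  by (metis mn_pl)

text \<open>Totality with the difference named by cut-off subtraction: with an existential
  difference the induction formula would not be quantifier-free.\<close>

lemma mn_total: "x \<in> N \<Longrightarrow> y \<in> N \<Longrightarrow> pl x (mn y x) = y \<or> pl y (mn x y) = x"
proof (rule N_induct [where P = "\<lambda>y. pl x (mn y x) = y \<or> pl y (mn x y) = x"
        and \<phi> = "Dis (Equ (Var 1 \<oplus> (Var 0 \<ominus> Var 1)) (Var 0)) (Equ (Var 0 \<oplus> (Var 1 \<ominus> Var 0)) (Var 1))"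
        and e = "[x]" and \<Gamma> = "[Nt]"])
  fix y assume x: "x \<in> N" and y: "y \<in> N" and *: "pl x (mn y x) = y \<or> pl y (mn x y) = x"
  have le: "pl x (mn (Su y) x) = Su y" if "pl x w = y" "w \<in> N" for w
  proof -
    have "Su y = pl (Su w) x" using that x pl_comm by auto
    then show ?thesis using that x pl_comm by (metis Su_N mn_pl)
  qed
  show "pl x (mn (Su y) x) = Su y \<or> pl (Su y) (mn x (Su y)) = x"
  proof (cases "pl x (mn y x) = y")
    case True
    then show ?thesis using le x y by simp
  next
    case False
    with * have d: "pl y (mn x y) = x" by simp
    from N_cases [of "mn x y"] x y consider "mn x y = zer" | "mn x y = Su (pr (mn x y))" by auto
    then show ?thesis
    proof cases
      case 1
      \<comment> \<open>The turning point \<open>y = x\<close>: the successor of \<open>y\<close>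
        leaves the second alternative for the first.\<close>
      then have "pl x zer = y" using d x y by simp
      then show ?thesis using le by simp
    next
      case 2
      then show ?thesis using d x y by (metis mn_N mn_Su pl_Su pl_Su_left pr_N)
    qed
  qed
qed simp_all

lemma N_total: "x \<in> N \<Longrightarrow> y \<in> N \<Longrightarrow> \<exists>z\<in>N. y = pl x z \<or> x = pl y z"
  by (metis mn_total mn_N)

lemma mn_eq_zer: "x \<in> N \<Longrightarrow> y \<in> N \<Longrightarrow> mn x y = zer \<longleftrightarrow> (\<exists>z\<in>N. y = pl x z)"
  by (metis mn_N mn_pl_zer mn_total pl_comm pl_zer)

lemma pl_eq_zer: "x \<in> N \<Longrightarrow> y \<in> N \<Longrightarrow> pl x y = zer \<Longrightarrow> x = zer"
  by (metis N_cases Su_zer(1) pl_N pl_Su_left pl_zer_left pr_N)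

lemma ml_eq_zer: "x \<in> N \<Longrightarrow> y \<in> N \<Longrightarrow> ml x y = zer \<Longrightarrow> x = zer \<or> y = zer"
  by (metis N_cases Su_zer(1) ml_N ml_Su pl_N pl_Su pr_N)

end

section \<open>The witnessing terms\<close>

text \<open>Case distinction by recursion: the step function is constant with value
  \<open>b\<close>, so every nonzero \<open>z\<close> yields \<open>b\<close>.\<close>

definition cond :: "tm \<Rightarrow> tm \<Rightarrow> tm \<Rightarrow> tm" where
  "cond z a b = Rc z a (Cst (PiC (Nt \<Rrightarrow> Nt) Nt) \<cdot> (Cst (PiC Nt Nt) \<cdot> b))"

text \<open>\<open>search_c f n\<close> is the least zero of \<open>f\<close> below \<open>n\<close>, or \<open>n\<close> if there is none.\<close>

definition search_c :: tm where
  "search_c = lam [Nt, ty1]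
    (Rc (Var 0) Z (lam [Nt, Nt, ty1] (cond (Var 2 \<cdot> Var 1) (Var 1) (Sc (Var 0))) \<cdot> Var 1))"

text \<open>The \<open>n\<close>-th real of the sequence \<open>jump_c f\<close> is 1 if \<open>f\<close> has a zero up to \<open>n\<close>, and 0 otherwise.\<close>

definition jump_c :: tm where
  "jump_c = lam [Nt, Nt, ty1] (mkq (Sc Z \<ominus> Var 2 \<cdot> (search_c \<cdot> Var 2 \<cdot> Var 1)) Z (Sc Z))"

definition zero_of_rate_c :: tm where
  "zero_of_rate_c = lam [ty1, ty_rate]
    (search_c \<cdot> Var 0 \<cdot> (Var 1 \<cdot> (jump_c \<cdot> Var 0) \<cdot> Sc (Sc Z)))"

text \<open>The grid point \<open>v j = c 0 m + j / 2 ^ m\<close>, where \<open>c 0 m\<close> is the \<open>m\<close>-th approximation of \<open>c 0\<close>.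
  \<open>above_c c m j n\<close> is zero iff \<open>v j \<le> c n m\<close>, and \<open>level_c \<mu> c m i\<close> is the largest \<open>j \<le> i\<close> that
  is attained in this sense for some \<open>n\<close>, as decided by the search functional \<open>\<mu>\<close>.  No grid point from
  \<open>bound_c c m\<close> on is attained.\<close>

definition grid_c :: tm where
  "grid_c = lam [Nt, Nt, ty_seq] (qadd (Var 2 \<cdot> Z \<cdot> Var 1) (mkq (Var 0) Z (pow2_c \<cdot> Var 1)))"

definition above_c :: tm where
  "above_c = lam [Nt, Nt, Nt, ty_seq]
    (let v = grid_c \<cdot> Var 3 \<cdot> Var 2 \<cdot> Var 1; q = Var 3 \<cdot> Var 0 \<cdot> Var 2 in
     (qpos v \<odot> qden q \<oplus> qneg q \<odot> qden v) \<ominus> (qpos q \<odot> qden v \<oplus> qneg v \<odot> qden q))"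

definition level_c :: tm where
  "level_c = lam [Nt, Nt, ty_seq, ty2]
    (Rc (Var 0) Z
      (lam [Nt, Nt, Nt, ty_seq, ty2]
        (let g = above_c \<cdot> Var 3 \<cdot> Var 2 \<cdot> Sc (Var 1) in cond (g \<cdot> (Var 4 \<cdot> g)) (Sc (Var 1)) (Var 1))
       \<cdot> Var 3 \<cdot> Var 2 \<cdot> Var 1))"

definition bound_c :: tm where
  "bound_c = lam [Nt, ty_seq] (pow2_c \<cdot> Var 0 \<odot> (qneg (Var 1 \<cdot> Z \<cdot> Var 0) \<oplus> Sc (Sc (Sc (Sc Z)))))"

definition index_c :: tm where
  "index_c = lam [Nt, ty_seq, ty2]
    (Var 2 \<cdot> (above_c \<cdot> Var 1 \<cdot> Var 0 \<cdot> (level_c \<cdot> Var 2 \<cdot> Var 1 \<cdot> Var 0 \<cdot> (bound_c \<cdot> Var 1 \<cdot> Var 0))))"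

definition rate_c :: tm where
  "rate_c = lam [Nt, ty_seq, ty2] (index_c \<cdot> Var 2 \<cdot> Var 1 \<cdot> Sc (Sc (Sc (Var 0))))"

text \<open>The search functional obtained from a functional \<open>F\<close> producing finitely many candidates.\<close>

definition search_seq_c :: tm where
  "search_seq_c = lam [ty1, ty1 \<Rrightarrow> SeqT Nt]
    (let s = Var 1 \<cdot> Var 0 in
     Cst (ProjC Nt) \<cdot> s \<cdot>
       (search_c \<cdot> (lam [Nt, ty1, SeqT Nt] (Var 1 \<cdot> (Cst (ProjC Nt) \<cdot> Var 2 \<cdot> Var 0)) \<cdot> s \<cdot> Var 0)
         \<cdot> (Cst (LenC Nt) \<cdot> s)))"

section \<open>Types of the witnessing terms\<close>

lemma typ_pow2_c [simp]: "typ_of \<Gamma> pow2_c = Some (Nt \<Rrightarrow> Nt)"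
  by (rule typ_closed) (simp add: pow2_c_def)
lemma typ_tri_c [simp]: "typ_of \<Gamma> tri_c = Some (Nt \<Rrightarrow> Nt)"
  by (rule typ_closed) (simp add: tri_c_def)
lemma typ_root_c [simp]: "typ_of \<Gamma> root_c = Some (Nt \<Rrightarrow> Nt)"
  by (rule typ_closed) (simp add: root_c_def)
lemma typ_pair_c [simp]: "typ_of \<Gamma> pair_c = Some (Nt \<Rrightarrow> Nt \<Rrightarrow> Nt)"
  by (rule typ_closed) (simp add: pair_c_def)
lemma typ_fst_c [simp]: "typ_of \<Gamma> fst_c = Some (Nt \<Rrightarrow> Nt)"
  by (rule typ_closed) (simp add: fst_c_def)
lemma typ_snd_c [simp]: "typ_of \<Gamma> snd_c = Some (Nt \<Rrightarrow> Nt)"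
  by (rule typ_closed) (simp add: snd_c_def)

lemmas q_defs = qpos_def qneg_def qden_def mkq_def qinv_def q2_def

lemma typ_mkq [simp]:
  "typ_of \<Gamma> a = Some Nt \<Longrightarrow> typ_of \<Gamma> b = Some Nt \<Longrightarrow> typ_of \<Gamma> d = Some Nt \<Longrightarrow>
    typ_of \<Gamma> (mkq a b d) = Some Nt"
  by (simp add: mkq_def)

lemma qf_qle [simp]: "qf (qle p q)"
  by (simp add: qle_def Le_def)

lemma well_typed_qle [simp]:
  "typ_of \<Gamma> p = Some Nt \<Longrightarrow> typ_of \<Gamma> q = Some Nt \<Longrightarrow> well_typed \<Gamma> (qle p q)"
  by (simp add: qle_def Le_def q_defs)

lemma typ_qadd_c [simp]: "typ_of \<Gamma> qadd_c = Some (Nt \<Rrightarrow> Nt \<Rrightarrow> Nt)"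
  by (rule typ_closed) (simp add: qadd_c_def q_defs Let_def)
lemma typ_qsub_c [simp]: "typ_of \<Gamma> qsub_c = Some (Nt \<Rrightarrow> Nt \<Rrightarrow> Nt)"
  by (rule typ_closed) (simp add: qsub_c_def q_defs Let_def)
lemma typ_qabs_c [simp]: "typ_of \<Gamma> qabs_c = Some (Nt \<Rrightarrow> Nt)"
  by (rule typ_closed) (simp add: qabs_c_def q_defs Let_def)
lemma typ_absdiff_c [simp]: "typ_of \<Gamma> absdiff_c = Some (ty1 \<Rrightarrow> ty1 \<Rrightarrow> ty1)"
  by (rule typ_closed) (simp add: absdiff_c_def q_defs numeral_2_eq_2)

lemma typ_cond [simp]:
  "typ_of \<Gamma> z = Some Nt \<Longrightarrow> typ_of \<Gamma> a = Some Nt \<Longrightarrow> typ_of \<Gamma> b = Some Nt \<Longrightarrow>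
    typ_of \<Gamma> (cond z a b) = Some Nt"
  by (simp add: cond_def)

lemma typ_search_c [simp]: "typ_of \<Gamma> search_c = Some (ty1 \<Rrightarrow> ty1)"
  by (rule typ_closed) (simp add: search_c_def numeral_2_eq_2)
lemma typ_jump_c [simp]: "typ_of \<Gamma> jump_c = Some (ty1 \<Rrightarrow> ty_seq)"
  by (rule typ_closed) (simp add: jump_c_def q_defs numeral_2_eq_2)
lemma typ_zero_of_rate_c [simp]: "typ_of \<Gamma> zero_of_rate_c = Some (ty_rate \<Rrightarrow> ty2)"
  by (rule typ_closed) (simp add: zero_of_rate_c_def)
lemma typ_grid_c [simp]: "typ_of \<Gamma> grid_c = Some (ty_seq \<Rrightarrow> Nt \<Rrightarrow> Nt \<Rrightarrow> Nt)"
  by (rule typ_closed) (simp add: grid_c_def q_defs numeral_2_eq_2)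
lemma typ_above_c [simp]: "typ_of \<Gamma> above_c = Some (ty_seq \<Rrightarrow> Nt \<Rrightarrow> Nt \<Rrightarrow> ty1)"
  by (rule typ_closed) (simp add: above_c_def q_defs Let_def eval_nat_numeral)
lemma typ_level_c [simp]: "typ_of \<Gamma> level_c = Some (ty2 \<Rrightarrow> ty_seq \<Rrightarrow> Nt \<Rrightarrow> Nt \<Rrightarrow> Nt)"
  by (rule typ_closed) (simp add: level_c_def q_defs Let_def eval_nat_numeral)
lemma typ_bound_c [simp]: "typ_of \<Gamma> bound_c = Some (ty_seq \<Rrightarrow> Nt \<Rrightarrow> Nt)"
  by (rule typ_closed) (simp add: bound_c_def q_defs)
lemma typ_index_c [simp]: "typ_of \<Gamma> index_c = Some (ty2 \<Rrightarrow> ty_seq \<Rrightarrow> Nt \<Rrightarrow> Nt)"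
  by (rule typ_closed) (simp add: index_c_def numeral_2_eq_2)
lemma typ_rate_c [simp]: "typ_of \<Gamma> rate_c = Some (ty2 \<Rrightarrow> ty_rate)"
  by (rule typ_closed) (simp add: rate_c_def numeral_2_eq_2)
lemma typ_search_seq_c [simp]: "typ_of \<Gamma> search_seq_c = Some ((ty1 \<Rrightarrow> SeqT Nt) \<Rrightarrow> ty2)"
  by (rule typ_closed) (simp add: search_seq_c_def Let_def numeral_2_eq_2)

lemmas ev_constants [simp] =
  ev_closed [OF typ_pow2_c, of _ "x # e" for x e]
  ev_closed [OF typ_tri_c, of _ "x # e" for x e]
  ev_closed [OF typ_root_c, of _ "x # e" for x e]
  ev_closed [OF typ_pair_c, of _ "x # e" for x e]
  ev_closed [OF typ_fst_c, of _ "x # e" for x e]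
  ev_closed [OF typ_snd_c, of _ "x # e" for x e]
  ev_closed [OF typ_qadd_c, of _ "x # e" for x e]
  ev_closed [OF typ_qsub_c, of _ "x # e" for x e]
  ev_closed [OF typ_qabs_c, of _ "x # e" for x e]
  ev_closed [OF typ_absdiff_c, of _ "x # e" for x e]
  ev_closed [OF typ_search_c, of _ "x # e" for x e]
  ev_closed [OF typ_jump_c, of _ "x # e" for x e]
  ev_closed [OF typ_zero_of_rate_c, of _ "x # e" for x e]
  ev_closed [OF typ_grid_c, of _ "x # e" for x e]
  ev_closed [OF typ_above_c, of _ "x # e" for x e]
  ev_closed [OF typ_level_c, of _ "x # e" for x e]
  ev_closed [OF typ_bound_c, of _ "x # e" for x e]
  ev_closed [OF typ_index_c, of _ "x # e" for x e]
  ev_closed [OF typ_rate_c, of _ "x # e" for x e]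
  ev_closed [OF typ_search_seq_c, of _ "x # e" for x e]

section \<open>Rationals of a model\<close>

text \<open>Inequalities and fractions of the model are computed in an ordered field into which its
  numbers embed, which opens them to linear arithmetic and field simplification. Such a field is
  constructed at the end.\<close>

locale arithmetic_field = arithmetic M L T for M :: "'v struct" and L T +
  fixes \<iota> :: "'v \<Rightarrow> 'k::linordered_field"
  assumes \<iota>_zer [simp]: "\<iota> zer = 0"
    and \<iota>_Su [simp]: "x \<in> N \<Longrightarrow> \<iota> (Su x) = \<iota> x + 1"
    and \<iota>_pl [simp]: "x \<in> N \<Longrightarrow> y \<in> N \<Longrightarrow> \<iota> (pl x y) = \<iota> x + \<iota> y"
    and \<iota>_ml [simp]: "x \<in> N \<Longrightarrow> y \<in> N \<Longrightarrow> \<iota> (ml x y) = \<iota> x * \<iota> y"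
    and \<iota>_nonneg [simp]: "x \<in> N \<Longrightarrow> 0 \<le> \<iota> x"
    and \<iota>_inj: "x \<in> N \<Longrightarrow> y \<in> N \<Longrightarrow> \<iota> x = \<iota> y \<longleftrightarrow> x = y"
begin

text \<open>That the embedding reflects the order follows from totality and injectivity: if
  \<open>x = pl y z\<close> although \<open>\<iota> x \<le> \<iota> y\<close>, then
  \<open>\<iota> z = 0\<close> and hence \<open>z = zer\<close>.\<close>

lemma mn_zer_iff [simp]: "x \<in> N \<Longrightarrow> y \<in> N \<Longrightarrow> mn x y = zer \<longleftrightarrow> \<iota> x \<le> \<iota> y"
proof
  assume xy: "x \<in> N" "y \<in> N"
  {
    assume "mn x y = zer"
    then show "\<iota> x \<le> \<iota> y" using xy mn_eq_zer by auto
  next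
    assume le: "\<iota> x \<le> \<iota> y"
    obtain z where z: "z \<in> N" "y = pl x z \<or> x = pl y z" using N_total xy by blast
    then show "mn x y = zer"
    proof (cases "y = pl x z")
      case False
      then have "x = pl y z" using z by simp
      then have "\<iota> z = 0" using le z xy \<iota>_nonneg [OF z(1)] by simp
      then have "z = zer" using \<iota>_inj [OF z(1) zer_N] by simp
      then show ?thesis using \<open>x = pl y z\<close> xy mn_eq_zer by (metis pl_zer z(1))
    qed (use z xy mn_eq_zer in blast)
  }
qed

lemma \<iota>_mn [simp]: "x \<in> N \<Longrightarrow> y \<in> N \<Longrightarrow> \<iota> (mn x y) = (if \<iota> x \<le> \<iota> y then 0 else \<iota> x - \<iota> y)"
proof (cases "mn x y = zer")
  case True
  moreover assume "x \<in> N" "y \<in> N"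
  ultimately show ?thesis by (metis \<iota>_zer mn_zer_iff)
next
  case False
  assume xy: "x \<in> N" "y \<in> N"
  with False have "pl y (mn x y) = x"
    by (metis mn_total mn_N mn_pl_zer pl_comm)
  then have "\<iota> x = \<iota> y + \<iota> (mn x y)" using \<iota>_pl xy by (metis mn_N)
  then show ?thesis using False xy by auto
qed

lemma \<iota>_eq_zero [simp]: "x \<in> N \<Longrightarrow> \<iota> x = 0 \<longleftrightarrow> x = zer"
  using \<iota>_inj [of x zer] by simp

lemma \<iota>_le_zero [simp]: "x \<in> N \<Longrightarrow> \<iota> x \<le> 0 \<longleftrightarrow> x = zer"
  using \<iota>_nonneg [of x] \<iota>_eq_zero [of x] by (auto simp: order_le_less)

lemma \<iota>_pos: "x \<in> N \<Longrightarrow> x \<noteq> zer \<Longrightarrow> 1 \<le> \<iota> x"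
  using N_cases [of x] \<iota>_Su [of "pr x"] \<iota>_nonneg [of "pr x"] pr_N [of x] by simp

lemma \<iota>_less: "x \<in> N \<Longrightarrow> y \<in> N \<Longrightarrow> \<iota> x < \<iota> y \<longleftrightarrow> \<iota> x + 1 \<le> \<iota> y"
proof
  assume xy: "x \<in> N" "y \<in> N" "\<iota> x < \<iota> y"
  then have "mn y x \<noteq> zer" by simp
  then show "\<iota> x + 1 \<le> \<iota> y" using \<iota>_pos [of "mn y x"] xy by simp
qed simp

lemma \<iota>_pr: "x \<in> N \<Longrightarrow> x \<noteq> zer \<Longrightarrow> \<iota> (pr x) = \<iota> x - 1"
  using N_cases [of x] \<iota>_Su [of "pr x"] pr_N [of x] by simp

lemma \<iota>_Su_pos [simp]: "x \<in> N \<Longrightarrow> 0 < \<iota> x + 1"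
  using \<iota>_nonneg [of x] by linarith

section \<open>Powers of two and Cantor pairing\<close>

definition p2 :: "'v \<Rightarrow> 'v" where "p2 x = ev M [] pow2_c \<star> x"
definition tri :: "'v \<Rightarrow> 'v" where "tri x = ev M [] tri_c \<star> x"
definition rt :: "'v \<Rightarrow> 'v" where "rt x = ev M [] root_c \<star> x"
definition pair :: "'v \<Rightarrow> 'v \<Rightarrow> 'v" where "pair x y = ev M [] pair_c \<star> x \<star> y"
definition fs :: "'v \<Rightarrow> 'v" where "fs x = ev M [] fst_c \<star> x"
definition sn :: "'v \<Rightarrow> 'v" where "sn x = ev M [] snd_c \<star> x"

lemma folds2 [simp]:
  "ev M [] pow2_c \<star> x = p2 x" "ev M [] tri_c \<star> x = tri x" "ev M [] root_c \<star> x = rt x"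
  "ev M [] pair_c \<star> x \<star> y = pair x y" "ev M [] fst_c \<star> x = fs x" "ev M [] snd_c \<star> x = sn x"
  by (simp_all add: p2_def tri_def rt_def pair_def fs_def sn_def)

lemma codes_N [simp]:
  "x \<in> N \<Longrightarrow> p2 x \<in> N" "x \<in> N \<Longrightarrow> tri x \<in> N" "x \<in> N \<Longrightarrow> rt x \<in> N"
  "x \<in> N \<Longrightarrow> y \<in> N \<Longrightarrow> pair x y \<in> N" "x \<in> N \<Longrightarrow> fs x \<in> N" "x \<in> N \<Longrightarrow> sn x \<in> N"
  using ev_dom [of "[Nt]" "[x]" "pow2_c \<cdot> Var 0" Nt] ev_dom [of "[Nt]" "[x]" "tri_c \<cdot> Var 0" Nt]
    ev_dom [of "[Nt]" "[x]" "root_c \<cdot> Var 0" Nt]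
    ev_dom [of "[Nt, Nt]" "[x, y]" "pair_c \<cdot> Var 0 \<cdot> Var 1" Nt]
    ev_dom [of "[Nt]" "[x]" "fst_c \<cdot> Var 0" Nt] ev_dom [of "[Nt]" "[x]" "snd_c \<cdot> Var 0" Nt]
  by simp_all

lemma p2_rec [simp]: "p2 zer = Su zer" "x \<in> N \<Longrightarrow> p2 (Su x) = pl (p2 x) (p2 x)"
  by (simp_all add: p2_def pow2_c_def)

lemma tri_rec [simp]: "tri zer = zer" "x \<in> N \<Longrightarrow> tri (Su x) = pl (tri x) (Su x)"
  by (simp_all add: tri_def tri_c_def)

lemma rt_rec [simp]: "rt zer = zer"
  "x \<in> N \<Longrightarrow> rt (Su x) = pl (rt x) (mn (Su zer) (mn (tri (Su (rt x))) (Su x)))"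
  by (simp_all add: rt_def root_c_def)

lemma pair_eq: "x \<in> N \<Longrightarrow> y \<in> N \<Longrightarrow> pair x y = pl (tri (pl x y)) x"
  by (simp add: pair_def pair_c_def)

lemma fs_eq: "x \<in> N \<Longrightarrow> fs x = mn x (tri (rt x))"
  by (simp add: fs_def fst_c_def)

lemma sn_eq: "x \<in> N \<Longrightarrow> sn x = mn (rt x) (fs x)"
  by (simp add: sn_def snd_c_def)

text \<open>Doubling avoids the division by 2, so the induction formula is an equation between
  terms.\<close>

lemma \<iota>_tri: "x \<in> N \<Longrightarrow> 2 * \<iota> (tri x) = \<iota> x * (\<iota> x + 1)"
  by (rule N_induct [where P = "\<lambda>x. 2 * \<iota> (tri x) = \<iota> x * (\<iota> x + 1)"
        and \<phi> = "Equ (tri_c \<cdot> Var 0 \<oplus> tri_c \<cdot> Var 0) (Var 0 \<odot> Sc (Var 0))" and e = "[]" and \<Gamma> = "[]"])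
    (simp_all flip: \<iota>_inj, simp_all add: algebra_simps)

lemma rt_bounds:
  "x \<in> N \<Longrightarrow> \<iota> (tri (rt x)) \<le> \<iota> x \<and> \<iota> x + 1 \<le> \<iota> (tri (Su (rt x)))"
proof (rule N_induct [where P = "\<lambda>x. \<iota> (tri (rt x)) \<le> \<iota> x \<and> \<iota> x + 1 \<le> \<iota> (tri (Su (rt x)))"
      and \<phi> = "Con (Le (tri_c \<cdot> (root_c \<cdot> Var 0)) (Var 0)) (Lt (Var 0) (tri_c \<cdot> Sc (root_c \<cdot> Var 0)))"
      and e = "[]" and \<Gamma> = "[]"])
  fix x assume x: "x \<in> N" and *: "\<iota> (tri (rt x)) \<le> \<iota> x \<and> \<iota> x + 1 \<le> \<iota> (tri (Su (rt x)))"
  show "\<iota> (tri (rt (Su x))) \<le> \<iota> (Su x) \<and> \<iota> (Su x) + 1 \<le> \<iota> (tri (Su (rt (Su x))))"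
  proof (cases "\<iota> (tri (Su (rt x))) \<le> \<iota> (Su x)")
    case True
    then have eq: "mn (tri (Su (rt x))) (Su x) = zer" using x by simp
    have "rt (Su x) = Su (rt x)" unfolding rt_rec(2) [OF x] eq using x by simp
    \<comment> \<open>After an increase the upper bound has to reach \<open>\<iota> x + 2\<close>.
      It grows by \<open>\<iota> (rt x) + 2\<close>, which suffices because
      \<open>\<iota> (rt x)\<close> is nonnegative.\<close>
    moreover have "0 \<le> \<iota> (rt x)" using x by simp
    ultimately show ?thesis using True * x by simp
  next
    case False
    then have "mn (tri (Su (rt x))) (Su x) \<noteq> zer" using x by simp
    then have "1 \<le> \<iota> (mn (tri (Su (rt x))) (Su x))" using x by (intro \<iota>_pos) simp_all
    then have eq: "mn (Su zer) (mn (tri (Su (rt x))) (Su x)) = zer"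
      using x by (subst mn_zer_iff) (simp_all del: \<iota>_mn)
    have rt: "rt (Su x) = rt x" unfolding rt_rec(2) [OF x] eq using x by simp
    show ?thesis unfolding rt
      using False * x \<iota>_less [of "Su x" "tri (Su (rt x))"] by simp
  qed
qed (simp_all add: Le_def Lt_def)

lemma rt_unique:
  assumes "x \<in> N" "w \<in> N" "\<iota> (tri w) \<le> \<iota> x" "\<iota> x < \<iota> (tri (Su w))"
  shows "rt x = w"
proof -
  have mono: "\<iota> (tri a) \<le> \<iota> (tri b)" if "a \<in> N" "b \<in> N" "\<iota> a \<le> \<iota> b" for a b
  proof -
    have "\<iota> a * (\<iota> a + 1) \<le> \<iota> b * (\<iota> b + 1)" using that by (intro mult_mono) auto
    then show ?thesis using \<iota>_tri [of a] \<iota>_tri [of b] that by linarith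
  qed
  have *: "\<iota> (tri (rt x)) \<le> \<iota> x" "\<iota> x < \<iota> (tri (Su (rt x)))"
    using rt_bounds [OF assms(1)] by linarith+
  have False if "\<iota> (rt x) < \<iota> w"
    using mono [of "Su (rt x)" w] \<iota>_less [of "rt x" w] that assms * by (simp del: tri_rec)
  moreover have False if "\<iota> w < \<iota> (rt x)"
    using mono [of "Su w" "rt x"] \<iota>_less [of w "rt x"] that assms * by (simp del: tri_rec)
  ultimately have "\<iota> (rt x) = \<iota> w" by (meson less_linear)
  then show ?thesis using assms \<iota>_inj by simp
qed

text \<open>The summand \<open>x\<close> is smaller than \<open>x + y + 1\<close>, the gap between
  the triangular numbers of \<open>x + y\<close> and of its successor.\<close>

lemma rt_pair: "x \<in> N \<Longrightarrow> y \<in> N \<Longrightarrow> rt (pair x y) = pl x y"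
  by (rule rt_unique) (simp_all add: pair_eq add_strict_increasing)

lemma fs_pair [simp]: "x \<in> N \<Longrightarrow> y \<in> N \<Longrightarrow> fs (pair x y) = x"
  by (subst \<iota>_inj [symmetric]) (simp_all add: fs_eq rt_pair, simp_all add: pair_eq)

lemma sn_pair [simp]: "x \<in> N \<Longrightarrow> y \<in> N \<Longrightarrow> sn (pair x y) = y"
  by (subst \<iota>_inj [symmetric]) (simp_all add: sn_eq rt_pair)

section \<open>Values of coded rationals\<close>

definition qv :: "'v \<Rightarrow> 'k" where
  "qv q = (\<iota> (fs (fs q)) - \<iota> (sn (fs q))) / (\<iota> (sn q) + 1)"

definition mk :: "'v \<Rightarrow> 'v \<Rightarrow> 'v \<Rightarrow> 'v" where "mk a b d = pair (pair a b) (pr d)"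

text \<open>Closed constants are rewritten to the empty environment from nonempty ones only, hence
  the case distinction on \<open>e\<close>.\<close>

lemma ev_mkq [simp]: "ev M e (mkq a b d) = mk (ev M e a) (ev M e b) (ev M e d)"
  by (cases e) (simp_all add: mkq_def mk_def)

lemma mk_N [simp]: "a \<in> N \<Longrightarrow> b \<in> N \<Longrightarrow> d \<in> N \<Longrightarrow> mk a b d \<in> N"
  by (simp add: mk_def)

lemma qv_mk: "a \<in> N \<Longrightarrow> b \<in> N \<Longrightarrow> d \<in> N \<Longrightarrow> d \<noteq> zer \<Longrightarrow> qv (mk a b d) = (\<iota> a - \<iota> b) / \<iota> d"
  by (simp add: qv_def mk_def \<iota>_pr)

definition qa :: "'v \<Rightarrow> 'v \<Rightarrow> 'v" where "qa x y = ev M [] qadd_c \<star> x \<star> y"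
definition qs :: "'v \<Rightarrow> 'v \<Rightarrow> 'v" where "qs x y = ev M [] qsub_c \<star> x \<star> y"
definition qb :: "'v \<Rightarrow> 'v" where "qb x = ev M [] qabs_c \<star> x"

lemma folds3 [simp]:
  "ev M [] qadd_c \<star> x \<star> y = qa x y" "ev M [] qsub_c \<star> x \<star> y = qs x y" "ev M [] qabs_c \<star> x = qb x"
  by (simp_all add: qa_def qs_def qb_def)

lemma q_N [simp]:
  "x \<in> N \<Longrightarrow> y \<in> N \<Longrightarrow> qa x y \<in> N" "x \<in> N \<Longrightarrow> y \<in> N \<Longrightarrow> qs x y \<in> N" "x \<in> N \<Longrightarrow> qb x \<in> N"
  using ev_dom [of "[Nt, Nt]" "[x, y]" "qadd (Var 0) (Var 1)" Nt]
    ev_dom [of "[Nt, Nt]" "[x, y]" "qsub (Var 0) (Var 1)" Nt]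
    ev_dom [of "[Nt]" "[x]" "qabs (Var 0)" Nt]
  by simp_all

lemma ml_ne_zer: "x \<in> N \<Longrightarrow> y \<in> N \<Longrightarrow> ml (Su x) (Su y) \<noteq> zer"
  using ml_eq_zer [of "Su x" "Su y"] by auto

text \<open>Numerators are differences of numbers. Subtraction uses the same identity with the two
  parts of the second numerator exchanged.\<close>

lemma sum_fractions:
  fixes d e :: 'k
  assumes "0 < d" "0 < e"
  shows "(a * e + b * d - (a' * e + b' * d)) / (d * e) = (a - a') / d + (b - b') / e"
  using assms by (simp add: field_simps)

lemma qv_qa [simp]: "x \<in> N \<Longrightarrow> y \<in> N \<Longrightarrow> qv (qa x y) = qv x + qv y"
proof -
  assume xy: "x \<in> N" "y \<in> N"
  have "qa x y = mk (pl (ml (fs (fs x)) (Su (sn y))) (ml (fs (fs y)) (Su (sn x))))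
      (pl (ml (sn (fs x)) (Su (sn y))) (ml (sn (fs y)) (Su (sn x)))) (ml (Su (sn x)) (Su (sn y)))"
    using xy by (simp add: qa_def qadd_c_def Let_def qpos_def qneg_def qden_def)
  then have "qv (qa x y) =
    (\<iota> (fs (fs x)) * (\<iota> (sn y) + 1) + \<iota> (fs (fs y)) * (\<iota> (sn x) + 1) -
     (\<iota> (sn (fs x)) * (\<iota> (sn y) + 1) + \<iota> (sn (fs y)) * (\<iota> (sn x) + 1))) /
    ((\<iota> (sn x) + 1) * (\<iota> (sn y) + 1))"
    using xy ml_ne_zer [of "sn x" "sn y"] by (simp add: qv_mk del: ml_Su)
  also have "\<dots> = qv x + (\<iota> (fs (fs y)) - \<iota> (sn (fs y))) / (\<iota> (sn y) + 1)"
    unfolding qv_def using xy by (intro sum_fractions) simp_all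
  finally show ?thesis by (simp add: qv_def)
qed

lemma qv_qs [simp]: "x \<in> N \<Longrightarrow> y \<in> N \<Longrightarrow> qv (qs x y) = qv x - qv y"
proof -
  assume xy: "x \<in> N" "y \<in> N"
  have "qs x y = mk (pl (ml (fs (fs x)) (Su (sn y))) (ml (sn (fs y)) (Su (sn x))))
      (pl (ml (sn (fs x)) (Su (sn y))) (ml (fs (fs y)) (Su (sn x)))) (ml (Su (sn x)) (Su (sn y)))"
    using xy by (simp add: qs_def qsub_c_def Let_def qpos_def qneg_def qden_def)
  then have "qv (qs x y) =
    (\<iota> (fs (fs x)) * (\<iota> (sn y) + 1) + \<iota> (sn (fs y)) * (\<iota> (sn x) + 1) -
     (\<iota> (sn (fs x)) * (\<iota> (sn y) + 1) + \<iota> (fs (fs y)) * (\<iota> (sn x) + 1))) /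
    ((\<iota> (sn x) + 1) * (\<iota> (sn y) + 1))"
    using xy ml_ne_zer [of "sn x" "sn y"] by (simp add: qv_mk del: ml_Su)
  also have "\<dots> = qv x + (\<iota> (sn (fs y)) - \<iota> (fs (fs y))) / (\<iota> (sn y) + 1)"
    unfolding qv_def using xy by (intro sum_fractions) simp_all
  finally show ?thesis by (simp add: qv_def diff_divide_distrib)
qed

lemma qv_qb [simp]: "x \<in> N \<Longrightarrow> qv (qb x) = \<bar>qv x\<bar>"
proof -
  assume x: "x \<in> N"
  have "qb x = mk (pl (mn (fs (fs x)) (sn (fs x))) (mn (sn (fs x)) (fs (fs x)))) zer (Su (sn x))"
    using x by (simp add: qb_def qabs_c_def Let_def qpos_def qneg_def qden_def)
  then have "qv (qb x) = \<bar>\<iota> (fs (fs x)) - \<iota> (sn (fs x))\<bar> / (\<iota> (sn x) + 1)"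
    using x by (simp add: qv_mk)
  then show ?thesis using \<iota>_Su_pos [of "sn x"] x by (simp add: qv_def abs_divide)
qed

lemma sat_qle [simp]:
  assumes "ev M e p \<in> N" "ev M e q \<in> N"
  shows "sat M e (qle p q) \<longleftrightarrow> qv (ev M e p) \<le> qv (ev M e q)"
proof -
  have "sat M e (qle p q) \<longleftrightarrow>
    \<iota> (fs (fs (ev M e p))) * (\<iota> (sn (ev M e q)) + 1) + \<iota> (sn (fs (ev M e q))) * (\<iota> (sn (ev M e p)) + 1) \<le>
    \<iota> (fs (fs (ev M e q))) * (\<iota> (sn (ev M e p)) + 1) + \<iota> (sn (fs (ev M e p))) * (\<iota> (sn (ev M e q)) + 1)"
    using assms by (cases e) (simp_all add: qle_def Le_def qpos_def qneg_def qden_def del: ml_Su)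
  then show ?thesis
    using \<iota>_Su_pos [of "sn (ev M e p)"] \<iota>_Su_pos [of "sn (ev M e q)"] assms
    by (simp add: qv_def divide_le_eq le_divide_eq) (simp add: algebra_simps)
qed

lemma sat_qlt [simp]:
  assumes "ev M e p \<in> N" "ev M e q \<in> N"
  shows "sat M e (qlt p q) \<longleftrightarrow> qv (ev M e p) < qv (ev M e q)"
proof -
  let ?a = "pl (ml (fs (fs (ev M e p))) (Su (sn (ev M e q)))) (ml (sn (fs (ev M e q))) (Su (sn (ev M e p))))"
  let ?b = "pl (ml (fs (fs (ev M e q))) (Su (sn (ev M e p)))) (ml (sn (fs (ev M e p))) (Su (sn (ev M e q))))"
  have "sat M e (qlt p q) \<longleftrightarrow> \<iota> ?a < \<iota> ?b"
    using assms \<iota>_less [of ?a ?b]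
    by (cases e) (simp_all add: qlt_def Lt_def Le_def qpos_def qneg_def qden_def del: ml_Su)
  then show ?thesis
    using \<iota>_Su_pos [of "sn (ev M e p)"] \<iota>_Su_pos [of "sn (ev M e q)"] assms
    by (simp add: qv_def divide_less_eq less_divide_eq del: ml_Su) (simp add: algebra_simps)
qed

section \<open>The error bounds 2^-n\<close>

definition h :: "'v \<Rightarrow> 'k" where "h n = 1 / \<iota> (p2 n)"

lemma p2_ge: "n \<in> N \<Longrightarrow> \<iota> n + 1 \<le> \<iota> (p2 n)"
proof (rule N_induct [where P = "\<lambda>n. \<iota> n + 1 \<le> \<iota> (p2 n)" and \<phi> = "Lt (Var 0) (pow2_c \<cdot> Var 0)"
      and e = "[]" and \<Gamma> = "[]"])
  fix n assume n: "n \<in> N" and "\<iota> n + 1 \<le> \<iota> (p2 n)"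
  moreover have "0 \<le> \<iota> n" using n by simp
  ultimately have "\<iota> n + 1 + 1 \<le> \<iota> (p2 n) + \<iota> (p2 n)" by linarith
  then show "\<iota> (Su n) + 1 \<le> \<iota> (p2 (Su n))" using n by simp
qed (simp_all add: Lt_def Le_def)

lemma p2_pos: "n \<in> N \<Longrightarrow> 0 < \<iota> (p2 n)"
  using p2_ge [of n] \<iota>_nonneg [of n] by linarith

lemma p2_ne [simp]: "n \<in> N \<Longrightarrow> p2 n \<noteq> zer"
  using p2_pos [of n] by auto

lemma p2_pl: "a \<in> N \<Longrightarrow> n \<in> N \<Longrightarrow> p2 (pl a n) = ml (p2 a) (p2 n)"
  by (rule N_induct [where P = "\<lambda>n. p2 (pl a n) = ml (p2 a) (p2 n)"
        and \<phi> = "Equ (pow2_c \<cdot> (Var 1 \<oplus> Var 0)) (pow2_c \<cdot> Var 1 \<odot> pow2_c \<cdot> Var 0)"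
        and e = "[a]" and \<Gamma> = "[Nt]"])
    (simp_all add: ml_pl)

lemma h_pos [simp]: "n \<in> N \<Longrightarrow> 0 < h n" by (simp add: h_def p2_pos)
lemma h_zer [simp]: "h zer = 1" by (simp add: h_def)
lemma h_Su [simp]: "n \<in> N \<Longrightarrow> h (Su n) = h n / 2" by (simp add: h_def)
lemma h_pl: "a \<in> N \<Longrightarrow> n \<in> N \<Longrightarrow> h (pl a n) = h a * h n" by (simp add: h_def p2_pl)
text \<open>As 2^n exceeds n, even n errors of size \<open>h n\<close> sum up to at most 1; this
  pays for walks of arbitrary length along a sequence.\<close>

lemma \<iota>_h: "n \<in> N \<Longrightarrow> \<iota> n * h n \<le> 1"
  using p2_ge [of n] p2_pos [of n] by (simp add: h_def divide_le_eq)
lemma h_le_1: "n \<in> N \<Longrightarrow> h n \<le> 1"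
proof -
  assume n: "n \<in> N"
  have "0 \<le> \<iota> n" using n by simp
  with p2_ge [OF n] have "1 \<le> \<iota> (p2 n)" by linarith
  then show ?thesis by (simp add: h_def)
qed
lemma h_le: "n \<in> N \<Longrightarrow> n \<noteq> zer \<Longrightarrow> h n \<le> 1 / \<iota> n"
  using \<iota>_h [of n] \<iota>_pos [of n] by (simp add: le_divide_eq mult.commute)

lemma ev_qinv [simp]: "ev M e (qinv k) = mk (Su zer) zer (ev M e k)"
  by (simp add: qinv_def)

definition hq :: "'v \<Rightarrow> 'v" where "hq n = mk (Su zer) zer (p2 n)"

lemma ev_q2 [simp]: "ev M e (q2 n) = hq (ev M e n)"
  by (cases e) (simp_all add: q2_def hq_def)

lemma hq_N [simp]: "n \<in> N \<Longrightarrow> hq n \<in> N"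
  by (simp add: hq_def)

lemma qv_hq [simp]: "n \<in> N \<Longrightarrow> qv (hq n) = h n"
  by (simp add: qv_mk h_def hq_def)

end

context arithmetic_field
begin

section \<open>Search functionals\<close>

lemma app_types [simp]:
  "f \<in> D ty1 \<Longrightarrow> n \<in> N \<Longrightarrow> f \<star> n \<in> N"
  "c \<in> D ty_seq \<Longrightarrow> n \<in> N \<Longrightarrow> c \<star> n \<in> D ty1"
  "\<mu> \<in> D ty2 \<Longrightarrow> f \<in> D ty1 \<Longrightarrow> \<mu> \<star> f \<in> N"
  "t \<in> D ty_rate \<Longrightarrow> c \<in> D ty_seq \<Longrightarrow> t \<star> c \<in> D ty1"
  by (rule app_dom; assumption)+

lemma ev_cond [simp]:
  assumes "ev M e z \<in> N" "ev M e a \<in> N" "ev M e b \<in> N"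
  shows "ev M e (cond z a b) = (if ev M e z = zer then ev M e a else ev M e b)"
proof -
  have 1: "cst M (PiC Nt Nt) \<star> ev M e b \<in> D ty1"
    using app_dom [OF _ assms(3)] cst_dom [of "PiC Nt Nt"] by simp
  then have 2: "cst M (PiC ty1 Nt) \<star> (cst M (PiC Nt Nt) \<star> ev M e b) \<in> D step_ty"
    using app_dom [OF _ 1] cst_dom [of "PiC ty1 Nt"] by simp
  from N_cases [OF assms(1)] show ?thesis
  proof
    assume "ev M e z = zer"
    then show ?thesis using assms 2 by (simp add: cond_def)
  next
    assume z: "ev M e z = Su (pr (ev M e z))"
    then have "ev M e z \<noteq> zer" using assms by (metis Su_zer(1) pr_N)
    moreover have "Rec (Su (pr (ev M e z))) (ev M e a)
        (cst M (PiC ty1 Nt) \<star> (cst M (PiC Nt Nt) \<star> ev M e b)) = ev M e b"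
      using assms 1 2 by (subst Rec_Su) simp_all
    ultimately show ?thesis using z by (simp add: cond_def)
  qed
qed

definition W :: "'v \<Rightarrow> 'v \<Rightarrow> 'v" where "W f n = ev M [] search_c \<star> f \<star> n"

lemma fold_W [simp]: "ev M [] search_c \<star> f \<star> n = W f n" by (simp add: W_def)

lemma W_N [simp]: "f \<in> D ty1 \<Longrightarrow> n \<in> N \<Longrightarrow> W f n \<in> N"
  using ev_dom [of "[ty1, Nt]" "[f, n]" "search_c \<cdot> Var 0 \<cdot> Var 1" Nt] by simp

lemma W_rec:
  "f \<in> D ty1 \<Longrightarrow> W f zer = zer"
  "f \<in> D ty1 \<Longrightarrow> n \<in> N \<Longrightarrow> W f (Su n) = (if f \<star> W f n = zer then W f n else Su n)"
proof -
  assume f: "f \<in> D ty1"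
  \<comment> \<open>Here \<open>lam\<close> has to produce a closed term, so the parameter
    \<open>f\<close> is passed to the step function as an argument instead of being free in
    it.\<close>
  define z where "z = ev M [] (lam [Nt, Nt, ty1] (cond (Var 2 \<cdot> Var 1) (Var 1) (Sc (Var 0))))"
  have z: "z \<in> D (ty1 \<Rrightarrow> step_ty)"
    unfolding z_def by (rule ev_dom [of "[]"]) (simp_all add: numeral_2_eq_2)
  then have zf: "z \<star> f \<in> D step_ty" using app_dom f by blast
  have W: "W f n = Rec n zer (z \<star> f)" if "n \<in> N" for n
    using f that by (simp add: W_def search_c_def z_def numeral_2_eq_2)
  show "W f zer = zer" using W zf by simp
  assume n: "n \<in> N"
  have "Rec n zer (z \<star> f) \<in> N" using zf n by simp
  then have "z \<star> f \<star> Rec n zer (z \<star> f) \<star> n =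
      (if f \<star> Rec n zer (z \<star> f) = zer then Rec n zer (z \<star> f) else Su n)"
    using f n unfolding z_def by (simp add: numeral_2_eq_2)
  then show "W f (Su n) = (if f \<star> W f n = zer then W f n else Su n)"
    using W zf n by simp
qed

lemma W_cases: "f \<in> D ty1 \<Longrightarrow> n \<in> N \<Longrightarrow> f \<star> W f n = zer \<or> W f n = n"
  by (rule N_induct [where P = "\<lambda>n. f \<star> W f n = zer \<or> W f n = n"
        and \<phi> = "Dis (Equ (Var 1 \<cdot> (search_c \<cdot> Var 1 \<cdot> Var 0)) Z) (Equ (search_c \<cdot> Var 1 \<cdot> Var 0) (Var 0))"
        and e = "[f]" and \<Gamma> = "[ty1]"])
    (simp_all add: W_rec)

text \<open>Plays the part of minimality, whose usual form has a bounded quantifier and would not be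
  quantifier-free.\<close>

lemma W_persist:
  "f \<in> D ty1 \<Longrightarrow> n \<in> N \<Longrightarrow> i \<in> N \<Longrightarrow> f \<star> W f n = zer \<Longrightarrow> W f (pl n i) = W f n"
  by (rule N_induct [where P = "\<lambda>i. W f (pl n i) = W f n"
        and \<phi> = "Equ (search_c \<cdot> Var 1 \<cdot> (Var 2 \<oplus> Var 0)) (search_c \<cdot> Var 1 \<cdot> Var 2)"
        and e = "[f, n]" and \<Gamma> = "[ty1, Nt]"])
    (simp_all add: W_rec)

text \<open>The search up to \<open>n\<close> ends at a zero or at \<open>n\<close>, which is a zero
  itself; persistence carries the result on.\<close>

lemma W_found:
  assumes "f \<in> D ty1" "n \<in> N" "i \<in> N" "f \<star> n = zer"
  shows "f \<star> W f (pl n i) = zer"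
  using W_cases [of f n] W_persist [of f n i] assms by auto

lemma W_le: "f \<in> D ty1 \<Longrightarrow> n \<in> N \<Longrightarrow> \<iota> (W f n) \<le> \<iota> n"
proof (rule N_induct [where P = "\<lambda>n. \<iota> (W f n) \<le> \<iota> n"
      and \<phi> = "Le (search_c \<cdot> Var 1 \<cdot> Var 0) (Var 0)" and e = "[f]" and \<Gamma> = "[ty1]"])
  fix n assume "f \<in> D ty1" "n \<in> N" "\<iota> (W f n) \<le> \<iota> n"
  then show "\<iota> (W f (Su n)) \<le> \<iota> (Su n)" by (simp add: W_rec)
qed (simp_all add: Le_def W_rec)

section \<open>Monotone sequences of reals\<close>

text \<open>The bound \<open>h n / 4\<close> is the 2^-(n+2) of \<open>is_real\<close>.\<close>

definition real_code :: "'v \<Rightarrow> bool" where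
  "real_code x \<longleftrightarrow> (\<forall>n\<in>N. \<forall>i\<in>N. \<bar>qv (x \<star> n) - qv (x \<star> pl n i)\<bar> < h n / 4)"

definition monob :: "'v \<Rightarrow> bool" where
  "monob c \<longleftrightarrow> (\<forall>n\<in>N. real_code (c \<star> n)) \<and>
    (\<forall>n\<in>N. (\<forall>i\<in>N. qv (c \<star> n \<star> i) \<le> qv (c \<star> Su n \<star> i) + h i) \<and>
           (\<forall>i\<in>N. qv (c \<star> Su n \<star> i) \<le> 1 + h i))"

lemma sat_mono_bounded [simp]:
  "ev M e c \<in> D ty_seq \<Longrightarrow> sat M e (mono_bounded c) \<longleftrightarrow> monob (ev M e c)"
  by (simp add: mono_bounded_def monob_def real_code_def is_real_def real_le_def real_of_rat_def qv_mk)

lemma real_close: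
  assumes "real_code x" "a \<in> N" "b \<in> N"
  shows "\<bar>qv (x \<star> a) - qv (x \<star> b)\<bar> \<le> h a / 4 + h b / 4"
proof -
  have *: "\<bar>qv (x \<star> a) - qv (x \<star> pl a z)\<bar> < h a / 4" if "a \<in> N" "z \<in> N" for a z
    using assms that by (auto simp: real_code_def)
  obtain z where "z \<in> N" "b = pl a z \<or> a = pl b z" using N_total assms by blast
  then have "\<bar>qv (x \<star> a) - qv (x \<star> b)\<bar> < h a / 4 \<or> \<bar>qv (x \<star> b) - qv (x \<star> a)\<bar> < h b / 4"
    using * assms by blast
  moreover have "0 < h a" "0 < h b" using assms by auto
  ultimately show ?thesis by linarith
qed

text \<open>Adding up the errors of \<open>l\<close> steps at a precision that exceeds \<open>l\<close> avoids an induction on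
  an inequality between reals, which is not quantifier-free.\<close>

lemma monob_le:
  assumes c: "c \<in> D ty_seq" "monob c" and N: "n \<in> N" "l \<in> N" "m \<in> N"
  shows "qv (c \<star> n \<star> m) \<le> qv (c \<star> pl n l \<star> m) + h m"
proof -
  \<comment> \<open>With this \<open>i\<close> the error \<open>\<iota> l * h i\<close> is at most
    \<open>h m / 2\<close>, and moving each of the two reals between the precisions \<open>m\<close>
    and \<open>i\<close> costs less than \<open>h m / 4\<close>; the total is within
    \<open>h m\<close>.\<close>
  define i where "i = pl m (Su l)"
  have i: "i \<in> N" using N by (simp add: i_def)
  have "qv (c \<star> n \<star> i) \<le> qv (c \<star> pl n l \<star> i) + \<iota> l * h i"
  proof (rule N_induct [where P = "\<lambda>l. qv (c \<star> n \<star> i) \<le> qv (c \<star> pl n l \<star> i) + \<iota> l * h i"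
        and \<phi> = "qle (Var 1 \<cdot> Var 2 \<cdot> Var 3)
          (qadd (Var 1 \<cdot> (Var 2 \<oplus> Var 0) \<cdot> Var 3) (mkq (Var 0) Z (pow2_c \<cdot> Var 3)))"
        and e = "[c, n, i]" and \<Gamma> = "[ty_seq, Nt, Nt]"])
    fix l assume l: "l \<in> N" and *: "qv (c \<star> n \<star> i) \<le> qv (c \<star> pl n l \<star> i) + \<iota> l * h i"
    have "qv (c \<star> pl n l \<star> i) \<le> qv (c \<star> Su (pl n l) \<star> i) + h i"
      using c N l i by (simp add: monob_def)
    with * show "qv (c \<star> n \<star> i) \<le> qv (c \<star> pl n (Su l) \<star> i) + \<iota> (Su l) * h i"
      using N l by (simp add: algebra_simps)
  qed (use c N i in \<open>simp_all add: qv_mk h_def eval_nat_numeral\<close>)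
  moreover have "\<iota> l * h i \<le> h m / 2"
  proof -
    have "\<iota> l * h i = h m / 2 * (\<iota> l * h l)" using N by (simp add: i_def h_pl)
    also have "\<dots> \<le> h m / 2 * 1" using N \<iota>_h [of l] by (intro mult_left_mono) (auto intro: less_imp_le)
    finally show ?thesis by simp
  qed
  moreover have "\<bar>qv (c \<star> k \<star> m) - qv (c \<star> k \<star> i)\<bar> < h m / 4" if "k \<in> N" for k
    using c N that by (simp add: monob_def real_code_def i_def del: pl_Su)
  from this [of n] this [of "pl n l"] N
  have "\<bar>qv (c \<star> n \<star> m) - qv (c \<star> n \<star> i)\<bar> < h m / 4"
    "\<bar>qv (c \<star> pl n l \<star> m) - qv (c \<star> pl n l \<star> i)\<bar> < h m / 4" by simp_all
  ultimately show ?thesis by linarith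
qed

text \<open>The bound 1 is given for the reals with successor index. Passing to the next index and
  from the real to its approximation costs \<open>h m\<close> each, and \<open>h m\<close> is at
  most 1, whence 3.\<close>

lemma monob_upper:
  assumes c: "c \<in> D ty_seq" "monob c" and N: "n \<in> N" "m \<in> N"
  shows "qv (c \<star> n \<star> m) \<le> 3"
proof -
  have "qv (c \<star> n \<star> m) \<le> qv (c \<star> Su n \<star> m) + h m" "qv (c \<star> Su n \<star> m) \<le> 1 + h m"
    using c N by (simp_all add: monob_def)
  then show ?thesis using h_le_1 [of m] N by linarith
qed

section \<open>From monotone convergence to a search functional\<close>

definition J :: "'v \<Rightarrow> 'v" where "J f = ev M [] jump_c \<star> f"

lemma fold_J [simp]: "ev M [] jump_c \<star> f = J f" by (simp add: J_def)

lemma J_dom [simp]: "f \<in> D ty1 \<Longrightarrow> J f \<in> D ty_seq"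
  using ev_dom [of "[ty1]" "[f]" "jump_c \<cdot> Var 0" ty_seq] by simp

lemma qv_J [simp]:
  "f \<in> D ty1 \<Longrightarrow> n \<in> N \<Longrightarrow> i \<in> N \<Longrightarrow> qv (J f \<star> n \<star> i) = (if f \<star> W f n = zer then 1 else 0)"
proof -
  assume fni: "f \<in> D ty1" "n \<in> N" "i \<in> N"
  then have "J f \<star> n \<star> i = mk (mn (Su zer) (f \<star> W f n)) zer (Su zer)"
    by (simp add: J_def jump_c_def numeral_2_eq_2)
  then show ?thesis using fni \<iota>_pos [of "f \<star> W f n"] by (simp add: qv_mk)
qed

text \<open>Each real is represented by a sequence of constant value, so convergence is trivial, and
  a search that has found a zero keeps it, so the values never fall back to 0.\<close>

lemma monob_J [simp]: "f \<in> D ty1 \<Longrightarrow> monob (J f)"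
  by (auto simp: monob_def real_code_def W_rec less_imp_le add_nonneg_nonneg)

definition MU_at :: "'v \<Rightarrow> bool" where
  "MU_at \<mu> \<longleftrightarrow> (\<forall>f\<in>D ty1. (\<exists>n\<in>N. f \<star> n = zer) \<longrightarrow> f \<star> (\<mu> \<star> f) = zer)"

lemma sat_MU [simp]: "sat M e (MU \<mu>) \<longleftrightarrow> MU_at (ev M e \<mu>)"
  by (simp add: MU_def MU_at_def)

text \<open>The index \<open>Su i\<close> comes from the shift in \<open>absdiff_c\<close>, and
  \<open>h i\<close> is the error in the order of reals.\<close>

definition MCT_rate :: "'v \<Rightarrow> bool" where
  "MCT_rate t \<longleftrightarrow> (\<forall>c\<in>D ty_seq. \<forall>k\<in>N. k \<noteq> zer \<longrightarrow> monob c \<longrightarrow>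
    (\<forall>a\<in>N. \<forall>b\<in>N. \<iota> (t \<star> c \<star> k) \<le> \<iota> a \<and> \<iota> (t \<star> c \<star> k) \<le> \<iota> b \<longrightarrow>
      (\<forall>i\<in>N. \<bar>qv (c \<star> b \<star> Su i) - qv (c \<star> a \<star> Su i)\<bar> \<le> 1 / \<iota> k + h i)))"

lemma absdiff_app [simp]:
  "x \<in> D ty1 \<Longrightarrow> y \<in> D ty1 \<Longrightarrow> i \<in> N \<Longrightarrow>
    ev M [] absdiff_c \<star> x \<star> y \<star> i = qb (qs (x \<star> Su i) (y \<star> Su i))"
  by (simp add: absdiff_c_def numeral_2_eq_2)

lemma sat_MCT_ef [simp]:
  "ev M e t \<in> D ty_rate \<Longrightarrow> sat M e (MCT_ef t) \<longleftrightarrow> MCT_rate (ev M e t)"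
  by (simp add: MCT_ef_def MCT_rate_def Let_def real_le_def real_absdiff_def real_of_rat_def
      eval_nat_numeral Le_def qv_mk)

text \<open>The index \<open>pl n r\<close> lies past the rate \<open>r\<close> and past the zero
  \<open>n\<close>, so \<open>J f\<close> is 1 there. Being close to this value, \<open>J f\<close>
  is 1 at \<open>r\<close> already, which means that the search up to \<open>r\<close>
  succeeds.\<close>

lemma MU_of_MCT_rate:
  assumes t: "t \<in> D ty_rate" "MCT_rate t"
  shows "MU_at (ev M [] zero_of_rate_c \<star> t)"
  unfolding MU_at_def
proof (intro ballI impI)
  fix f assume f: "f \<in> D ty1" and "\<exists>n\<in>N. f \<star> n = zer"
  then obtain n where n: "n \<in> N" "f \<star> n = zer" by blast
  define r where "r = t \<star> J f \<star> Su (Su zer)"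
  have r: "r \<in> N" using t f by (simp add: r_def)
  have eq: "ev M [] zero_of_rate_c \<star> t \<star> f = W f r"
    using t f by (simp add: zero_of_rate_c_def r_def)
  have "f \<star> W f (pl n r) = zer" using W_found f n r by blast
  moreover have "\<bar>qv (J f \<star> pl n r \<star> Su i) - qv (J f \<star> r \<star> Su i)\<bar> \<le> 1 / \<iota> (Su (Su zer)) + h i"
    if "i \<in> N" for i
    using t(2) [unfolded MCT_rate_def, rule_format, OF J_dom [OF f], of "Su (Su zer)" r "pl n r" i]
      f r n that by (simp add: r_def [symmetric])
  \<comment> \<open>At this precision the bound is 1/2 + 1/4, whereas distinct values among 0 and 1
    have distance 1.\<close>
  from this [of "Su (Su zer)"]
  have "\<bar>qv (J f \<star> pl n r \<star> Su (Su (Su zer))) - qv (J f \<star> r \<star> Su (Su (Su zer)))\<bar> \<le> 3 / 4" by simp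
  ultimately show "f \<star> (ev M [] zero_of_rate_c \<star> t \<star> f) = zer"
    using f r n by (simp add: eq split: if_splits)
qed

section \<open>From a search functional to monotone convergence\<close>

definition G :: "'v \<Rightarrow> 'v \<Rightarrow> 'v \<Rightarrow> 'v" where "G c m j = ev M [] above_c \<star> c \<star> m \<star> j"
definition Lv :: "'v \<Rightarrow> 'v \<Rightarrow> 'v \<Rightarrow> 'v \<Rightarrow> 'v" where "Lv \<mu> c m i = ev M [] level_c \<star> \<mu> \<star> c \<star> m \<star> i"
definition B :: "'v \<Rightarrow> 'v \<Rightarrow> 'v" where "B c m = ev M [] bound_c \<star> c \<star> m"
definition I :: "'v \<Rightarrow> 'v \<Rightarrow> 'v \<Rightarrow> 'v" where "I \<mu> c m = ev M [] index_c \<star> \<mu> \<star> c \<star> m"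

lemma fold_G [simp]:
  "ev M [] above_c \<star> c \<star> m \<star> j = G c m j"
  "ev M [] level_c \<star> \<mu> \<star> c \<star> m \<star> i = Lv \<mu> c m i"
  "ev M [] bound_c \<star> c \<star> m = B c m"
  "ev M [] index_c \<star> \<mu> \<star> c \<star> m = I \<mu> c m"
  by (simp_all add: G_def Lv_def B_def I_def)

lemma G_dom [simp]: "c \<in> D ty_seq \<Longrightarrow> m \<in> N \<Longrightarrow> j \<in> N \<Longrightarrow> G c m j \<in> D ty1"
  using ev_dom [of "[ty_seq, Nt, Nt]" "[c, m, j]" "above_c \<cdot> Var 0 \<cdot> Var 1 \<cdot> Var 2" ty1]
  by (simp add: numeral_2_eq_2)

lemma Lv_N [simp]: "\<mu> \<in> D ty2 \<Longrightarrow> c \<in> D ty_seq \<Longrightarrow> m \<in> N \<Longrightarrow> i \<in> N \<Longrightarrow> Lv \<mu> c m i \<in> N"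
  using ev_dom [of "[ty2, ty_seq, Nt, Nt]" "[\<mu>, c, m, i]" "level_c \<cdot> Var 0 \<cdot> Var 1 \<cdot> Var 2 \<cdot> Var 3" Nt]
  by (simp add: eval_nat_numeral)

lemma B_N [simp]: "c \<in> D ty_seq \<Longrightarrow> m \<in> N \<Longrightarrow> B c m \<in> N"
  using ev_dom [of "[ty_seq, Nt]" "[c, m]" "bound_c \<cdot> Var 0 \<cdot> Var 1" Nt] by simp

lemma G_zero:
  assumes "c \<in> D ty_seq" "m \<in> N" "j \<in> N" "n \<in> N"
  shows "G c m j \<star> n = zer \<longleftrightarrow> qv (c \<star> zer \<star> m) + \<iota> j * h m \<le> qv (c \<star> n \<star> m)"
proof -
  define v where "v = ev M [] grid_c \<star> c \<star> m \<star> j"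
  have v: "v = qa (c \<star> zer \<star> m) (mk j zer (p2 m))"
    using assms by (simp add: v_def grid_c_def numeral_2_eq_2)
  then have vN: "v \<in> N" and qv: "qv v = qv (c \<star> zer \<star> m) + \<iota> j * h m"
    using assms by (simp_all add: qv_mk h_def)
  \<comment> \<open>\<open>above_c\<close> is the left side of the equation hidden in
    \<open>qle\<close>; evaluating that formula saves a second cross-multiplication.\<close>
  have "G c m j \<star> n = zer \<longleftrightarrow> sat M [v, c \<star> n \<star> m] (qle (Var 0) (Var 1))"
    using assms vN
    by (simp add: G_def above_c_def Let_def eval_nat_numeral v_def [symmetric] qle_def Le_def q_defs
        del: sat_qle)
  also have "\<dots> \<longleftrightarrow> qv v \<le> qv (c \<star> n \<star> m)" using assms vN by simp
  finally show ?thesis by (simp add: qv)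
qed

abbreviation attained :: "'v \<Rightarrow> 'v \<Rightarrow> 'v \<Rightarrow> 'v \<Rightarrow> bool" where
  "attained \<mu> c m j \<equiv> G c m j \<star> (\<mu> \<star> G c m j) = zer"

lemma Lv_rec:
  assumes "\<mu> \<in> D ty2" "c \<in> D ty_seq" "m \<in> N"
  shows "Lv \<mu> c m zer = zer"
    and "i \<in> N \<Longrightarrow> Lv \<mu> c m (Su i) =
      (if attained \<mu> c m (Su (Lv \<mu> c m i)) then Su (Lv \<mu> c m i) else Lv \<mu> c m i)"
proof -
  define z where "z = ev M [] (lam [Nt, Nt, Nt, ty_seq, ty2]
        (let g = above_c \<cdot> Var 3 \<cdot> Var 2 \<cdot> Sc (Var 1) in cond (g \<cdot> (Var 4 \<cdot> g)) (Sc (Var 1)) (Var 1)))"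
  have "z \<in> D (ty2 \<Rrightarrow> ty_seq \<Rrightarrow> Nt \<Rrightarrow> step_ty)"
    unfolding z_def by (rule ev_dom [of "[]"]) (simp_all add: eval_nat_numeral Let_def)
  then have z: "z \<star> \<mu> \<star> c \<star> m \<in> D step_ty" using app_dom assms by blast
  have L: "Lv \<mu> c m i = Rec i zer (z \<star> \<mu> \<star> c \<star> m)" if "i \<in> N" for i
    using assms that by (simp add: Lv_def level_c_def z_def Let_def eval_nat_numeral)
  show "Lv \<mu> c m zer = zer" using L z by simp
  assume i: "i \<in> N"
  define p where "p = Rec i zer (z \<star> \<mu> \<star> c \<star> m)"
  have p: "p \<in> N" using z i by (simp add: p_def)
  have "z \<star> \<mu> \<star> c \<star> m \<star> p \<star> i = (if attained \<mu> c m (Su p) then Su p else p)"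
    using assms i p unfolding z_def by (simp add: Let_def eval_nat_numeral)
  then show "Lv \<mu> c m (Su i) =
      (if attained \<mu> c m (Su (Lv \<mu> c m i)) then Su (Lv \<mu> c m i) else Lv \<mu> c m i)"
    using L z i by (simp add: p_def [symmetric])
qed

text \<open>Thanks to \<open>\<mu>\<close> attainment is an equation, so the invariant is
  quantifier-free. Once a test fails, the level stays put and the same test fails forever, which
  preserves the disjunction.\<close>

lemma Lv_invariant:
  assumes "\<mu> \<in> D ty2" "c \<in> D ty_seq" "m \<in> N" "attained \<mu> c m zer" "i \<in> N"
  shows "(Lv \<mu> c m i = i \<or> \<not> attained \<mu> c m (Su (Lv \<mu> c m i))) \<and> attained \<mu> c m (Lv \<mu> c m i)"
proof (rule N_induct [where P = "\<lambda>i. (Lv \<mu> c m i = i \<or> \<not> attained \<mu> c m (Su (Lv \<mu> c m i))) \<and>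
        attained \<mu> c m (Lv \<mu> c m i)"
      and \<phi> = "let l = level_c \<cdot> Var 1 \<cdot> Var 2 \<cdot> Var 3 \<cdot> Var 0;
          g = above_c \<cdot> Var 2 \<cdot> Var 3 \<cdot> l; g' = above_c \<cdot> Var 2 \<cdot> Var 3 \<cdot> Sc l in
        Con (Dis (Equ l (Var 0)) (Neg (Equ (g' \<cdot> (Var 1 \<cdot> g')) Z))) (Equ (g \<cdot> (Var 1 \<cdot> g)) Z)"
      and e = "[\<mu>, c, m]" and \<Gamma> = "[ty2, ty_seq, Nt]"])
  fix i assume "i \<in> N" and
    "(Lv \<mu> c m i = i \<or> \<not> attained \<mu> c m (Su (Lv \<mu> c m i))) \<and> attained \<mu> c m (Lv \<mu> c m i)"
  then show "(Lv \<mu> c m (Su i) = Su i \<or> \<not> attained \<mu> c m (Su (Lv \<mu> c m (Su i)))) \<and>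
      attained \<mu> c m (Lv \<mu> c m (Su i))"
    using Lv_rec(2) [OF assms(1-3), of i] by auto
qed (use assms Lv_rec in \<open>simp_all add: Let_def eval_nat_numeral\<close>)

text \<open>The origin of the 4 in \<open>bound_c\<close>: if b is the negative part of the
  numerator of \<open>c \<star> zer \<star> m\<close>, this grid point lies b + 4 above an
  approximation that is at least -b. So it is at least 4, beyond the 3 of
  \<open>monob_upper\<close>.\<close>

lemma B_not_attained:
  assumes c: "c \<in> D ty_seq" "monob c" and N: "m \<in> N" "n \<in> N"
  shows "G c m (B c m) \<star> n \<noteq> zer"
proof
  let ?q = "c \<star> zer \<star> m"
  have q: "?q \<in> N" using c N by simp
  have B: "B c m = ml (p2 m) (pl (sn (fs ?q)) (Su (Su (Su (Su zer)))))"
    using c N by (simp add: B_def bound_c_def q_defs)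
  have "\<iota> (B c m) * h m = \<iota> (sn (fs ?q)) + 4"
    unfolding B using q p2_pos [of m] N by (simp add: h_def del: pl_Su)
  moreover assume "G c m (B c m) \<star> n = zer"
  ultimately have "qv ?q + (\<iota> (sn (fs ?q)) + 4) \<le> 3"
    using G_zero [of c m "B c m" n] monob_upper [OF c] c N by fastforce
  \<comment> \<open>The denominator is at least 1, so the division cannot enlarge the negative
    part.\<close>
  moreover have "- \<iota> (sn (fs ?q)) \<le> qv ?q"
  proof -
    have "\<iota> (sn (fs ?q)) * 1 \<le> \<iota> (sn (fs ?q)) * (\<iota> (sn ?q) + 1)"
      using q by (intro mult_left_mono) auto
    moreover have "0 \<le> \<iota> (fs (fs ?q))" using q by simp
    ultimately have "- \<iota> (sn (fs ?q)) * (\<iota> (sn ?q) + 1) \<le> \<iota> (fs (fs ?q)) - \<iota> (sn (fs ?q))"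
      by (simp only: mult_minus_left)
    then show ?thesis unfolding qv_def using q by (subst pos_le_divide_eq) auto
  qed
  ultimately show False by linarith
qed

text \<open>Correctness of \<open>\<mu>\<close> is required only at grid point 0 and just above the
  final level. So the lemma serves a functional that is correct everywhere as well as one that is
  correct on standard functions, in the case where these two grid functions are standard.\<close>

lemma index_close:
  assumes \<mu>: "\<mu> \<in> D ty2" and c: "c \<in> D ty_seq" "monob c" and m: "m \<in> N"
    and 0: "attained \<mu> c m zer"
    and next_level: "\<And>n. n \<in> N \<Longrightarrow> G c m (Su (Lv \<mu> c m (B c m))) \<star> n = zer \<Longrightarrow>
      attained \<mu> c m (Su (Lv \<mu> c m (B c m)))"
    and ab: "a \<in> N" "\<iota> (I \<mu> c m) \<le> \<iota> a" "b \<in> N" "\<iota> (I \<mu> c m) \<le> \<iota> b"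
  shows "\<bar>qv (c \<star> a \<star> m) - qv (c \<star> b \<star> m)\<bar> \<le> 2 * h m"
proof -
  define j where "j = Lv \<mu> c m (B c m)"
  define n where "n = I \<mu> c m"
  define v where "v = qv (c \<star> zer \<star> m) + \<iota> j * h m"
  have j: "j \<in> N" using \<mu> c m by (simp add: j_def)
  have n_eq: "n = \<mu> \<star> G c m j" using \<mu> c m by (simp add: n_def I_def index_c_def j_def numeral_2_eq_2)
  then have n: "n \<in> N" using \<mu> c m j by simp
  have inv: "(j = B c m \<or> \<not> attained \<mu> c m (Su j)) \<and> attained \<mu> c m j"
    unfolding j_def using \<mu> c m 0 by (intro Lv_invariant) simp_all
  \<comment> \<open>Attainment of \<open>j\<close> excludes \<open>j = B c m\<close>, so the climb
    ended because the next grid point failed the test.\<close>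
  then have "\<not> attained \<mu> c m (Su j)"
    using B_not_attained [OF c m n] n_eq by auto
  then have upper: "qv (c \<star> k \<star> m) < v + h m" if "k \<in> N" for k
    using next_level [of k] G_zero [of c m "Su j" k] that c m j
    by (fastforce simp: j_def [symmetric] v_def algebra_simps)
  have "v \<le> qv (c \<star> n \<star> m)"
    using inv G_zero [of c m j n] c m j n by (simp add: n_eq [symmetric] v_def)
  \<comment> \<open>Monotonicity of the reals makes their approximations monotone only up to
    \<open>h m\<close>; with the same slack above \<open>v\<close> this gives the distance
    \<open>2 * h m\<close>.\<close>
  then have lower: "v - h m \<le> qv (c \<star> k \<star> m)" if k: "k \<in> N" "\<iota> n \<le> \<iota> k" for k
  proof -
    have "mn n k = zer" using k n by simp
    then obtain l where "l \<in> N" "k = pl n l" using mn_eq_zer k n by blast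
    then show ?thesis using monob_le [OF c n _ m, of l] \<open>v \<le> _\<close> by simp
  qed
  show ?thesis
    using upper [OF ab(1)] upper [OF ab(3)] lower ab by (fastforce simp: n_def abs_le_iff)
qed

lemma MCT_rate_of_MU:
  assumes \<mu>: "\<mu> \<in> D ty2" "MU_at \<mu>"
  shows "MCT_rate (ev M [] rate_c \<star> \<mu>)"
  unfolding MCT_rate_def
proof (intro ballI impI, elim conjE)
  fix c k a b i
  assume c: "c \<in> D ty_seq" "monob c" and k: "k \<in> N" "k \<noteq> zer" and N: "a \<in> N" "b \<in> N" "i \<in> N"
    and ab: "\<iota> (ev M [] rate_c \<star> \<mu> \<star> c \<star> k) \<le> \<iota> a" "\<iota> (ev M [] rate_c \<star> \<mu> \<star> c \<star> k) \<le> \<iota> b"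
  \<comment> \<open>Three more binary digits: to \<open>2 * h ?m\<close> the two changes of
    precision add \<open>h ?m / 2 + h (Su i) / 2\<close>. The total
    \<open>5 * h k / 16 + h i / 4\<close> is below \<open>h k + h i\<close>.\<close>
  let ?m = "Su (Su (Su k))"
  have rate: "ev M [] rate_c \<star> \<mu> \<star> c \<star> k = I \<mu> c ?m"
    using \<mu> c k by (simp add: rate_c_def numeral_2_eq_2)
  have m: "?m \<in> N" using k by simp
  have att: "attained \<mu> c ?m j" if "j \<in> N" "n \<in> N" "G c ?m j \<star> n = zer" for j n
    using \<mu> that c m unfolding MU_at_def by (metis G_dom)
  have "attained \<mu> c ?m zer" using att [of zer zer] G_zero [of c ?m zer zer] c m by simp
  then have "\<bar>qv (c \<star> b \<star> ?m) - qv (c \<star> a \<star> ?m)\<bar> \<le> 2 * h ?m"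
    using att \<mu> c m N ab unfolding rate by (intro index_close) auto
  moreover have "\<bar>qv (c \<star> b \<star> ?m) - qv (c \<star> b \<star> Su i)\<bar> \<le> h ?m / 4 + h (Su i) / 4"
    "\<bar>qv (c \<star> a \<star> ?m) - qv (c \<star> a \<star> Su i)\<bar> \<le> h ?m / 4 + h (Su i) / 4"
    using c N m by (auto simp: monob_def simp del: h_Su intro!: real_close)
  moreover have "h ?m = h k / 8" "h (Su i) = h i / 2" "0 < h k" "0 < h i" using k N by auto
  moreover have "h k \<le> 1 / \<iota> k" using h_le k by blast
  ultimately show "\<bar>qv (c \<star> b \<star> Su i) - qv (c \<star> a \<star> Su i)\<bar> \<le> 1 / \<iota> k + h i"
    by linarith
qed

section \<open>Standard elements\<close>

definition ns_closeness :: bool where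
  "ns_closeness \<longleftrightarrow> (\<forall>c\<in>D ty_seq. std M ty_seq c \<longrightarrow> monob c \<longrightarrow>
    (\<forall>a\<in>N. \<forall>b\<in>N. \<not> std M Nt a \<and> \<not> std M Nt b \<longrightarrow>
      (\<forall>i\<in>N. std M Nt i \<longrightarrow> \<bar>qv (c \<star> b \<star> i) - qv (c \<star> a \<star> i)\<bar> \<le> h i)))"

lemma sat_MCT_ns: "sat M [] MCT_ns \<longleftrightarrow> ns_closeness"
  by (simp add: MCT_ns_def ns_closeness_def Forall_st_def real_approx_def numeral_2_eq_2)

definition trans_at :: "'v \<Rightarrow> bool" where
  "trans_at f \<longleftrightarrow> ((\<forall>n\<in>N. std M Nt n \<longrightarrow> f \<star> n \<noteq> zer) \<longrightarrow> (\<forall>n\<in>N. f \<star> n \<noteq> zer))"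

lemma sat_Pi01_TRANS: "sat M [] Pi01_TRANS \<longleftrightarrow> (\<forall>f\<in>D ty1. std M ty1 f \<longrightarrow> trans_at f)"
  by (simp add: Pi01_TRANS_def Forall_st_def trans_at_def)

end

section \<open>Models of the nonstandard system\<close>

locale nonstandard_field = arithmetic_field M UNIV T \<iota>
  for M :: "'v struct" and T and \<iota> :: "'v \<Rightarrow> 'k::linordered_field" +
  assumes P0_T: "P0_ax \<subseteq> T"
begin

lemma P0: "\<phi> \<in> P0_ax \<Longrightarrow> well_typed \<Gamma> \<phi> \<Longrightarrow> env M \<Gamma> e \<Longrightarrow> sat M e \<phi>"
  using P0_T axiom [of \<phi> \<Gamma>] by (auto simp: wff_def)

lemma st_closed: "typ_of [] t = Some \<sigma> \<Longrightarrow> std M \<sigma> (ev M [] t)"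
  using P0 [of "St \<sigma> t" "[]" "[]"] T_st.st_closed [of t \<sigma>] by (auto simp: P0_ax_def closed_tm_def)

lemma st_app:
  "std M (\<sigma> \<Rrightarrow> \<tau>) f \<Longrightarrow> std M \<sigma> x \<Longrightarrow> f \<in> D (\<sigma> \<Rrightarrow> \<tau>) \<Longrightarrow> x \<in> D \<sigma> \<Longrightarrow> std M \<tau> (f \<star> x)"
  using P0 [of "Imp (Con (St (\<sigma> \<Rrightarrow> \<tau>) (Var 0)) (St \<sigma> (Var 1))) (St \<tau> (Var 0 \<cdot> Var 1))"
      "[\<sigma> \<Rrightarrow> \<tau>, \<sigma>]" "[f, x]"] T_st.st_app [of \<sigma> \<tau> "Var 0" "Var 1"]
  by (auto simp: P0_ax_def)

text \<open>The main source of standard objects: a construction written as a term takes standard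
  arguments to standard values, because constants are standard and application preserves
  standardness.\<close>

lemma st_term:
  assumes "typ_of \<Gamma> t = Some \<sigma>" "env M \<Gamma> e" "list_all2 (std M) \<Gamma> e"
  shows "std M \<sigma> (ev M e t)"
  using assms(1)
proof (induction t arbitrary: \<sigma>)
  case (Var n)
  then show ?case using assms(3) by (auto simp: list_all2_conv_all_nth split: if_splits)
next
  case (Cst c)
  then show ?case using st_closed [of "Cst c"] by simp
next
  case (App s t)
  then show ?case unfolding typ_of_App ev.simps using st_app ev_dom assms(2) by blast
qed

lemma trans_of_closeness:
  assumes ns_closeness "f \<in> D ty1" "std M ty1 f"
  shows "trans_at f"
  unfolding trans_at_def
proof (intro impI ballI notI)
  fix n assume st: "\<forall>n\<in>N. std M Nt n \<longrightarrow> f \<star> n \<noteq> zer" and n: "n \<in> N" "f \<star> n = zer"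
  define b where "b = W f n"
  have b: "b \<in> N" "f \<star> b = zer"
    using assms n W_found [of f n zer] by (simp_all add: b_def)
  \<comment> \<open>\<open>b\<close> is a zero not beyond \<open>n\<close>. The search up to
    \<open>b\<close> therefore ends at a zero, and by persistence its result agrees with that of the
    search up to \<open>n\<close>, which is \<open>b\<close>.\<close>
  have "W f b = b"
  proof -
    obtain z where "z \<in> N" "n = pl b z"
      using W_le [of f n] assms n mn_zer_iff [of b n] b mn_eq_zer [of b n] by (auto simp: b_def)
    moreover have "f \<star> W f b = zer" using W_found [of f b zer] b assms by simp
    ultimately show ?thesis using W_persist [of f b z] assms b by (simp add: b_def)
  qed
  have "b \<noteq> zer" using st st_closed [of Z Nt] b by auto
  then obtain a where a: "a \<in> N" "b = Su a" using N_cases [of b] b by (metis pr_N)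
  have nst_b: "\<not> std M Nt b" using st b by blast
  have nst_a: "\<not> std M Nt a"
    using st_term [of "[Nt]" "Sc (Var 0)" Nt "[a]"] nst_b a by auto
  have fa: "f \<star> W f a \<noteq> zer"
  proof
    assume "f \<star> W f a = zer"
    then have "W f b = W f a" using W_rec(2) [of f a] a assms by simp
    then have "\<iota> b \<le> \<iota> a" using \<open>W f b = b\<close> W_le [of f a] a assms by simp
    then show False using a by simp
  qed
  have "std M ty_seq (J f)"
    using st_term [of "[ty1]" "jump_c \<cdot> Var 0" ty_seq "[f]"] assms by simp
  \<comment> \<open>Precision 1 separates 0 from 1, the bound being 1/2; at precision 0 the bound is
    1 and there is no contradiction.\<close>
  moreover have one: "Su zer \<in> N" "std M Nt (Su zer)"
    using st_closed [of "Sc Z" Nt] by simp_all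
  ultimately have "\<bar>qv (J f \<star> b \<star> Su zer) - qv (J f \<star> a \<star> Su zer)\<bar> \<le> h (Su zer)"
    using assms(1,2) nst_a nst_b a(1) b(1) unfolding ns_closeness_def by (meson J_dom monob_J)
  then show False
    using a(1) b fa one(1) assms(2) \<open>W f b = b\<close> by simp
qed

text \<open>A standard \<open>f\<close> with a zero has a standard one by transfer, and 0 serves if
  it has none. \<open>HAC_int\<close> only gives a finite sequence of candidates, but whether a
  candidate is a zero of \<open>f\<close> is decidable, so the first good one can be searched
  for.\<close>

lemma standard_MU:
  assumes "\<forall>f\<in>D ty1. std M ty1 f \<longrightarrow> trans_at f"
  obtains \<mu> where "\<mu> \<in> D ty2" "std M ty2 \<mu>"
    "\<And>f n. f \<in> D ty1 \<Longrightarrow> std M ty1 f \<Longrightarrow> n \<in> N \<Longrightarrow> f \<star> n = zer \<Longrightarrow> f \<star> (\<mu> \<star> f) = zer"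
proof -
  \<comment> \<open>Outside the inner quantifier variable 0 is the candidate and variable 1 is
    \<open>f\<close>. The quantifier is harmless, as \<open>HAC_int\<close> asks for an internal
    formula only.\<close>
  let ?\<phi> = "Imp (Exists Nt (Equ (Var 2 \<cdot> Var 0) Z)) (Equ (Var 1 \<cdot> Var 0) Z)"
  have "Imp (Forall_st ty1 (Exists_st Nt ?\<phi>))
      (Exists_st (ty1 \<Rrightarrow> SeqT Nt) (Forall_st ty1 (Exists Nt
         (Con (Mem Nt (Var 0) (Var 2 \<cdot> Var 1)) (weaken2 ?\<phi>))))) \<in> P0_ax" (is "?ax \<in> _")
    unfolding P0_ax_def HAC_int_def by (fastforce simp: numeral_2_eq_2)
  moreover have "well_typed [] ?ax"
    by (simp add: Forall_st_def Exists_st_def Mem_def weaken2_def numeral_2_eq_2)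
  ultimately have "sat M [] ?ax" by (rule P0) simp
  moreover have "sat M [] (Forall_st ty1 (Exists_st Nt ?\<phi>))"
  proof -
    have "\<exists>y\<in>N. std M Nt y \<and> ((\<exists>n\<in>N. f \<star> n = zer) \<longrightarrow> f \<star> y = zer)"
      if "f \<in> D ty1" "std M ty1 f" for f
      using assms that st_closed [of Z Nt] unfolding trans_at_def by (metis ev.simps(2) typ_of_zero_tm zer_N zero_tm.simps(1))
    then show ?thesis by (simp add: Forall_st_def Exists_st_def numeral_2_eq_2)
  qed
  ultimately have "sat M [] (Exists_st (ty1 \<Rrightarrow> SeqT Nt) (Forall_st ty1 (Exists Nt
         (Con (Mem Nt (Var 0) (Var 2 \<cdot> Var 1)) (weaken2 ?\<phi>)))))" by simp
  then obtain F where F: "F \<in> D (ty1 \<Rrightarrow> SeqT Nt)" "std M (ty1 \<Rrightarrow> SeqT Nt) F"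
    and mem: "\<And>f. f \<in> D ty1 \<Longrightarrow> std M ty1 f \<Longrightarrow>
      \<exists>y\<in>N. (\<exists>i\<in>N. mn (Su i) (cst M (LenC Nt) \<star> (F \<star> f)) = zer \<and> y = cst M (ProjC Nt) \<star> (F \<star> f) \<star> i) \<and>
        ((\<exists>n\<in>N. f \<star> n = zer) \<longrightarrow> f \<star> y = zer)"
    by (auto simp: Forall_st_def Exists_st_def Mem_def weaken2_def Lt_def Le_def numeral_2_eq_2)
  define \<mu> where "\<mu> = ev M [] search_seq_c \<star> F"
  show thesis
  proof
    show "\<mu> \<in> D ty2"
      using ev_dom [of "[ty1 \<Rrightarrow> SeqT Nt]" "[F]" "search_seq_c \<cdot> Var 0" ty2] F by (simp add: \<mu>_def)
    show "std M ty2 \<mu>"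
      using st_term [of "[ty1 \<Rrightarrow> SeqT Nt]" "search_seq_c \<cdot> Var 0" ty2 "[F]"] F by (simp add: \<mu>_def)
    fix f n assume f: "f \<in> D ty1" "std M ty1 f" and n: "n \<in> N" "f \<star> n = zer"
    define s where "s = F \<star> f"
    define l where "l = cst M (LenC Nt) \<star> s"
    have s: "s \<in> D (SeqT Nt)" using app_dom F f by (simp add: s_def)
    have l: "l \<in> N" using app_dom [OF _ s] cst_dom [of "LenC Nt"] by (simp add: l_def)
    have p: "cst M (ProjC Nt) \<star> s \<star> i \<in> N" if "i \<in> N" for i
      using app_dom [OF app_dom [OF _ s] that] cst_dom [of "ProjC Nt"] by simp
    define g where "g = ev M [] (lam [Nt, ty1, SeqT Nt] (Var 1 \<cdot> (Cst (ProjC Nt) \<cdot> Var 2 \<cdot> Var 0))) \<star> s \<star> f"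
    have g: "g \<in> D ty1"
    proof -
      have "ev M [] (lam [Nt, ty1, SeqT Nt] (Var 1 \<cdot> (Cst (ProjC Nt) \<cdot> Var 2 \<cdot> Var 0))) \<in> D (SeqT Nt \<Rrightarrow> ty1 \<Rrightarrow> ty1)"
        by (rule ev_dom [of "[]"]) (simp_all add: numeral_2_eq_2)
      then show ?thesis unfolding g_def using app_dom s f by blast
    qed
    have g_app: "g \<star> i = f \<star> (cst M (ProjC Nt) \<star> s \<star> i)" if "i \<in> N" for i
      using s f that by (simp add: g_def numeral_2_eq_2)
    have \<mu>f: "\<mu> \<star> f = cst M (ProjC Nt) \<star> s \<star> W g l"
      using F f by (simp add: \<mu>_def search_seq_c_def Let_def g_def s_def l_def numeral_2_eq_2)
    obtain i where i: "i \<in> N" "mn (Su i) l = zer" "f \<star> (cst M (ProjC Nt) \<star> s \<star> i) = zer"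
      using mem [OF f] n by (auto simp: s_def l_def)
    obtain z where "z \<in> N" "l = pl (Su i) z" using mn_eq_zer [of "Su i" l] i l by auto
    \<comment> \<open>The position \<open>i\<close> of a good candidate is below the length, so the
      search up to the length passes it.\<close>
    then have "l = pl i (Su z)" using i by simp
    moreover have "g \<star> i = zer" using i g_app by simp
    ultimately have "g \<star> W g l = zer" using W_found [of g i "Su z"] g i \<open>z \<in> N\<close> by simp
    then show "f \<star> (\<mu> \<star> f) = zer" using g_app [of "W g l"] g l by (simp add: \<mu>f)
  qed
qed

text \<open>The data of the grid argument are values of terms at \<open>\<mu>\<close>,
  \<open>c\<close> and \<open>i\<close>, hence standard; so \<open>\<mu>\<close> is correct where
  \<open>index_close\<close> asks for it, and the index obtained is standard.\<close>

lemma closeness_of_trans: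
  assumes trans: "\<forall>f\<in>D ty1. std M ty1 f \<longrightarrow> trans_at f"
    and down: "\<And>a b. a \<in> N \<Longrightarrow> b \<in> N \<Longrightarrow> std M Nt a \<Longrightarrow> \<iota> b \<le> \<iota> a \<Longrightarrow> std M Nt b"
  shows ns_closeness
  unfolding ns_closeness_def
proof (intro ballI impI, elim conjE)
  fix c a b i
  assume c: "c \<in> D ty_seq" "monob c" "std M ty_seq c" and N: "a \<in> N" "b \<in> N" "i \<in> N"
    and nst: "\<not> std M Nt a" "\<not> std M Nt b" and st_i: "std M Nt i"
  obtain \<mu> where \<mu>: "\<mu> \<in> D ty2" "std M ty2 \<mu>"
    and search: "\<And>f n. f \<in> D ty1 \<Longrightarrow> std M ty1 f \<Longrightarrow> n \<in> N \<Longrightarrow> f \<star> n = zer \<Longrightarrow> f \<star> (\<mu> \<star> f) = zer"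
    using standard_MU [OF trans] by blast
  \<comment> \<open>The comparison is at precision \<open>i\<close> itself:
    \<open>2 * h ?m + h ?m / 2 + h i / 2\<close> equals \<open>13 * h i / 16\<close>.\<close>
  let ?m = "Su (Su (Su i))" and ?e = "[\<mu>, c, i]" and ?\<Gamma> = "[ty2, ty_seq, Nt]"
  let ?tm = "Sc (Sc (Sc (Var 2)))"
  have e: "env M ?\<Gamma> ?e" "list_all2 (std M) ?\<Gamma> ?e" using \<mu> c N st_i by simp_all
  have m: "?m \<in> N" using N by simp
  have att: "attained \<mu> c ?m j" if "j \<in> N" "std M Nt j" "n \<in> N" "G c ?m j \<star> n = zer" for j n
  proof (rule search)
    show "std M ty1 (G c ?m j)"
      using st_term [of "[ty_seq, Nt, Nt]" "above_c \<cdot> Var 0 \<cdot> Sc (Sc (Sc (Var 1))) \<cdot> Var 2" ty1 "[c, i, j]"]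
        that c N st_i by (simp add: numeral_2_eq_2)
  qed (use that c m in auto)
  let ?t = "level_c \<cdot> Var 0 \<cdot> Var 1 \<cdot> ?tm \<cdot> (bound_c \<cdot> Var 1 \<cdot> ?tm)"
  have "std M Nt (ev M ?e (Sc ?t))" "std M Nt (ev M ?e (index_c \<cdot> Var 0 \<cdot> Var 1 \<cdot> ?tm))"
    by (rule st_term [OF _ e]; simp add: numeral_2_eq_2)+
  then have st: "std M Nt (Su (Lv \<mu> c ?m (B c ?m)))" "std M Nt (I \<mu> c ?m)"
    by (simp_all add: numeral_2_eq_2)
  have "I \<mu> c ?m \<in> N"
    using ev_dom [OF e(1), of "index_c \<cdot> Var 0 \<cdot> Var 1 \<cdot> ?tm" Nt] by (simp add: numeral_2_eq_2)
  \<comment> \<open>A nonstandard number below the standard index would be standard by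
    \<open>down\<close>.\<close>
  then have above: "\<iota> (I \<mu> c ?m) \<le> \<iota> a" "\<iota> (I \<mu> c ?m) \<le> \<iota> b"
    using down st N nst by (meson linear)+
  have "attained \<mu> c ?m zer"
    using att [of zer zer] G_zero [of c ?m zer zer] c m st_closed [of Z Nt] by simp
  then have "\<bar>qv (c \<star> b \<star> ?m) - qv (c \<star> a \<star> ?m)\<bar> \<le> 2 * h ?m"
    using att [OF _ st(1)] \<mu> c m N above by (intro index_close) auto
  moreover have "\<bar>qv (c \<star> b \<star> ?m) - qv (c \<star> b \<star> i)\<bar> \<le> h ?m / 4 + h i / 4"
    "\<bar>qv (c \<star> a \<star> ?m) - qv (c \<star> a \<star> i)\<bar> \<le> h ?m / 4 + h i / 4"
    using c N m by (auto simp: monob_def simp del: h_Su intro!: real_close)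
  moreover have "h ?m = h i / 8" "0 < h i" using N by auto
  ultimately show "\<bar>qv (c \<star> b \<star> i) - qv (c \<star> a \<star> i)\<bar> \<le> h i"
    by linarith
qed

end

section \<open>The ordered field of a countermodel\<close>

text \<open>
  The numbers of a model have to form a type for the construction of their field of fractions.  As a type
  cannot depend on a model, one structure is fixed in advance: the numbers of a countermodel to one of
  the three claims if there is one, and the natural numbers otherwise.
\<close>

definition claims :: "(fm set \<times> fm set \<times> fm) set" where
  "claims =
    {(UNIV, P0_ax, Imp MCT_ns Pi01_TRANS),
     (UNIV, P0_ax \<union> {st_downward}, Iff MCT_ns Pi01_TRANS),
     (Collect internal, EPRA_ax,
        Con (Forall ty2 (Imp (MU (Var 0)) (MCT_ef (rate_c \<cdot> Var 0))))
          (Forall ty_rate (Imp (MCT_ef (Var 0)) (MU (zero_of_rate_c \<cdot> Var 0)))))}"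

definition countermodel :: "nat struct \<Rightarrow> bool" where
  "countermodel M \<longleftrightarrow> (\<exists>(L, T, \<chi>)\<in>claims. model M L T \<and> \<not> sat M [] \<chi>)"

type_synonym 'v semiring_struct = "'v set \<times> ('v \<Rightarrow> 'v \<Rightarrow> 'v) \<times> ('v \<Rightarrow> 'v \<Rightarrow> 'v) \<times> 'v \<times> 'v"

text \<open>The laws that make the differences an ordered integral domain: cancellation for the
  embedding, totality and the absence of negatives for the linear order, the absence of zero
  divisors for strict monotonicity of products.\<close>

definition is_semiring :: "'v semiring_struct \<Rightarrow> bool" where
  "is_semiring = (\<lambda>(A, p, t, z, u). z \<in> A \<and> u \<in> A \<and> z \<noteq> u \<and>
    (\<forall>x\<in>A. p z x = x \<and> t u x = x \<and> t z x = z) \<and>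
    (\<forall>x\<in>A. \<forall>y\<in>A. p x y \<in> A \<and> t x y \<in> A \<and> p x y = p y x \<and> t x y = t y x \<and>
      (p x y = z \<longrightarrow> x = z) \<and> (t x y = z \<longrightarrow> x = z \<or> y = z) \<and>
      (\<exists>w\<in>A. y = p x w \<or> x = p y w)) \<and>
    (\<forall>x\<in>A. \<forall>y\<in>A. \<forall>w\<in>A. p (p x y) w = p x (p y w) \<and> t (t x y) w = t x (t y w) \<and>
      t (p x y) w = p (t x w) (t y w) \<and> (p x w = p y w \<longrightarrow> x = y)))"

definition nat_part :: "nat struct \<Rightarrow> nat semiring_struct" where
  "nat_part M = (dom M Nt, arithmetic.pl M, arithmetic.ml M, cst M ZeroC,
    app M (cst M SuccC) (cst M ZeroC))"

lemma (in arithmetic) is_semiring_N: "is_semiring (N, pl, ml, zer, Su zer)"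
proof -
  have "ml (Su zer) x = x" if "x \<in> N" for x using that ml_Su_left [of zer x] by simp
  moreover have "ml (pl x y) w = pl (ml x w) (ml y w)" if "x \<in> N" "y \<in> N" "w \<in> N" for x y w
    using that ml_pl [of w x y] by (simp add: ml_comm [of _ w])
  ultimately show ?thesis
    unfolding is_semiring_def prod.case
    by (intro conjI ballI impI)
      (simp_all add: pl_cancel pl_assoc ml_assoc N_total ml_eq_zer,
        (rule pl_comm ml_comm pl_eq_zer; assumption)+)
qed

lemma claims_arithmetic:
  assumes "(L, T, \<chi>) \<in> claims" "model M L T"
  shows "arithmetic M L T"
proof -
  have "language L" "EPRA_ax \<subseteq> T"
    using assms language_UNIV language_internal by (auto simp: claims_def P0_ax_def)
  then show ?thesis
    using assms(2) by (simp add: arithmetic_def arithmetic_axioms_def)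
qed

lemma nat_structure_exists:
  "\<exists>S. is_semiring S \<and> ((\<exists>M. countermodel M) \<longrightarrow> (\<exists>M. countermodel M \<and> S = nat_part M))"
proof (cases "\<exists>M. countermodel M")
  case True
  then obtain M where M: "countermodel M" by blast
  then obtain L T \<chi> where *: "(L, T, \<chi>) \<in> claims" "model M L T"
    by (auto simp: countermodel_def)
  interpret arithmetic M L T using * by (rule claims_arithmetic)
  have "is_semiring (nat_part M)" using is_semiring_N by (simp add: nat_part_def)
  then show ?thesis using M by blast
next
  case False
  have "is_semiring (UNIV, (+), (*), 0, 1 :: nat)"
    by (auto simp: is_semiring_def algebra_simps) (metis le_Suc_ex nat_le_linear)
  then show ?thesis using False by blast
qed

definition nat_structure :: "nat semiring_struct" where
  "nat_structure = (SOME S. is_semiring S \<and>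
    ((\<exists>M. countermodel M) \<longrightarrow> (\<exists>M. countermodel M \<and> S = nat_part M)))"

lemma nat_structure:
  "is_semiring nat_structure"
  "countermodel M \<Longrightarrow> \<exists>M. countermodel M \<and> nat_structure = nat_part M"
  using someI_ex [OF nat_structure_exists] unfolding nat_structure_def by blast+

abbreviation "nA \<equiv> fst nat_structure"
abbreviation "nP \<equiv> fst (snd nat_structure)"
abbreviation "nT \<equiv> fst (snd (snd nat_structure))"
abbreviation "nZ \<equiv> fst (snd (snd (snd nat_structure)))"
abbreviation "nU \<equiv> snd (snd (snd (snd nat_structure)))"

lemma nat_laws:
  shows "nZ \<in> nA" "nU \<in> nA" "nZ \<noteq> nU"
    and "x \<in> nA \<Longrightarrow> nP nZ x = x" "x \<in> nA \<Longrightarrow> nT nU x = x" "x \<in> nA \<Longrightarrow> nT nZ x = nZ"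
    and "x \<in> nA \<Longrightarrow> y \<in> nA \<Longrightarrow> nP x y \<in> nA" "x \<in> nA \<Longrightarrow> y \<in> nA \<Longrightarrow> nT x y \<in> nA"
    and "x \<in> nA \<Longrightarrow> y \<in> nA \<Longrightarrow> nP x y = nP y x" "x \<in> nA \<Longrightarrow> y \<in> nA \<Longrightarrow> nT x y = nT y x"
    and "x \<in> nA \<Longrightarrow> y \<in> nA \<Longrightarrow> nP x y = nZ \<Longrightarrow> x = nZ"
    and "x \<in> nA \<Longrightarrow> y \<in> nA \<Longrightarrow> nT x y = nZ \<Longrightarrow> x = nZ \<or> y = nZ"
    and "x \<in> nA \<Longrightarrow> y \<in> nA \<Longrightarrow> \<exists>w\<in>nA. y = nP x w \<or> x = nP y w"
    and "x \<in> nA \<Longrightarrow> y \<in> nA \<Longrightarrow> w \<in> nA \<Longrightarrow> nP (nP x y) w = nP x (nP y w)"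
    and "x \<in> nA \<Longrightarrow> y \<in> nA \<Longrightarrow> w \<in> nA \<Longrightarrow> nT (nT x y) w = nT x (nT y w)"
    and "x \<in> nA \<Longrightarrow> y \<in> nA \<Longrightarrow> w \<in> nA \<Longrightarrow> nT (nP x y) w = nP (nT x w) (nT y w)"
    and "x \<in> nA \<Longrightarrow> y \<in> nA \<Longrightarrow> w \<in> nA \<Longrightarrow> nP x w = nP y w \<Longrightarrow> x = y"
proof -
  have "is_semiring (nA, nP, nT, nZ, nU)" using nat_structure(1) by simp
  note S = this [unfolded is_semiring_def prod.case]
  show "nZ \<in> nA" "nU \<in> nA" "nZ \<noteq> nU"
    "x \<in> nA \<Longrightarrow> nP nZ x = x" "x \<in> nA \<Longrightarrow> nT nU x = x" "x \<in> nA \<Longrightarrow> nT nZ x = nZ"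
    "x \<in> nA \<Longrightarrow> y \<in> nA \<Longrightarrow> nP x y \<in> nA" "x \<in> nA \<Longrightarrow> y \<in> nA \<Longrightarrow> nT x y \<in> nA"
    "x \<in> nA \<Longrightarrow> y \<in> nA \<Longrightarrow> nP x y = nP y x" "x \<in> nA \<Longrightarrow> y \<in> nA \<Longrightarrow> nT x y = nT y x"
    "x \<in> nA \<Longrightarrow> y \<in> nA \<Longrightarrow> nP x y = nZ \<Longrightarrow> x = nZ"
    "x \<in> nA \<Longrightarrow> y \<in> nA \<Longrightarrow> nT x y = nZ \<Longrightarrow> x = nZ \<or> y = nZ"
    "x \<in> nA \<Longrightarrow> y \<in> nA \<Longrightarrow> \<exists>w\<in>nA. y = nP x w \<or> x = nP y w"
    "x \<in> nA \<Longrightarrow> y \<in> nA \<Longrightarrow> w \<in> nA \<Longrightarrow> nP (nP x y) w = nP x (nP y w)"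
    "x \<in> nA \<Longrightarrow> y \<in> nA \<Longrightarrow> w \<in> nA \<Longrightarrow> nT (nT x y) w = nT x (nT y w)"
    "x \<in> nA \<Longrightarrow> y \<in> nA \<Longrightarrow> w \<in> nA \<Longrightarrow> nT (nP x y) w = nP (nT x w) (nT y w)"
    "x \<in> nA \<Longrightarrow> y \<in> nA \<Longrightarrow> w \<in> nA \<Longrightarrow> nP x w = nP y w \<Longrightarrow> x = y"
    using S by blast+
qed

section \<open>Ring of differences\<close>

typedef mnat = nA
  using nat_laws(1) by blast

setup_lifting type_definition_mnat

instantiation mnat :: comm_semiring_1
begin

lift_definition plus_mnat :: "mnat \<Rightarrow> mnat \<Rightarrow> mnat" is nP by (rule nat_laws)
lift_definition times_mnat :: "mnat \<Rightarrow> mnat \<Rightarrow> mnat" is nT by (rule nat_laws)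
lift_definition zero_mnat :: mnat is nZ by (rule nat_laws)
lift_definition one_mnat :: mnat is nU by (rule nat_laws)

instance
proof
  fix a b c :: mnat
  show "a + b + c = a + (b + c)" "a + b = b + a" "0 + a = a" "a * b * c = a * (b * c)"
    "a * b = b * a" "1 * a = a" "(a + b) * c = a * c + b * c" "0 * a = 0"
    "(0::mnat) \<noteq> 1"
    by (transfer, rule nat_laws; assumption)+
  show "a * 0 = 0" by transfer (metis nat_laws(1,6,10))
qed

end

lemma mnat_add_right_cancel: "a + c = b + c \<Longrightarrow> a = b" for a b c :: mnat
  by transfer (rule nat_laws(17))

lemma mnat_add_eq_0: "a + b = 0 \<Longrightarrow> a = 0" for a b :: mnat
  by transfer (rule nat_laws(11))

lemma mnat_mult_eq_0: "a * b = 0 \<Longrightarrow> a = 0 \<or> b = 0" for a b :: mnat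
  by transfer (rule nat_laws(12))

lemma mnat_total: "\<exists>w. b = a + w \<or> a = b + w" for a b :: mnat
  by transfer (simp add: nat_laws(13))

instance mnat :: cancel_semigroup_add
  by standard (metis mnat_add_right_cancel add.commute)+

definition diffrel :: "mnat \<times> mnat \<Rightarrow> mnat \<times> mnat \<Rightarrow> bool" where
  "diffrel = (\<lambda>(x, y) (u, v). x + v = u + y)"

quotient_type mint = "mnat \<times> mnat" / diffrel
  morphisms rep_mint mk_mint
proof (rule equivpI)
  show "reflp diffrel" by (auto simp: reflp_def diffrel_def)
  show "symp diffrel" by (auto simp: symp_def diffrel_def)
  show "transp diffrel"
  proof (rule transpI, clarsimp simp: diffrel_def)
    fix a b c d e f :: mnat
    assume "a + d = c + b" "c + f = e + d"
    then have "(a + f) + (c + d) = (e + b) + (c + d)" by (metis add.assoc add.commute)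
    then show "a + f = e + b" by (rule add_right_imp_eq)
  qed
qed

instantiation mint :: comm_ring_1
begin

lift_definition zero_mint :: mint is "(0, 0)" .
lift_definition one_mint :: mint is "(1, 0)" .
lift_definition plus_mint :: "mint \<Rightarrow> mint \<Rightarrow> mint" is "\<lambda>(x, y) (u, v). (x + u, y + v)"
  unfolding diffrel_def by clarsimp (metis add.assoc add.commute)
lift_definition uminus_mint :: "mint \<Rightarrow> mint" is "\<lambda>(x, y). (y, x)"
  unfolding diffrel_def by clarsimp (metis add.commute)
lift_definition minus_mint :: "mint \<Rightarrow> mint \<Rightarrow> mint" is "\<lambda>(x, y) (u, v). (x + v, y + u)"
  unfolding diffrel_def by clarsimp (metis add.assoc add.commute)
lift_definition times_mint :: "mint \<Rightarrow> mint \<Rightarrow> mint"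
  is "\<lambda>(x, y) (u, v). (x * u + y * v, x * v + y * u)"
proof (unfold diffrel_def, clarify)
  fix s t u v w x y z :: mnat
  assume 1: "s + v = u + t" and 2: "w + z = y + x"
  \<comment> \<open>The padding \<open>v * w + u * x\<close> lets the first hypothesis act on
    multiples of \<open>w\<close> and \<open>x\<close>, then the second on multiples of
    \<open>u\<close> and \<open>v\<close>; it is cancelled at the end.\<close>
  have "(s * w + t * x + (u * z + v * y)) + (v * w + u * x) =
    (s + v) * w + (u + t) * x + u * z + v * y" by (simp add: algebra_simps)
  also have "\<dots> = (u + t) * w + (s + v) * x + u * z + v * y" by (simp add: 1)
  also have "\<dots> = u * (w + z) + v * (y + x) + (t * w + s * x)" by (simp add: algebra_simps)
  also have "\<dots> = u * (y + x) + v * (w + z) + (t * w + s * x)" by (simp add: 2)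
  also have "\<dots> = (u * y + v * z + (s * x + t * w)) + (v * w + u * x)" by (simp add: algebra_simps)
  finally show "s * w + t * x + (u * z + v * y) = u * y + v * z + (s * x + t * w)"
    by (rule add_right_imp_eq)
qed

instance
  by standard (transfer; clarsimp simp: algebra_simps diffrel_def)+

end

definition emb :: "mnat \<Rightarrow> mint" where "emb n = mk_mint (n, 0)"

lemma emb_hom [simp]:
  "emb 0 = 0" "emb 1 = 1" "emb (a + b) = emb a + emb b" "emb (a * b) = emb a * emb b"
  by (simp_all add: emb_def zero_mint_def one_mint_def plus_mint.abs_eq times_mint.abs_eq)

lemma emb_eq [simp]: "emb a = emb b \<longleftrightarrow> a = b"
  by (simp add: emb_def mint.abs_eq_iff diffrel_def)

lemma emb_eq_0 [simp]: "emb a = 0 \<longleftrightarrow> a = 0"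
  using emb_eq [of a 0] by simp

text \<open>By totality one part of a difference can be subtracted from the other; linearity of the
  order rests on this.\<close>

lemma mint_cases: "\<exists>w. x = emb w \<or> x = - emb w"
proof -
  have "\<exists>a b. x = emb a - emb b"
    by (induct x rule: mint.abs_induct) (auto simp: emb_def minus_mint.abs_eq)
  then obtain a b where x: "x = emb a - emb b" by blast
  obtain w where "b = a + w \<or> a = b + w" using mnat_total by blast
  then show ?thesis using x by (intro exI [of _ w]) auto
qed

instantiation mint :: linordered_idom
begin

definition less_eq_mint :: "mint \<Rightarrow> mint \<Rightarrow> bool" where "(x :: mint) \<le> y \<longleftrightarrow> (\<exists>w. y = x + emb w)"
definition less_mint :: "mint \<Rightarrow> mint \<Rightarrow> bool" where "(x :: mint) < y \<longleftrightarrow> x \<le> y \<and> \<not> y \<le> x"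
definition abs_mint :: "mint \<Rightarrow> mint" where "\<bar>x :: mint\<bar> = (if x < 0 then - x else x)"
definition sgn_mint :: "mint \<Rightarrow> mint" where "sgn (x :: mint) = (if x = 0 then 0 else if 0 < x then 1 else - 1)"

instance
proof
  fix x y z :: mint
  have less: "x < y \<longleftrightarrow> (\<exists>w. w \<noteq> 0 \<and> y = x + emb w)" for x y :: mint
  proof
    assume "x < y"
    then obtain w where "y = x + emb w" "\<not> y \<le> x" by (auto simp: less_mint_def less_eq_mint_def)
    moreover from this have "w \<noteq> 0" using less_eq_mint_def by (metis add.right_neutral emb_hom(1))
    ultimately show "\<exists>w. w \<noteq> 0 \<and> y = x + emb w" by blast
  next
    assume "\<exists>w. w \<noteq> 0 \<and> y = x + emb w"
    then obtain w where w: "w \<noteq> 0" "y = x + emb w" by blast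
    \<comment> \<open>Going up by \<open>w\<close> and then by \<open>v\<close> and being back at
      \<open>x\<close> means \<open>w + v = 0\<close>, which forces \<open>w = 0\<close>.\<close>
    have "x \<noteq> y + emb v" for v
    proof
      assume "x = y + emb v"
      then have "emb (w + v) = 0" using w by (simp add: add.assoc)
      then show False using w mnat_add_eq_0 by (metis emb_eq_0)
    qed
    then show "x < y" using w by (auto simp: less_mint_def less_eq_mint_def)
  qed
  show "x < y \<longleftrightarrow> x \<le> y \<and> \<not> y \<le> x" by (rule less_mint_def)
  show "x \<le> x" by (auto simp: less_eq_mint_def intro!: exI [of _ 0])
  show "x \<le> y \<Longrightarrow> y \<le> z \<Longrightarrow> x \<le> z"
    unfolding less_eq_mint_def by (metis add.assoc emb_hom(3))
  show "x \<le> y \<Longrightarrow> y \<le> x \<Longrightarrow> x = y"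
    using less less_mint_def unfolding less_eq_mint_def by (metis add.right_neutral emb_eq_0)
  show "x \<le> y \<or> y \<le> x"
  proof -
    obtain w where "y - x = emb w \<or> y - x = - emb w" using mint_cases by blast
    then have "y = x + emb w \<or> x = y + emb w" by (auto simp: algebra_simps)
    then show ?thesis by (auto simp: less_eq_mint_def)
  qed
  show "x \<le> y \<Longrightarrow> z + x \<le> z + y"
    by (auto simp: less_eq_mint_def add.assoc)
  show "x < y \<Longrightarrow> 0 < z \<Longrightarrow> z * x < z * y"
  proof -
    assume "x < y" "0 < z"
    then obtain w v where "w \<noteq> 0" "y = x + emb w" "v \<noteq> 0" "z = emb v"
      unfolding less by auto
    then have "v * w \<noteq> 0" "z * y = z * x + emb (v * w)"
      using mnat_mult_eq_0 by (auto simp: algebra_simps)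
    then show ?thesis unfolding less by blast
  qed
  show "\<bar>x\<bar> = (if x < 0 then - x else x)" by (rule abs_mint_def)
  show "sgn x = (if x = 0 then 0 else if 0 < x then 1 else - 1)" by (rule sgn_mint_def)
qed

end

section \<open>Embedding of the chosen numbers into the field of fractions\<close>

definition to_field :: "nat \<Rightarrow> mint fract" where
  "to_field x = Fract (emb (Abs_mnat x)) 1"

lemma arithmetic_field_countermodel:
  assumes "arithmetic M L T" "nat_structure = nat_part M"
  shows "arithmetic_field M L T to_field"
proof -
  interpret arithmetic M L T by fact
  have S: "nat_structure = (N, pl, ml, zer, Su zer)" using assms(2) by (simp add: nat_part_def)
  have abs: "Rep_mnat (Abs_mnat x) = x" if "x \<in> N" for x
    using that by (intro Abs_mnat_inverse) (simp add: S)
  have hom: "Abs_mnat zer = 0" "Abs_mnat (Su zer) = 1"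
    "x \<in> N \<Longrightarrow> y \<in> N \<Longrightarrow> Abs_mnat (pl x y) = Abs_mnat x + Abs_mnat y"
    "x \<in> N \<Longrightarrow> y \<in> N \<Longrightarrow> Abs_mnat (ml x y) = Abs_mnat x * Abs_mnat y"
    for x y
    by (simp_all add: zero_mnat_def one_mnat_def plus_mnat_def times_mnat_def S abs)
  show ?thesis
  proof
    show "to_field zer = 0" by (simp add: to_field_def hom Zero_fract_def)
    show "to_field (Su x) = to_field x + 1" if "x \<in> N" for x
    proof -
      have "Su x = pl x (Su zer)" using that by simp
      then show ?thesis using that hom(3) [of x "Su zer"] by (simp add: to_field_def hom One_fract_def)
    qed
    show "to_field (pl x y) = to_field x + to_field y" if "x \<in> N" "y \<in> N" for x y
      using that by (simp add: to_field_def hom)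
    show "to_field (ml x y) = to_field x * to_field y" if "x \<in> N" "y \<in> N" for x y
      using that by (simp add: to_field_def hom)
    show "0 \<le> to_field x" for x
      by (auto simp: to_field_def zero_le_Fract_iff less_eq_mint_def)
    show "to_field x = to_field y \<longleftrightarrow> x = y" if "x \<in> N" "y \<in> N" for x y
      using that abs by (auto simp: to_field_def eq_fract) (metis abs)
  qed
qed

text \<open>The field is at hand only for the structure fixed in advance. So an arbitrary
  countermodel is exchanged for the one whose numbers were chosen, possibly a countermodel to
  another claim, and that one is refuted in its own field; this is why all claims are treated
  together.\<close>

lemma no_countermodel: "\<not> countermodel M"
proof
  assume "countermodel M"
  then obtain M where M: "countermodel M" "nat_structure = nat_part M"
    using nat_structure(2) by blast
  then obtain L T \<chi> where claim: "(L, T, \<chi>) \<in> claims" and LT: "model M L T" and \<chi>: "\<not> sat M [] \<chi>"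
    by (auto simp: countermodel_def)
  have A: "arithmetic_field M L T to_field"
    using claims_arithmetic [OF claim LT] M(2) by (rule arithmetic_field_countermodel)
  from claim consider
      (ns) "L = UNIV" "P0_ax \<subseteq> T" "\<chi> = Imp MCT_ns Pi01_TRANS"
    | (iff) "L = UNIV" "T = P0_ax \<union> {st_downward}" "\<chi> = Iff MCT_ns Pi01_TRANS"
    | (ef) "\<chi> = Con (Forall ty2 (Imp (MU (Var 0)) (MCT_ef (rate_c \<cdot> Var 0))))
          (Forall ty_rate (Imp (MCT_ef (Var 0)) (MU (zero_of_rate_c \<cdot> Var 0))))"
    by (auto simp: claims_def)
  then show False
  proof cases
    case ns
    interpret nonstandard_field M T to_field
      using A ns by (simp add: nonstandard_field_def nonstandard_field_axioms_def)
    show False using \<chi> trans_of_closeness by (simp add: ns sat_MCT_ns sat_Pi01_TRANS)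
  next
    case iff
    interpret nonstandard_field M T to_field
      using A iff by (auto simp: nonstandard_field_def nonstandard_field_axioms_def)
    have "sat M [] st_downward"
      using axiom [of st_downward "[]" "[]"] iff
      by (simp add: wff_def st_downward_def Forall_st_def Le_def)
    then have "\<forall>a\<in>N. std M Nt a \<longrightarrow> (\<forall>b\<in>N. mn b a = zer \<longrightarrow> std M Nt b)"
      by (simp add: st_downward_def Forall_st_def Le_def del: mn_zer_iff)
    then have "std M Nt b" if "a \<in> N" "b \<in> N" "std M Nt a" "to_field b \<le> to_field a" for a b
      using that mn_zer_iff by blast
    then have "ns_closeness" if "\<forall>f\<in>D ty1. std M ty1 f \<longrightarrow> trans_at f"
      using closeness_of_trans that by blast
    then show False
      using \<chi> trans_of_closeness by (auto simp: iff sat_MCT_ns sat_Pi01_TRANS)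
  next
    case ef
    interpret arithmetic_field M L T to_field by (rule A)
    have rate: "app M (ev M [] rate_c) \<mu> \<in> dom M ty_rate" if "\<mu> \<in> dom M ty2" for \<mu>
      using ev_dom [of "[ty2]" "[\<mu>]" "rate_c \<cdot> Var 0" ty_rate] that by simp
    show False
      using \<chi> rate MCT_rate_of_MU MU_of_MCT_rate by (auto simp: ef)
  qed
qed

lemma claims_provable:
  assumes "(L, T, \<chi>) \<in> claims"
  shows "prv L T [] [] \<chi>"
proof (rule completeness)
  show "language L" "EPRA_ax \<subseteq> T" "L \<subseteq> Collect internal \<or> T_st \<subseteq> T"
    using assms language_UNIV language_internal by (auto simp: claims_def P0_ax_def)
  show "sub_closed T"
    using assms sub_closed_P0_ax sub_closed_EPRA_ax sub_closed_Un [OF sub_closed_P0_ax sub_closed_st_downward]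
    by (auto simp: claims_def)
  have real: "well_typed \<Gamma> (is_real x)" if "typ_of \<Gamma> x = Some ty1" for \<Gamma> x
    using that by (simp add: is_real_def qlt_def Lt_def Le_def q_defs typ_of_lift)
  have mono: "well_typed \<Gamma> (mono_bounded c)" if "typ_of \<Gamma> c = Some ty_seq" for \<Gamma> c
    using that real [of "Nt # \<Gamma>" "lift c \<cdot> Var 0"]
    by (simp add: mono_bounded_def real_le_def real_of_rat_def qle_def Le_def q_defs typ_of_lift)
  have "well_typed [] MCT_ns" "well_typed [] Pi01_TRANS"
    using mono [of "[ty_seq]" "Var 0"]
    by (simp_all add: MCT_ns_def Pi01_TRANS_def Forall_st_def real_approx_def q2_def qinv_def numeral_2_eq_2)
  moreover have "well_typed [] st_downward"
    by (simp add: st_downward_def Forall_st_def Le_def)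
  moreover have "well_typed \<Gamma> (MCT_ef t)" if "typ_of \<Gamma> t = Some ty_rate" for \<Gamma> t
    using that mono [of "Nt # ty_seq # \<Gamma>" "Var 1"]
    by (simp add: MCT_ef_def Let_def real_le_def real_absdiff_def real_of_rat_def qle_def Le_def
        q_defs typ_of_lift eval_nat_numeral)
  moreover have "internal (MCT_ef t)" for t
    by (simp add: MCT_ef_def mono_bounded_def is_real_def real_le_def qlt_def qle_def Lt_def Le_def Let_def)
  moreover have "well_typed \<Gamma> (MU \<mu>)" if "typ_of \<Gamma> \<mu> = Some ty2" for \<Gamma> \<mu>
    using that by (simp add: MU_def typ_of_lift)
  moreover have "internal (MU \<mu>)" for \<mu>
    by (simp add: MU_def)
  ultimately show "wff L [] \<chi>"
    using assms by (auto simp: claims_def wff_def)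
  show "sat M [] \<chi>" if "model M L T" for M :: "nat struct"
    using that assms no_countermodel [of M] by (auto simp: countermodel_def)
qed

theorem theorem4p1:
  shows "(P0_ax \<turnstile>st Imp MCT_ns Pi01_TRANS) \<and>
    (P0_ax \<union> {st_downward} \<turnstile>st Iff MCT_ns Pi01_TRANS) \<and>
    (\<exists>s u. closed_tm s (ty2 \<Rrightarrow> ty_rate) \<and> closed_tm u (ty_rate \<Rrightarrow> ty2) \<and>
       (EPRA \<turnstile> Con (Forall ty2 (Imp (MU (Var 0)) (MCT_ef (s \<cdot> Var 0))))
                  (Forall ty_rate (Imp (MCT_ef (Var 0)) (MU (u \<cdot> Var 0))))))"
  unfolding st_proves_def EPRA_proves_def
proof (intro conjI exI)
  show "closed_tm rate_c (ty2 \<Rrightarrow> ty_rate)" "closed_tm zero_of_rate_c (ty_rate \<Rrightarrow> ty2)"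
    by (simp_all add: closed_tm_def)
qed (rule claims_provable, simp add: claims_def)+

end
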